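(* Let $1\le k\le n$, let $M$ be a proper kernel, let $R(f)=\|M_f\|_{n-k}$, and let $I:\mathcal{G}'_k\cup\mathcal{S}(\mathbb{R}^n)\to\mathbb{R}^+$ be such that for any sequence $\{f_i\}\subseteq\mathcal{S}(\mathbb{R}^n)$ with $T_{f_i}\to^* f\in\mathcal{G}'_k$ one has $\lim_{i\to\infty}I(f_i)=I(f)$. If $\operatorname{rsol}(I,R)\neq\emptyset$, then $$\operatorname{Arg}\min_{f\in\mathcal{G}'_k}I(f)\ \cap\ \mathcal{B}_k\ \subseteq\ \operatorname{rsol}(I,R).$$
   Context: $\mathcal{S}(\mathbb{R}^n)$ is the (complex) Schwartz space, $\mathcal{S}'(\mathbb{R}^n)$ the tempered distributions with the weak topology; $\to^*$ is weak convergence of sequences. A Schwartz function $f$ is identified with the distribution $T_f:\phi\mapsto\int f\phi$. $\mathbb{R}^+$ is the set of nonnegative reals. For $g\in\mathcal{S}'(\mathbb{R}^k)$, $g\otimes\delta^{n-k}$ is its tensor product with the $(n-k)$-dimensional Dirac delta at the origin. For $h\in\mathcal{S}'(\mathbb{R}^n)$ and orthogonal $U$, $\langle h_U,\phi\rangle=\langle h,\psi\rangle$ with $\psi(\mathbf{x})=\phi(U^T\mathbf{x})$. With $\mathcal{O}(n)=\{U\in\mathbb{R}^{n\times n}:U^TU=I_n\}$, $\mathcal{G}'_k=\{(g\otimes\delta^{n-k})_U: g\in\mathcal{S}'(\mathbb{R}^k),\ U\in\mathcal{O}(n)\}$ and $\mathcal{G}_k=\{(T_g\otimes\delta^{n-k})_U: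 g\in\mathcal{S}(\mathbb{R}^k),\ U\in\mathcal{O}(n)\}$. Proper kernel: for $M:\mathbb{R}^n\times\mathbb{R}^n\to\mathbb{C}$ let $\mathrm{O}_M[f](\mathbf{x})=\int M(\mathbf{x},\mathbf{y})f(\mathbf{y})\,d\mathbf{y}$. $M$ is a proper kernel if (1) $\mathrm{O}_M:L_2(\mathbb{R}^n)\to L_2(\mathbb{R}^n)$ is a properly defined, strictly positive, self-adjoint operator (strictly positive: $\langle f,\mathrm{O}_M[f]\rangle_{L_2}>0$ for $f\ne0$); (2) $M$ is bounded; (3) $\operatorname{Range}[\mathrm{O}_M]\cap\mathcal{S}(\mathbb{R}^n)$ is dense in $\mathcal{S}(\mathbb{R}^n)$ with its standard topology. For $f,g\in L_1(\mathbb{R}^n)$, $\langle f|M|g\rangle=\iint f(\mathbf{x})^*M(\mathbf{x},\mathbf{y})g(\mathbf{y})\,d\mathbf{x}\,d\mathbf{y}$. For $f,g\in\mathcal{S}'(\mathbb{R}^n)$, with $G^n_\epsilon(\mathbf{x})=(2\pi\epsilon^2)^{-n/2}e^{-\|\mathbf{x}\|^2/(2\epsilon^2)}$, $\langle f|M|g\rangle$ is defined if there are $f_\epsilon,g_\epsilon\in L_1(\mathbb{R}^n)$ with $T_{f_\epsilon}=f*G^n_\epsilon$, $T_{g_\epsilon}=g*G^n_\epsilon$ and $\lim_{\epsilon\to0}\langle f_\epsilon|M|g_\epsilon\rangle$ exists and is finite; its value is that limit. $M_f=[\operatorname{Re}\langle x_if|M|x_jf\rangle]_{1\le i,j\le n}$.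 For a positive semidefinite $A\in\mathbb{R}^{n\times n}$ with eigenvalues $\lambda_1\ge\dots\ge\lambda_n$ (with multiplicities), the Ky Fan $m$-anti-norm is $\|A\|_m=\sum_{i=1}^m\lambda_{n+1-i}$. $\mathcal{B}_k=\bigcup_{C>0}\overline{\{f\in\mathcal{G}_k:\operatorname{Tr}(M_f)\le C\}}^*$, where $\overline{\Omega}^*$ is the sequential closure (the set of weak limits of sequences from $\Omega$) in $\mathcal{S}'(\mathbb{R}^n)$, and only $f$ for which $M_f$ is defined are considered. A sequence $\{f_i\}_{i\ge1}\subseteq\mathcal{S}(\mathbb{R}^n)$ regularly solves the penalized problem if there are $\epsilon_i\to+0$ and $\lambda_i\to+\infty$ with $I(f_i)+\lambda_iR(f_i)\le\inf_{f\in\mathcal{S}(\mathbb{R}^n)}\big(I(f)+\lambda_iR(f)\big)+\epsilon_i$ for all $i$, and $\operatorname{Tr}(M_{f_i})$ is bounded. For a sequence of distributions, $\operatorname{Lim}_{i\to\infty}h_i$ is the set of weak limits of its subsequences. $\operatorname{rsol}(I,R)=\bigcup\operatorname{Lim}_{i\to\infty}T_{f_i}$, the union being over all sequences $\{f_i\}$ that regularly solve the penalized problem. $\operatorname{Arg}\min$ denotes the set of all minimizers. *)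

theory Defs
  imports "HOL-Analysis.Analysis" "HOL-Computational_Algebra.Computational_Algebra"
begin

section \<open>Schwartz functions and tempered distributions\<close>

definition partial_deriv :: "'n::finite \<Rightarrow> (real^'n \<Rightarrow> complex) \<Rightarrow> real^'n \<Rightarrow> complex" where
  "partial_deriv i f x = frechet_derivative f (at x) (axis i 1)"

primrec iter_partial :: "'n::finite list \<Rightarrow> (real^'n \<Rightarrow> complex) \<Rightarrow> real^'n \<Rightarrow> complex" where
  "iter_partial [] f = f"
| "iter_partial (i # is) f = partial_deriv i (iter_partial is f)"

text \<open>Smoothness is expressed by differentiability of all iterated partial derivatives; a list of
  indices plays the role of a multi-index.\<close>

definition Schwartz :: "(real^'n::finite \<Rightarrow> complex) set" where
  "Schwartz = {f. \<forall>is. (\<forall>x. iter_partial is f differentiable (at x)) \<and>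
     (\<forall>N. bounded (range (\<lambda>x. (1 + norm x) ^ N * norm (iter_partial is f x))))}"

definition schwartz_seminorm :: "nat \<Rightarrow> 'n::finite list \<Rightarrow> (real^'n \<Rightarrow> complex) \<Rightarrow> real" where
  "schwartz_seminorm N is f = (SUP x. (1 + norm x) ^ N * norm (iter_partial is f x))"

definition schwartz_topology :: "(real^'n::finite \<Rightarrow> complex) topology" where
  "schwartz_topology = topology_generated_by
     {{g \<in> Schwartz. schwartz_seminorm N is (\<lambda>x. g x - f x) < e} | f N is e. f \<in> Schwartz \<and> 0 < e}"

text \<open>A distribution is a functional on Schwartz functions. It is encoded as a total function that
  is extensional on the set of Schwartz functions, so that equality of distributions is equality
  of functionals.\<close>

type_synonym 'n dist = "(real^'n \<Rightarrow> complex) \<Rightarrow> complex"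

definition tempered :: "'n::finite dist set" where
  "tempered = {T \<in> extensional Schwartz.
     (\<forall>\<phi>\<in>Schwartz. \<forall>\<psi>\<in>Schwartz. T (\<lambda>x. \<phi> x + \<psi> x) = T \<phi> + T \<psi>) \<and>
     (\<forall>c. \<forall>\<phi>\<in>Schwartz. T (\<lambda>x. c * \<phi> x) = c * T \<phi>) \<and>
     continuous_map schwartz_topology euclidean T}"

definition weak_topology :: "'n::finite dist topology" where
  "weak_topology = subtopology (product_topology (\<lambda>_. euclidean) Schwartz) tempered"

definition weak_conv :: "(nat \<Rightarrow> 'n::finite dist) \<Rightarrow> 'n dist \<Rightarrow> bool" where
  "weak_conv h T \<longleftrightarrow> limitin weak_topology h T sequentially"

definition seq_closure :: "'n::finite dist set \<Rightarrow> 'n dist set" where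
  "seq_closure \<Omega> = {T. \<exists>h. range h \<subseteq> \<Omega> \<and> weak_conv h T}"

definition Lim_set :: "(nat \<Rightarrow> 'n::finite dist) \<Rightarrow> 'n dist set" where
  "Lim_set h = {T. \<exists>r. strict_mono (r :: nat \<Rightarrow> nat) \<and> weak_conv (h \<circ> r) T}"

definition fun_dist :: "(real^'n::finite \<Rightarrow> complex) \<Rightarrow> 'n dist" where
  "fun_dist f = (\<lambda>\<phi>\<in>Schwartz. LINT x|lebesgue. f x * \<phi> x)"

definition coord_mult :: "'n::finite \<Rightarrow> 'n dist \<Rightarrow> 'n dist" where
  "coord_mult i T = (\<lambda>\<phi>\<in>Schwartz. T (\<lambda>x. of_real (x $ i) * \<phi> x))"

text \<open>Convolution with a function \<open>G\<close>: the functional is applied to the convolution of the test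
  function with the reflection of \<open>G\<close>.\<close>

definition dist_conv :: "'n::finite dist \<Rightarrow> (real^'n \<Rightarrow> complex) \<Rightarrow> 'n dist" where
  "dist_conv T G = (\<lambda>\<phi>\<in>Schwartz. T (\<lambda>x. LINT y|lebesgue. G (y - x) * \<phi> y))"

definition gaussian :: "real \<Rightarrow> real^'n::finite \<Rightarrow> complex" where
  "gaussian \<epsilon> x = of_real ((2 * pi * \<epsilon>\<^sup>2) powr (- real CARD('n) / 2) * exp (- (norm x)\<^sup>2 / (2 * \<epsilon>\<^sup>2)))"


section \<open>Distributions supported on $k$-dimensional subspaces\<close>

text \<open>The dimensions are \<open>n = CARD('n)\<close> and \<open>k = CARD('k)\<close>. An injection \<open>\<iota> :: 'k \<Rightarrow> 'n\<close> names the
  coordinates that are the first \<open>k\<close> ones; the remaining \<open>n - k\<close> coordinates carry the Dirac delta.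
  Thus the tensor product maps \<open>\<phi>\<close> to \<open>g\<close> applied to \<open>y \<mapsto> \<phi>(y, 0)\<close>.\<close>

definition embed :: "('k::finite \<Rightarrow> 'n::finite) \<Rightarrow> real^'k \<Rightarrow> real^'n" where
  "embed \<iota> y = (\<Sum>i\<in>UNIV. axis (\<iota> i) (y $ i))"

definition tensor_delta :: "('k::finite \<Rightarrow> 'n::finite) \<Rightarrow> 'k dist \<Rightarrow> 'n dist" where
  "tensor_delta \<iota> g = (\<lambda>\<phi>\<in>Schwartz. g (\<lambda>y. \<phi> (embed \<iota> y)))"

definition rotate_dist :: "real^'n^'n \<Rightarrow> 'n::finite dist \<Rightarrow> 'n dist" where
  "rotate_dist U h = (\<lambda>\<phi>\<in>Schwartz. h (\<lambda>x. \<phi> (transpose U *v x)))"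

definition G_tempered :: "('k::finite \<Rightarrow> 'n::finite) \<Rightarrow> 'n dist set" where
  "G_tempered \<iota> = {rotate_dist U (tensor_delta \<iota> g) | g U. g \<in> tempered \<and> orthogonal_matrix U}"

definition G_schwartz :: "('k::finite \<Rightarrow> 'n::finite) \<Rightarrow> 'n dist set" where
  "G_schwartz \<iota> =
     {rotate_dist U (tensor_delta \<iota> (fun_dist g)) | g U. g \<in> Schwartz \<and> orthogonal_matrix U}"


section \<open>Proper kernels\<close>

definition L2 :: "(real^'n::finite \<Rightarrow> complex) set" where
  "L2 = {f \<in> borel_measurable lebesgue. integrable lebesgue (\<lambda>x. (norm (f x))\<^sup>2)}"

definition L2_inner :: "(real^'n::finite \<Rightarrow> complex) \<Rightarrow> (real^'n \<Rightarrow> complex) \<Rightarrow> complex" where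
  "L2_inner f g = (LINT x|lebesgue. cnj (f x) * g x)"

definition kernel_op ::
  "((real^'n) \<times> (real^'n) \<Rightarrow> complex) \<Rightarrow> (real^'n::finite \<Rightarrow> complex) \<Rightarrow> real^'n \<Rightarrow> complex" where
  "kernel_op M f x = (LINT y|lebesgue. M (x, y) * f y)"

text \<open>The kernel is (Lebesgue) measurable and the operator is defined on all of \<open>L2\<close>, so that
  self-adjointness amounts to symmetry. Functions in \<open>L2\<close> are considered up to almost everywhere
  equality; in particular a Schwartz function is in the range if it agrees almost everywhere
  with an image.\<close>

definition proper_kernel :: "((real^'n::finite) \<times> (real^'n) \<Rightarrow> complex) \<Rightarrow> bool" where
  "proper_kernel M \<longleftrightarrow>
     M \<in> borel_measurable lebesgue \<and>
     (\<forall>f\<in>L2. (AE x in lebesgue. integrable lebesgue (\<lambda>y. M (x, y) * f y)) \<and> kernel_op M f \<in> L2) \<and>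
     (\<forall>f\<in>L2. \<forall>g\<in>L2. L2_inner (kernel_op M f) g = L2_inner f (kernel_op M g)) \<and>
     (\<forall>f\<in>L2. \<not> (AE x in lebesgue. f x = 0) \<longrightarrow>
        (\<exists>r>0. L2_inner f (kernel_op M f) = complex_of_real r)) \<and>
     bounded (range M) \<and>
     schwartz_topology closure_of
       {\<psi> \<in> Schwartz. \<exists>f\<in>L2. AE x in lebesgue. kernel_op M f x = \<psi> x} = Schwartz"


section \<open>The matrix of a distribution\<close>

definition L1_form :: "((real^'n::finite) \<times> (real^'n) \<Rightarrow> complex) \<Rightarrow>
    (real^'n \<Rightarrow> complex) \<Rightarrow> (real^'n \<Rightarrow> complex) \<Rightarrow> complex" where
  "L1_form M f g = (LINT (x, y)|lebesgue. cnj (f x) * M (x, y) * g y)"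

definition has_form :: "((real^'n::finite) \<times> (real^'n) \<Rightarrow> complex) \<Rightarrow>
    'n dist \<Rightarrow> 'n dist \<Rightarrow> complex \<Rightarrow> bool" where
  "has_form M f g c \<longleftrightarrow> (\<exists>f\<^sub>\<epsilon> g\<^sub>\<epsilon>.
     (\<forall>\<epsilon>>0. integrable lebesgue (f\<^sub>\<epsilon> \<epsilon>) \<and> fun_dist (f\<^sub>\<epsilon> \<epsilon>) = dist_conv f (gaussian \<epsilon>) \<and>
            integrable lebesgue (g\<^sub>\<epsilon> \<epsilon>) \<and> fun_dist (g\<^sub>\<epsilon> \<epsilon>) = dist_conv g (gaussian \<epsilon>)) \<and>
     ((\<lambda>\<epsilon>. L1_form M (f\<^sub>\<epsilon> \<epsilon>) (g\<^sub>\<epsilon> \<epsilon>)) \<longlongrightarrow> c) (at_right 0))"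

definition dist_form ::
  "((real^'n::finite) \<times> (real^'n) \<Rightarrow> complex) \<Rightarrow> 'n dist \<Rightarrow> 'n dist \<Rightarrow> complex" where
  "dist_form M f g = (THE c. has_form M f g c)"

definition M_mat :: "((real^'n::finite) \<times> (real^'n) \<Rightarrow> complex) \<Rightarrow> 'n dist \<Rightarrow> real^'n^'n" where
  "M_mat M f = (\<chi> i j. Re (dist_form M (coord_mult i f) (coord_mult j f)))"

definition M_mat_defined :: "((real^'n::finite) \<times> (real^'n) \<Rightarrow> complex) \<Rightarrow> 'n dist \<Rightarrow> bool" where
  "M_mat_defined M f \<longleftrightarrow> (\<forall>i j. \<exists>c. has_form M (coord_mult i f) (coord_mult j f) c)"

definition charac_poly :: "real^'n^'n::finite \<Rightarrow> real poly" where
  "charac_poly A = det (\<chi> i j. (if i = j then [:0, 1:] else 0) - [:A $ i $ j:])"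

text \<open>The sum of the \<open>m\<close> smallest eigenvalues, counted with multiplicities.\<close>

definition ky_fan_antinorm :: "nat \<Rightarrow> real^'n^'n::finite \<Rightarrow> real" where
  "ky_fan_antinorm m A = sum_list (take m (sorted_list_of_multiset (proots (charac_poly A))))"


section \<open>The penalized problem\<close>

definition B_set :: "((real^'n::finite) \<times> (real^'n) \<Rightarrow> complex) \<Rightarrow> ('k::finite \<Rightarrow> 'n) \<Rightarrow> 'n dist set" where
  "B_set M \<iota> = (\<Union>C\<in>{0<..}.
     seq_closure {f \<in> G_schwartz \<iota>. M_mat_defined M f \<and> trace (M_mat M f) \<le> C})"

text \<open>Functionals of a Schwartz function \<open>f\<close> are evaluated at the distribution \<open>fun_dist f\<close>.
  The infimum is taken in the extended reals, so no lower bound has to be presupposed.\<close>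

definition regularly_solves :: "((real^'n::finite) \<times> (real^'n) \<Rightarrow> complex) \<Rightarrow>
    ('n dist \<Rightarrow> real) \<Rightarrow> ('n dist \<Rightarrow> real) \<Rightarrow> (nat \<Rightarrow> real^'n \<Rightarrow> complex) \<Rightarrow> bool" where
  "regularly_solves M I R f \<longleftrightarrow>
     range f \<subseteq> Schwartz \<and>
     (\<exists>\<epsilon> \<Lambda>. filterlim \<epsilon> (at_right (0::real)) sequentially \<and> filterlim \<Lambda> at_top sequentially \<and>
        (\<forall>i. ereal (I (fun_dist (f i)) + \<Lambda> i * R (fun_dist (f i))) \<le>
             (INF g\<in>Schwartz. ereal (I (fun_dist g) + \<Lambda> i * R (fun_dist g))) + ereal (\<epsilon> i))) \<and>
     bounded (range (\<lambda>i. trace (M_mat M (fun_dist (f i)))))"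

definition rsol :: "((real^'n::finite) \<times> (real^'n) \<Rightarrow> complex) \<Rightarrow>
    ('n dist \<Rightarrow> real) \<Rightarrow> ('n dist \<Rightarrow> real) \<Rightarrow> 'n dist set" where
  "rsol M I R = (\<Union>f\<in>{f. regularly_solves M I R f}. Lim_set (\<lambda>i. fun_dist (f i)))"

end

theory Submission
  imports Defs "HOL-Probability.Sinc_Integral"
begin


text \<open>Write $m = n - k$ and let $f$ minimize $I$ over $\mathcal{G}'_k$ and lie in $\mathcal{B}_k$. Two facts connect the
penalty $R(g) = \|M_g\|_m$ on Schwartz functions with $\mathcal{G}'_k$.

(a) If $T_{h_i} \to^* T$ and $R(h_i) \to 0$, then $T \in \mathcal{G}'_k$ (\<open>weak_limit_in_G_tempered\<close>).
By Ky Fan's principle (\<open>ky_fan_attained\<close>) the number $R(h_i)$ is a sum of forms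
$\langle a | M | a \rangle$, where $a(x) = (u \cdot x) h_i(x)$ and $u$ runs through $m$ rows of an orthogonal
matrix $U_i$; every summand is nonnegative, so all of them tend to $0$. By the Cauchy-Schwarz
inequality for the positive form of $M$, the functions $a$ then tend to $0$ when they are paired
with the conjugate of any function in the range of $\mathrm{O}_M$. Along a subsequence the $U_i$ converge to an orthogonal matrix $U$,
so $(u \cdot x) T$ vanishes on a dense set of test functions, hence everywhere, for the
corresponding $m$ rows $u$ of $U$. A tempered distribution annihilated by these $m$ coordinates depends only on
the restriction of the test function to their common kernel (\<open>G_temperedI\<close>), which says that
it is $(g \otimes \delta^m)_U$ for a tempered $g$.

(b) An element $p$ of $\mathcal{G}_k$ with $M_p$ defined is approximated, uniformly on test
functions with bounded Lipschitz constant, by Schwartz functions $s$ for which $R(s)$ is arbitrarily small and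
$\operatorname{Tr} M_s$ is close to $\operatorname{Tr} M_p$ (\<open>G_schwartz_approx\<close>). The
functions $s = p * G_\epsilon$ do this: $x_i (p * G_\epsilon)$ differs from $(x_i p) * G_\epsilon$ by
$O(\epsilon)$ in $L_1$, and $M$ is bounded. In the $m$ directions $u$ normal to the subspace that carries
$p$ one has $(u \cdot x) p = 0$, so $\|(u \cdot x) s\|_1 = O(\epsilon)$ and $R(s) = O(\epsilon^2)$.

A sequence $(h_i)$ that witnesses $\operatorname{rsol}(I, R) \ne \emptyset$ satisfies $\lambda_i R(h_i) \le I(0) + \epsilon_i$,
because the zero function competes. Thus (a) applies to a weakly convergent subsequence: its limit $T$ lies in $\mathcal{G}'_k$ and
$I(h_i) \to I(T) \ge I(f)$ along it. So the infima of the penalized problems are eventually at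
least $I(f) - o(1)$. By (b), applied to a sequence in $\mathcal{G}_k$ that converges to $f$ with bounded traces,
there are Schwartz functions $s_i \to^* f$ with $\operatorname{Tr} M_{s_i}$ bounded and $R(s_i)$ so small that
$\lambda_i R(s_i) \to 0$. Then $I(s_i) + \lambda_i R(s_i) \to I(f)$, and $(s_i)$ regularly solves the
penalized problem.\<close>
section \<open>Calculus of Schwartz functions\<close>

text \<open>Partial derivatives of all orders are the primitive notion here; this lemma recovers from
them the total derivative, which the chain rule and the mean value inequality need.\<close>
lemma has_derivative_partials:
  fixes f :: "real^'n::finite \<Rightarrow> complex"
  assumes "f differentiable at x"
  shows "(f has_derivative (\<lambda>h. \<Sum>i\<in>UNIV. (h $ i) *\<^sub>R partial_deriv i f x)) (at x)"
proof -
  let ?D = "frechet_derivative f (at x)"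
  have D: "(f has_derivative ?D) (at x)" using assms frechet_derivative_works by blast
  interpret bounded_linear ?D using D by (rule has_derivative_bounded_linear)
  have "?D h = (\<Sum>i\<in>UNIV. (h $ i) *\<^sub>R partial_deriv i f x)" for h
  proof -
    have "?D h = ?D (\<Sum>i\<in>UNIV. (h $ i) *\<^sub>R axis i 1)"
      using basis_expansion[of h] by (simp add: scalar_mult_eq_scaleR)
    then show ?thesis by (simp add: sum scaleR partial_deriv_def)
  qed
  then have "?D = (\<lambda>h. \<Sum>i\<in>UNIV. (h $ i) *\<^sub>R partial_deriv i f x)" by (rule ext)
  with D show ?thesis by simp
qed

lemma partial_deriv_eqI:
  "(f has_derivative D) (at x) \<Longrightarrow> partial_deriv i f x = D (axis i 1)"
  unfolding partial_deriv_def by (simp add: frechet_derivative_at[symmetric])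

lemma partial_deriv_add:
  assumes "f differentiable at x" "g differentiable at x"
  shows "partial_deriv i (\<lambda>x. f x + g x) x = partial_deriv i f x + partial_deriv i g x"
  using assms unfolding frechet_derivative_works partial_deriv_def
  by (subst frechet_derivative_at[OF has_derivative_add, symmetric]) auto

lemma partial_deriv_diff:
  assumes "f differentiable at x" "g differentiable at x"
  shows "partial_deriv i (\<lambda>x. f x - g x) x = partial_deriv i f x - partial_deriv i g x"
  using assms unfolding frechet_derivative_works partial_deriv_def
  by (subst frechet_derivative_at[OF has_derivative_diff, symmetric]) auto

lemma partial_deriv_mult:
  assumes "f differentiable at x" "g differentiable at x"
  shows "partial_deriv i (\<lambda>x. f x * g x) x = partial_deriv i f x * g x + f x * partial_deriv i g x"
  using assms unfolding frechet_derivative_works partial_deriv_def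
  by (subst frechet_derivative_at[OF has_derivative_mult, symmetric]) auto

lemma partial_deriv_const [simp]: "partial_deriv i (\<lambda>x. c) = (\<lambda>x. 0)"
  by (rule ext) (simp add: partial_deriv_eqI[OF has_derivative_const])

lemma partial_deriv_cmult:
  "f differentiable at x \<Longrightarrow> partial_deriv i (\<lambda>x. c * f x) x = c * partial_deriv i f x"
  using partial_deriv_mult[of "\<lambda>_. c" x f i] by simp

lemma partial_deriv_bounded_linear:
  assumes "bounded_linear L" "f differentiable at x"
  shows "(\<lambda>x. L (f x)) differentiable at x \<and> partial_deriv i (\<lambda>x. L (f x)) x = L (partial_deriv i f x)"
proof -
  have "(f has_derivative frechet_derivative f (at x)) (at x)"
    using assms frechet_derivative_works by blast
  from bounded_linear.has_derivative[OF assms(1) this]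
  show ?thesis by (auto simp: partial_deriv_def differentiable_def dest: frechet_derivative_at[symmetric])
qed

lemma iter_partial_append: "iter_partial (is @ js) f = iter_partial is (iter_partial js f)"
  by (induction "is") auto

lemma Schwartz_differentiable: "f \<in> Schwartz \<Longrightarrow> iter_partial is f differentiable at x"
  by (simp add: Schwartz_def)

lemma Schwartz_differentiable0: "f \<in> Schwartz \<Longrightarrow> f differentiable at x"
  using Schwartz_differentiable[of f "[]"] by simp

lemma SchwartzI:
  assumes "\<And>is x. iter_partial is f differentiable at x"
    and "\<And>is N. \<exists>C. \<forall>x. (1 + norm x) ^ N * norm (iter_partial is f x) \<le> C"
  shows "f \<in> Schwartz"
  unfolding Schwartz_def mem_Collect_eq bounded_iff using assms by (auto simp: abs_mult)

text \<open>Membership in the Schwartz space is usually seen from a whole family of functions that is closed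
under partial differentiation. This principle spares the computation of iterated derivatives.\<close>
lemma Schwartz_coinduct [consumes 1, case_names differentiable decay deriv]:
  assumes "f \<in> F"
    and "\<And>f x. f \<in> F \<Longrightarrow> f differentiable at x"
    and "\<And>f N. f \<in> F \<Longrightarrow> \<exists>C. \<forall>x. (1 + norm x) ^ N * norm (f x) \<le> C"
    and "\<And>f i. f \<in> F \<Longrightarrow> partial_deriv i f \<in> F"
  shows "f \<in> Schwartz"
proof -
  have "iter_partial is f \<in> F" for "is" by (induction "is") (auto intro: assms)
  then show ?thesis by (intro SchwartzI) (auto intro: assms)
qed

lemma schwartz_seminorm_bdd:
  assumes "f \<in> Schwartz"
  shows "bdd_above (range (\<lambda>x. (1 + norm x) ^ N * norm (iter_partial is f x)))"
  using assms unfolding Schwartz_def by (auto intro!: bounded_imp_bdd_above)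

lemma schwartz_seminorm_ge:
  "f \<in> Schwartz \<Longrightarrow> (1 + norm x) ^ N * norm (iter_partial is f x) \<le> schwartz_seminorm N is f"
  unfolding schwartz_seminorm_def by (rule cSUP_upper[OF UNIV_I schwartz_seminorm_bdd])

lemma schwartz_seminorm_le:
  "(\<And>x. (1 + norm x) ^ N * norm (iter_partial is f x) \<le> C) \<Longrightarrow> schwartz_seminorm N is f \<le> C"
  unfolding schwartz_seminorm_def by (rule cSUP_least) auto

lemma schwartz_seminorm_nonneg: "f \<in> Schwartz \<Longrightarrow> 0 \<le> schwartz_seminorm N is f"
  by (rule order_trans[OF _ schwartz_seminorm_ge[of f 0]]) auto

lemma Schwartz_norm_le: "f \<in> Schwartz \<Longrightarrow> norm (iter_partial is f x) \<le> schwartz_seminorm N is f / (1 + norm x) ^ N"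
  using schwartz_seminorm_ge[of f x N "is"] by (simp add: field_simps add_pos_nonneg)

lemma Schwartz_iter_partial: "f \<in> Schwartz \<Longrightarrow> iter_partial is f \<in> Schwartz"
  by (simp add: Schwartz_def iter_partial_append[symmetric])

lemma Schwartz_partial_deriv: "f \<in> Schwartz \<Longrightarrow> partial_deriv i f \<in> Schwartz"
  using Schwartz_iter_partial[of f "[i]"] by simp

lemma Schwartz_continuous: "f \<in> Schwartz \<Longrightarrow> continuous_on A f"
  by (meson Schwartz_differentiable0 differentiable_imp_continuous_within continuous_at_imp_continuous_on)

lemma Schwartz_measurable [measurable_dest]: "f \<in> Schwartz \<Longrightarrow> f \<in> borel_measurable borel"
  by (simp add: Schwartz_continuous borel_measurable_continuous_onI)

lemma Schwartz_decay: "f \<in> Schwartz \<Longrightarrow> \<exists>C. \<forall>x. (1 + norm x) ^ N * norm (f x) \<le> C"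
  using schwartz_seminorm_ge[of f _ N "[]"] by auto

lemma Schwartz_zero: "(\<lambda>_. 0) \<in> Schwartz"
  by (rule Schwartz_coinduct[where F = "{\<lambda>_. 0}"]) auto

lemma Schwartz_add:
  assumes "f \<in> Schwartz" "g \<in> Schwartz" shows "(\<lambda>x. f x + g x) \<in> Schwartz"
proof (rule Schwartz_coinduct[where F = "{\<lambda>x. f x + g x | f g. f \<in> Schwartz \<and> g \<in> Schwartz}"])
  show "(\<lambda>x. f x + g x) \<in> {\<lambda>x. f x + g x | f g. f \<in> Schwartz \<and> g \<in> Schwartz}" using assms by blast
next
  fix h x assume "h \<in> {\<lambda>x. f x + g x | f g. f \<in> Schwartz \<and> g \<in> Schwartz}"
  then show "h differentiable at x" using Schwartz_differentiable0 differentiable_add by fastforce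
next
  fix h N assume "h \<in> {\<lambda>x. f x + g x | f g. f \<in> Schwartz \<and> g \<in> Schwartz}"
  then obtain f g where h: "h = (\<lambda>x. f x + g x)" "f \<in> Schwartz" "g \<in> Schwartz" by auto
  from Schwartz_decay[OF h(2), of N] Schwartz_decay[OF h(3), of N] obtain C D where
    CD: "\<And>x. (1 + norm x) ^ N * norm (f x) \<le> C" "\<And>x. (1 + norm x) ^ N * norm (g x) \<le> D" by blast
  have "(1 + norm x) ^ N * norm (h x) \<le> C + D" for x
  proof -
    have "(1 + norm x) ^ N * norm (h x) \<le> (1 + norm x) ^ N * (norm (f x) + norm (g x))"
      unfolding h by (intro mult_left_mono norm_triangle_ineq) auto
    then show ?thesis using CD[of x] by (simp add: distrib_left)
  qed
  then show "\<exists>C. \<forall>x. (1 + norm x) ^ N * norm (h x) \<le> C" by blast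
next
  fix h i assume "h \<in> {\<lambda>x. f x + g x | f g. f \<in> Schwartz \<and> g \<in> Schwartz}"
  then obtain f g where h: "h = (\<lambda>x. f x + g x)" "f \<in> Schwartz" "g \<in> Schwartz" by auto
  then have "partial_deriv i h = (\<lambda>x. partial_deriv i f x + partial_deriv i g x)"
    by (auto simp: partial_deriv_add Schwartz_differentiable0)
  with h show "partial_deriv i h \<in> {\<lambda>x. f x + g x | f g. f \<in> Schwartz \<and> g \<in> Schwartz}"
    using Schwartz_partial_deriv by blast
qed

text \<open>Multiplication by a constant and complex conjugation are both instances of the following.\<close>

lemma Schwartz_bounded_linear:
  assumes L: "bounded_linear L" and f: "f \<in> Schwartz"
  shows "(\<lambda>x. L (f x)) \<in> Schwartz"
    and "iter_partial is (\<lambda>x. L (f x)) = (\<lambda>x. L (iter_partial is f x))"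
proof -
  have *: "iter_partial is (\<lambda>x. L (f x)) = (\<lambda>x. L (iter_partial is f x))" for "is"
    by (induction "is") (auto simp: partial_deriv_bounded_linear[OF L Schwartz_differentiable[OF f]])
  then show "iter_partial is (\<lambda>x. L (f x)) = (\<lambda>x. L (iter_partial is f x))" .
  obtain K where K: "\<And>x. norm (L x) \<le> norm x * K" "K > 0"
    using bounded_linear.pos_bounded[OF L] by blast
  show "(\<lambda>x. L (f x)) \<in> Schwartz"
  proof (rule SchwartzI)
    fix "is" x show "iter_partial is (\<lambda>x. L (f x)) differentiable at x"
      by (simp add: * partial_deriv_bounded_linear[OF L Schwartz_differentiable[OF f]])
    fix N
    have "(1 + norm x) ^ N * norm (L (iter_partial is f x)) \<le> schwartz_seminorm N is f * K" for x
    proof -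
      have "(1 + norm x) ^ N * norm (L (iter_partial is f x)) \<le> (1 + norm x) ^ N * (norm (iter_partial is f x) * K)"
        by (intro mult_left_mono K) auto
      also have "\<dots> \<le> schwartz_seminorm N is f * K"
        using schwartz_seminorm_ge[OF f, of x N "is"] K(2) by (simp flip: mult.assoc)
      finally show ?thesis .
    qed
    then show "\<exists>C. \<forall>x. (1 + norm x) ^ N * norm (iter_partial is (\<lambda>x. L (f x)) x) \<le> C"
      unfolding * by blast
  qed
qed

lemmas Schwartz_cmult = Schwartz_bounded_linear(1)[OF bounded_linear_mult_right]
lemmas Schwartz_cnj = Schwartz_bounded_linear(1)[OF bounded_linear_cnj]

lemma Schwartz_diff:
  assumes "f \<in> Schwartz" "g \<in> Schwartz" shows "(\<lambda>x. f x - g x) \<in> Schwartz"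
  using Schwartz_add[OF assms(1) Schwartz_cmult[OF assms(2), of "-1"]] by simp

lemma Schwartz_sum:
  assumes "\<And>i. i \<in> A \<Longrightarrow> f i \<in> Schwartz" shows "(\<lambda>x. \<Sum>i\<in>A. f i x) \<in> Schwartz"
  using assms by (induction A rule: infinite_finite_induct) (auto intro: Schwartz_zero Schwartz_add)

lemma iter_partial_diff:
  assumes "f \<in> Schwartz" "g \<in> Schwartz"
  shows "iter_partial is (\<lambda>x. f x - g x) = (\<lambda>x. iter_partial is f x - iter_partial is g x)"
  by (induction "is") (auto simp: partial_deriv_diff Schwartz_differentiable assms)

lemma schwartz_seminorm_triangle:
  assumes "f \<in> Schwartz" "g \<in> Schwartz" "h \<in> Schwartz"
  shows "schwartz_seminorm N is (\<lambda>x. f x - h x) \<le>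
    schwartz_seminorm N is (\<lambda>x. f x - g x) + schwartz_seminorm N is (\<lambda>x. g x - h x)"
proof (rule schwartz_seminorm_le)
  fix x
  have "(1 + norm x) ^ N * norm (iter_partial is (\<lambda>x. f x - h x) x) \<le>
     (1 + norm x) ^ N * (norm (iter_partial is (\<lambda>x. f x - g x) x) + norm (iter_partial is (\<lambda>x. g x - h x) x))"
    by (intro mult_left_mono) (auto simp: iter_partial_diff assms intro: order_trans[OF _ norm_triangle_ineq])
  also have "\<dots> \<le> schwartz_seminorm N is (\<lambda>x. f x - g x) + schwartz_seminorm N is (\<lambda>x. g x - h x)"
    unfolding distrib_left by (intro add_mono schwartz_seminorm_ge Schwartz_diff assms)
  finally show "(1 + norm x) ^ N * norm (iter_partial is (\<lambda>x. f x - h x) x) \<le>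
    schwartz_seminorm N is (\<lambda>x. f x - g x) + schwartz_seminorm N is (\<lambda>x. g x - h x)" .
qed

subsection \<open>Products with multipliers and composition with linear maps\<close>

text \<open>A class of multipliers \<open>m\<close> that turn a Schwartz function \<open>\<psi>\<close> into a Schwartz function
\<open>x \<mapsto> m x * \<psi> (P x)\<close>. The rapid decay of \<open>\<psi>\<close> pays for any power of \<open>1 + norm (P x)\<close>, so \<open>m\<close> has to be rapidly decreasing only in the
directions that \<open>P\<close> does not see. The class covers coordinate multiplication, rotations
(\<open>m = 1\<close>), restriction to a subspace, and extension from a subspace by a Gaussian in the normal
directions.\<close>
definition schwartz_along :: "(real^'m::finite \<Rightarrow> real^'n::finite) \<Rightarrow> (real^'m \<Rightarrow> complex) \<Rightarrow> bool" where
  "schwartz_along P m \<longleftrightarrow> (\<forall>is. (\<forall>x. iter_partial is m differentiable at x) \<and>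
     (\<forall>N. \<exists>C K. 0 \<le> C \<and> (\<forall>x. (1 + norm x) ^ N * norm (iter_partial is m x) \<le> C * (1 + norm (P x)) ^ K)))"

lemma schwartz_along_partial_deriv:
  "schwartz_along P m \<Longrightarrow> schwartz_along P (partial_deriv i m)"
  unfolding schwartz_along_def using iter_partial_append[of _ "[i]" m] by simp metis

lemma schwartz_along_differentiable: "schwartz_along P m \<Longrightarrow> m differentiable at x"
  unfolding schwartz_along_def by (metis iter_partial.simps(1))

lemma schwartz_along_decay:
  "schwartz_along P m \<Longrightarrow> \<exists>C K. 0 \<le> C \<and> (\<forall>x. (1 + norm x) ^ N * norm (m x) \<le> C * (1 + norm (P x)) ^ K)"
  unfolding schwartz_along_def by (metis iter_partial.simps(1))

lemma schwartz_along_coinduct [consumes 1, case_names differentiable decay deriv]: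
  assumes "m \<in> F"
    and "\<And>m x. m \<in> F \<Longrightarrow> m differentiable at x"
    and "\<And>m N. m \<in> F \<Longrightarrow> \<exists>C K. 0 \<le> C \<and> (\<forall>x. (1 + norm x) ^ N * norm (m x) \<le> C * (1 + norm (P x)) ^ K)"
    and "\<And>m i. m \<in> F \<Longrightarrow> partial_deriv i m \<in> F"
  shows "schwartz_along P m"
proof -
  have "iter_partial is m \<in> F" for "is" by (induction "is") (auto intro: assms)
  then show ?thesis unfolding schwartz_along_def using assms(2,3) by blast
qed

lemma schwartz_along_cmult:
  assumes "schwartz_along P m" shows "schwartz_along P (\<lambda>x. c * m x)"
proof (rule schwartz_along_coinduct[where F = "{\<lambda>x. c * m x | m. schwartz_along P m}"])
  show "(\<lambda>x. c * m x) \<in> {\<lambda>x. c * m x | m. schwartz_along P m}" using assms by blast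
next
  fix h x assume "h \<in> {\<lambda>x. c * m x | m. schwartz_along P m}"
  then show "h differentiable at x" by (auto intro!: derivative_intros dest: schwartz_along_differentiable)
next
  fix h N assume "h \<in> {\<lambda>x. c * m x | m. schwartz_along P m}"
  then obtain m where m: "h = (\<lambda>x. c * m x)" "schwartz_along P m" by auto
  from schwartz_along_decay[OF m(2), of N] obtain C K where
    C: "0 \<le> C" "\<And>x. (1 + norm x) ^ N * norm (m x) \<le> C * (1 + norm (P x)) ^ K" by blast
  show "\<exists>C K. 0 \<le> C \<and> (\<forall>x. (1 + norm x) ^ N * norm (h x) \<le> C * (1 + norm (P x)) ^ K)"
    using mult_left_mono[OF C(2) norm_ge_zero[of c]] C(1)
    by (intro exI[of _ "norm c * C"] exI[of _ K]) (auto simp: m norm_mult mult_ac)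
next
  fix h i assume "h \<in> {\<lambda>x. c * m x | m. schwartz_along P m}"
  then obtain m where m: "h = (\<lambda>x. c * m x)" "schwartz_along P m" by auto
  then have "partial_deriv i h = (\<lambda>x. c * partial_deriv i m x)"
    by (auto simp: partial_deriv_cmult schwartz_along_differentiable)
  with m show "partial_deriv i h \<in> {\<lambda>x. c * m x | m. schwartz_along P m}"
    using schwartz_along_partial_deriv by blast
qed

text \<open>A class of operators that contains \<open>\<psi> \<mapsto> (\<lambda>x. m x * \<psi> (P x))\<close> and is closed under partial
differentiation of the result. Working with the class keeps the Leibniz and chain rules of all
orders implicit.\<close>
inductive composite_diffop ::
  "(real^'m::finite \<Rightarrow> real^'n::finite) \<Rightarrow> ((real^'n \<Rightarrow> complex) \<Rightarrow> real^'m \<Rightarrow> complex) \<Rightarrow> bool" for P where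
  atom: "schwartz_along P m \<Longrightarrow> composite_diffop P (\<lambda>\<psi> x. m x * iter_partial js \<psi> (P x))"
| add: "composite_diffop P L \<Longrightarrow> composite_diffop P L' \<Longrightarrow> composite_diffop P (\<lambda>\<psi> x. L \<psi> x + L' \<psi> x)"

lemma schwartz_along_zero: "schwartz_along P (\<lambda>x. 0)"
  by (rule schwartz_along_coinduct[where F = "{\<lambda>_. 0}"]) (auto intro!: exI[of _ 0])

lemma composite_diffop_sum:
  assumes "\<And>i. i \<in> A \<Longrightarrow> composite_diffop P (L i)"
  shows "composite_diffop P (\<lambda>\<psi> x. \<Sum>i\<in>A. L i \<psi> x)"
  using assms
proof (induction A rule: infinite_finite_induct)
  case (insert i A)
  then show ?case by (auto intro: composite_diffop.add)
qed (use composite_diffop.atom[OF schwartz_along_zero] in auto)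

lemma has_derivative_comp_linear:
  fixes \<psi> :: "real^'n::finite \<Rightarrow> complex"
  assumes "bounded_linear P" "\<psi> differentiable (at (P x))"
  shows "((\<lambda>x. \<psi> (P x)) has_derivative (\<lambda>h. \<Sum>l\<in>UNIV. (P h $ l) *\<^sub>R partial_deriv l \<psi> (P x))) (at x)"
  using diff_chain_at[OF bounded_linear_imp_has_derivative[OF assms(1)] has_derivative_partials[OF assms(2)]]
  by (simp add: o_def)

lemma composite_diffop_deriv:
  assumes "composite_diffop P L" and P: "bounded_linear P"
  shows "\<exists>L'. composite_diffop P L' \<and>
    (\<forall>\<psi>\<in>Schwartz. (\<forall>x. L \<psi> differentiable at x) \<and> partial_deriv i (L \<psi>) = L' \<psi>)"
  using assms(1)
proof induction
  case (atom m js)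
  let ?L' = "\<lambda>\<psi> x. partial_deriv i m x * iter_partial js \<psi> (P x) +
    (\<Sum>l\<in>UNIV. (of_real (P (axis i 1) $ l) * m x) * iter_partial (l # js) \<psi> (P x))"
  have "composite_diffop P ?L'"
    by (intro composite_diffop.add composite_diffop_sum composite_diffop.atom
        schwartz_along_partial_deriv schwartz_along_cmult atom)
  moreover have "(\<lambda>x. m x * iter_partial js \<psi> (P x)) differentiable at x \<and>
      partial_deriv i (\<lambda>x. m x * iter_partial js \<psi> (P x)) x = ?L' \<psi> x" if "\<psi> \<in> Schwartz" for \<psi> x
  proof -
    note d = has_derivative_comp_linear[OF P Schwartz_differentiable[OF that, of js]]
    have "(\<lambda>x. iter_partial js \<psi> (P x)) differentiable at x" using d by (auto simp: differentiable_def)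
    then show ?thesis using schwartz_along_differentiable[OF atom]
      by (auto simp: partial_deriv_mult partial_deriv_eqI[OF d] sum_distrib_left scaleR_conv_of_real mult_ac)
  qed
  ultimately show ?case by (intro exI[of _ ?L']) auto
next
  case (add L1 L2)
  then obtain L1' L2' where "composite_diffop P L1'" "composite_diffop P L2'"
    "\<forall>\<psi>\<in>Schwartz. (\<forall>x. L1 \<psi> differentiable at x) \<and> partial_deriv i (L1 \<psi>) = L1' \<psi>"
    "\<forall>\<psi>\<in>Schwartz. (\<forall>x. L2 \<psi> differentiable at x) \<and> partial_deriv i (L2 \<psi>) = L2' \<psi>" by blast
  then show ?case
    by (intro exI[of _ "\<lambda>\<psi> x. L1' \<psi> x + L2' \<psi> x"]) (auto intro: composite_diffop.add simp: partial_deriv_add fun_eq_iff)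
qed

lemma composite_diffop_bound:
  assumes "composite_diffop P L"
  shows "\<exists>J C. finite J \<and> 0 \<le> C \<and> (\<forall>\<psi>\<in>Schwartz. \<forall>x. (1 + norm x) ^ N * norm (L \<psi> x) \<le> C * (\<Sum>(K, js)\<in>J. schwartz_seminorm K js \<psi>))"
  using assms
proof induction
  case (atom m js)
  from schwartz_along_decay[OF atom, of N] obtain C K where
    C: "0 \<le> C" "\<And>x. (1 + norm x) ^ N * norm (m x) \<le> C * (1 + norm (P x)) ^ K" by blast
  have "(1 + norm x) ^ N * norm (m x * iter_partial js \<psi> (P x)) \<le> C * schwartz_seminorm K js \<psi>"
    if "\<psi> \<in> Schwartz" for \<psi> x
  proof -
    have "(1 + norm x) ^ N * norm (m x * iter_partial js \<psi> (P x))
        \<le> (C * (1 + norm (P x)) ^ K) * norm (iter_partial js \<psi> (P x))"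
      using mult_right_mono[OF C(2)[of x] norm_ge_zero[of "iter_partial js \<psi> (P x)"]] by (simp add: norm_mult mult_ac)
    also have "\<dots> \<le> C * schwartz_seminorm K js \<psi>"
      unfolding mult.assoc by (intro mult_left_mono C schwartz_seminorm_ge that)
    finally show ?thesis .
  qed
  then show ?case using C(1) by (intro exI[of _ "{(K, js)}"] exI[of _ C]) auto
next
  case (add L1 L2)
  from add.IH(1) obtain J1 C1 where J1: "finite J1" "0 \<le> C1"
    "\<forall>\<psi>\<in>Schwartz. \<forall>x. (1 + norm x) ^ N * norm (L1 \<psi> x) \<le> C1 * (\<Sum>(K, js)\<in>J1. schwartz_seminorm K js \<psi>)"
    by (elim exE conjE) (rule that)
  from add.IH(2) obtain J2 C2 where J2: "finite J2" "0 \<le> C2"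
    "\<forall>\<psi>\<in>Schwartz. \<forall>x. (1 + norm x) ^ N * norm (L2 \<psi> x) \<le> C2 * (\<Sum>(K, js)\<in>J2. schwartz_seminorm K js \<psi>)"
    by (elim exE conjE) (rule that)
  note J = J1(1,2) J2(1,2) J1(3)[rule_format] J2(3)[rule_format]
  have "(1 + norm x) ^ N * norm (L1 \<psi> x + L2 \<psi> x) \<le> (C1 + C2) * (\<Sum>(K, js)\<in>J1 \<union> J2. schwartz_seminorm K js \<psi>)"
    if \<psi>: "\<psi> \<in> Schwartz" for \<psi> x
  proof -
    have le: "(\<Sum>(K, js)\<in>J. schwartz_seminorm K js \<psi>) \<le> (\<Sum>(K, js)\<in>J1 \<union> J2. schwartz_seminorm K js \<psi>)"
      if "J \<subseteq> J1 \<union> J2" for J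
      by (rule sum_mono2) (use J1(1) J2(1) that \<psi> in \<open>auto intro: schwartz_seminorm_nonneg\<close>)
    have "(1 + norm x) ^ N * norm (L1 \<psi> x + L2 \<psi> x) \<le> (1 + norm x) ^ N * (norm (L1 \<psi> x) + norm (L2 \<psi> x))"
      by (intro mult_left_mono norm_triangle_ineq) auto
    also have "\<dots> \<le> C1 * (\<Sum>(K, js)\<in>J1. schwartz_seminorm K js \<psi>) + C2 * (\<Sum>(K, js)\<in>J2. schwartz_seminorm K js \<psi>)"
      unfolding distrib_left using \<psi> by (intro add_mono J)
    also have "\<dots> \<le> (C1 + C2) * (\<Sum>(K, js)\<in>J1 \<union> J2. schwartz_seminorm K js \<psi>)"
      unfolding distrib_right by (intro add_mono mult_left_mono le J1(2) J2(2)) auto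
    finally show ?thesis .
  qed
  then show ?case using J1(1,2) J2(1,2)
    by (intro exI[of _ "J1 \<union> J2"] exI[of _ "C1 + C2"] conjI ballI allI) auto
qed

lemma composite_diffop_iter_partial:
  assumes "composite_diffop P L" "bounded_linear P"
  shows "\<exists>L'. composite_diffop P L' \<and> (\<forall>\<psi>\<in>Schwartz. iter_partial is (L \<psi>) = L' \<psi>)"
proof (induction "is")
  case Nil
  then show ?case using assms by auto
next
  case (Cons i "is")
  then obtain L' where L': "composite_diffop P L'" "\<forall>\<psi>\<in>Schwartz. iter_partial is (L \<psi>) = L' \<psi>" by blast
  from composite_diffop_deriv[OF this(1) assms(2), of i] obtain L'' where
    "composite_diffop P L''" "\<forall>\<psi>\<in>Schwartz. partial_deriv i (L' \<psi>) = L'' \<psi>" by blast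
  with L' show ?case by (intro exI[of _ L'']) auto
qed

text \<open>Every derivative of the product is a \<open>composite_diffop\<close>, and for these the seminorm estimate is
immediate. The estimate is linear in the seminorms of \<open>\<psi>\<close>, which gives continuity later.\<close>
theorem Schwartz_mult_comp:
  assumes m: "schwartz_along P m" and P: "bounded_linear P"
  shows "\<psi> \<in> Schwartz \<Longrightarrow> (\<lambda>x. m x * \<psi> (P x)) \<in> Schwartz"
    and "\<exists>J C. finite J \<and> 0 \<le> C \<and> (\<forall>\<psi>\<in>Schwartz.
      schwartz_seminorm N is (\<lambda>x. m x * \<psi> (P x)) \<le> C * (\<Sum>(K, js)\<in>J. schwartz_seminorm K js \<psi>))"
proof -
  let ?L = "\<lambda>\<psi> x. m x * \<psi> (P x)"
  have L: "composite_diffop P ?L" using composite_diffop.atom[OF m, of "[]"] by simp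
  have bd: "\<exists>J C. finite J \<and> 0 \<le> C \<and> (\<forall>\<psi>\<in>Schwartz. \<forall>x. (1 + norm x) ^ N * norm (iter_partial is (?L \<psi>) x) \<le>
      C * (\<Sum>(K, js)\<in>J. schwartz_seminorm K js \<psi>))" for N "is"
  proof -
    from composite_diffop_iter_partial[OF L P, of "is"] obtain L' where
      L': "composite_diffop P L'" "\<forall>\<psi>\<in>Schwartz. iter_partial is (?L \<psi>) = L' \<psi>" by blast
    then show ?thesis using composite_diffop_bound[OF L'(1), of N] by simp
  qed
  then show "\<exists>J C. finite J \<and> 0 \<le> C \<and> (\<forall>\<psi>\<in>Schwartz.
      schwartz_seminorm N is (?L \<psi>) \<le> C * (\<Sum>(K, js)\<in>J. schwartz_seminorm K js \<psi>))"
    by (meson schwartz_seminorm_le)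
  assume \<psi>: "\<psi> \<in> Schwartz"
  show "?L \<psi> \<in> Schwartz"
  proof (rule SchwartzI)
    fix "is" x N
    from composite_diffop_iter_partial[OF L P, of "is"] obtain L' where
      L': "composite_diffop P L'" "\<forall>\<psi>\<in>Schwartz. iter_partial is (?L \<psi>) = L' \<psi>" by blast
    then show "iter_partial is (?L \<psi>) differentiable at x"
      using composite_diffop_deriv[OF L'(1) P] \<psi> by auto
    show "\<exists>C. \<forall>x. (1 + norm x) ^ N * norm (iter_partial is (?L \<psi>) x) \<le> C" using bd[of N "is"] \<psi> by blast
  qed
qed

subsection \<open>Polynomials times Gaussians\<close>

lemma real_polynomial_function_has_derivative:
  assumes "real_polynomial_function p"
  shows "\<exists>p'. real_polynomial_function p' \<and> (\<forall>x. \<exists>D. (p has_derivative D) (at x) \<and> D v = p' x)"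
  using assms
proof induction
  case (linear f)
  then show ?case by (intro exI[of _ "\<lambda>_. f v"]) (auto intro: bounded_linear_imp_has_derivative)
next
  case (const c)
  then show ?case by (intro exI[of _ "\<lambda>_. 0"]) (auto intro!: exI[of _ "\<lambda>_. 0"])
next
  case (add f g)
  then obtain f' g' where *: "real_polynomial_function f'" "real_polynomial_function g'"
    "\<And>x. \<exists>D. (f has_derivative D) (at x) \<and> D v = f' x" "\<And>x. \<exists>D. (g has_derivative D) (at x) \<and> D v = g' x" by blast
  have "\<exists>D. ((\<lambda>x. f x + g x) has_derivative D) (at x) \<and> D v = f' x + g' x" for x
  proof -
    from *(3,4)[of x] obtain D E where "(f has_derivative D) (at x)" "D v = f' x" "(g has_derivative E) (at x)" "E v = g' x" by blast
    with has_derivative_add[of f D "at x" g E] show ?thesis by (intro exI[of _ "\<lambda>h. D h + E h"]) auto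
  qed
  then show ?case using *(1,2) by (intro exI[of _ "\<lambda>x. f' x + g' x"]) auto
next
  case (mult f g)
  then obtain f' g' where *: "real_polynomial_function f'" "real_polynomial_function g'"
    "\<And>x. \<exists>D. (f has_derivative D) (at x) \<and> D v = f' x" "\<And>x. \<exists>D. (g has_derivative D) (at x) \<and> D v = g' x" by blast
  have "\<exists>D. ((\<lambda>x. f x * g x) has_derivative D) (at x) \<and> D v = f x * g' x + f' x * g x" for x
  proof -
    from *(3,4)[of x] obtain D E where "(f has_derivative D) (at x)" "D v = f' x" "(g has_derivative E) (at x)" "E v = g' x" by blast
    with has_derivative_mult[of f D x UNIV g E] show ?thesis
      by (intro exI[of _ "\<lambda>h. f x * E h + D h * g x"]) auto
  qed
  then show ?case using *(1,2) mult.hyps by (intro exI[of _ "\<lambda>x. f x * g' x + f' x * g x"]) auto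
qed

lemma real_polynomial_function_growth:
  assumes "real_polynomial_function p"
  shows "\<exists>C K. 0 \<le> C \<and> (\<forall>x. \<bar>p x\<bar> \<le> C * (1 + norm x) ^ K)"
  using assms
proof induction
  case (linear f)
  from bounded_linear.pos_bounded[OF this] obtain C where C: "C > 0" "\<And>x. norm (f x) \<le> norm x * C" by blast
  have "\<bar>f x\<bar> \<le> C * (1 + norm x) ^ 1" for x
    using C(2)[of x] C(1) by (simp add: algebra_simps)
  then show ?case using C(1) by (metis less_imp_le)
next
  case (const c)
  then show ?case by (intro exI[of _ "\<bar>c\<bar>"] exI[of _ 0]) auto
next
  case (add f g)
  then obtain C K D L where *: "0 \<le> C" "0 \<le> D" "\<And>x. \<bar>f x\<bar> \<le> C * (1 + norm x) ^ K" "\<And>x. \<bar>g x\<bar> \<le> D * (1 + norm x) ^ L" by blast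
  have "\<bar>f x + g x\<bar> \<le> (C + D) * (1 + norm x) ^ (K + L)" for x
  proof -
    have "\<bar>f x + g x\<bar> \<le> C * (1 + norm x) ^ K + D * (1 + norm x) ^ L" using *(3,4)[of x] by linarith
    also have "\<dots> \<le> C * (1 + norm x) ^ (K + L) + D * (1 + norm x) ^ (K + L)"
      using * by (intro add_mono mult_left_mono power_increasing) auto
    finally show ?thesis by (simp add: distrib_right)
  qed
  then show ?case using * by (intro exI[of _ "C + D"] exI[of _ "K + L"]) auto
next
  case (mult f g)
  then obtain C K D L where *: "0 \<le> C" "0 \<le> D" "\<And>x. \<bar>f x\<bar> \<le> C * (1 + norm x) ^ K" "\<And>x. \<bar>g x\<bar> \<le> D * (1 + norm x) ^ L" by blast
  have "\<bar>f x * g x\<bar> \<le> (C * D) * (1 + norm x) ^ (K + L)" for x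
    using mult_mono[OF *(3,4)[of x]] * by (simp add: abs_mult power_add mult_ac)
  then show ?case using * by (intro exI[of _ "C * D"] exI[of _ "K + L"]) auto
qed

text \<open>A polynomial times \<open>exp (- q)\<close> has partial derivatives of the same shape, and polynomial
factors are absorbed by the decay of \<open>exp (- q)\<close>, so only the growth of \<open>exp (- q)\<close> itself has to be checked.\<close>
lemma schwartz_along_poly_exp:
  fixes P :: "real^'m::finite \<Rightarrow> real^'n::finite"
  assumes p: "real_polynomial_function p" and q: "real_polynomial_function q"
    and dec: "\<And>N. \<exists>C K. 0 \<le> C \<and> (\<forall>x. (1 + norm x) ^ N * exp (- q x) \<le> C * (1 + norm (P x)) ^ K)"
  shows "schwartz_along P (\<lambda>x. of_real (p x * exp (- q x)))"
proof (rule schwartz_along_coinduct[where F = "{\<lambda>x. complex_of_real (p x * exp (- q x)) | p. real_polynomial_function p}"])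
  show "(\<lambda>x. of_real (p x * exp (- q x))) \<in> {\<lambda>x. complex_of_real (p x * exp (- q x)) | p. real_polynomial_function p}"
    using p by blast
next
  fix h N assume "h \<in> {\<lambda>x. complex_of_real (p x * exp (- q x)) | p. real_polynomial_function p}"
  then obtain p where h: "h = (\<lambda>x. complex_of_real (p x * exp (- q x)))" "real_polynomial_function p" by auto
  from real_polynomial_function_growth[OF h(2)] obtain C K where
    C: "0 \<le> C" "\<And>x. \<bar>p x\<bar> \<le> C * (1 + norm x) ^ K" by blast
  from dec[of "N + K"] obtain D L where
    D: "0 \<le> D" "\<And>x. (1 + norm x) ^ (N + K) * exp (- q x) \<le> D * (1 + norm (P x)) ^ L" by blast
  have "(1 + norm x) ^ N * norm (h x) \<le> C * D * (1 + norm (P x)) ^ L" for x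
  proof -
    have "(1 + norm x) ^ N * norm (h x) = (1 + norm x) ^ N * (\<bar>p x\<bar> * exp (- q x))"
      unfolding h norm_of_real by (simp add: abs_mult)
    also have "\<dots> \<le> (1 + norm x) ^ N * (C * (1 + norm x) ^ K * exp (- q x))"
      by (intro mult_left_mono mult_right_mono C) auto
    also have "\<dots> = C * ((1 + norm x) ^ (N + K) * exp (- q x))" by (simp add: power_add mult_ac)
    also have "\<dots> \<le> C * (D * (1 + norm (P x)) ^ L)" by (intro mult_left_mono C D)
    finally show ?thesis by (simp add: mult_ac)
  qed
  then show "\<exists>C K. 0 \<le> C \<and> (\<forall>x. (1 + norm x) ^ N * norm (h x) \<le> C * (1 + norm (P x)) ^ K)"
    using C(1) D(1) by (intro exI[of _ "C * D"] exI[of _ L]) auto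
next
  have key: "\<exists>p'. real_polynomial_function p' \<and> (\<forall>x. \<exists>D. ((\<lambda>x. of_real (p x * exp (- q x)) :: complex) has_derivative D) (at x) \<and>
      D v = of_real (p' x * exp (- q x)))" if p: "real_polynomial_function p" for p v
  proof -
    from real_polynomial_function_has_derivative[OF p, of v] real_polynomial_function_has_derivative[OF q, of v]
    obtain p' q' where *: "real_polynomial_function p'" "real_polynomial_function q'"
      "\<And>x. \<exists>D. (p has_derivative D) (at x) \<and> D v = p' x" "\<And>x. \<exists>D. (q has_derivative D) (at x) \<and> D v = q' x" by blast
    have "\<exists>D. ((\<lambda>x. of_real (p x * exp (- q x)) :: complex) has_derivative D) (at x) \<and>
      D v = of_real ((p' x - p x * q' x) * exp (- q x))" for x
    proof -
      from *(3,4)[of x] obtain D E where [derivative_intros]: "(p has_derivative D) (at x)" "(q has_derivative E) (at x)"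
        and DE: "D v = p' x" "E v = q' x" by blast
      have "((\<lambda>x. of_real (p x * exp (- q x)) :: complex) has_derivative
         (\<lambda>h. of_real (p x * (exp (- q x) * - E h) + D h * exp (- q x)))) (at x)"
        by (rule derivative_eq_intros refl | simp add: mult_ac)+
      then show ?thesis using DE
        by (intro exI[of _ "\<lambda>h. of_real (p x * (exp (- q x) * - E h) + D h * exp (- q x))"]) (auto simp: algebra_simps)
    qed
    then show ?thesis using p * by (intro exI[of _ "\<lambda>x. p' x - p x * q' x"]) auto
  qed
  fix h assume "h \<in> {\<lambda>x. complex_of_real (p x * exp (- q x)) | p. real_polynomial_function p}"
  then obtain p where h: "h = (\<lambda>x. complex_of_real (p x * exp (- q x)))" "real_polynomial_function p" by auto
  show "h differentiable at x" for x
    using key[OF h(2), of 0] unfolding h differentiable_def by blast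
  fix i
  from key[OF h(2), of "axis i 1"] obtain p' where p': "real_polynomial_function p'"
    "\<And>x. \<exists>D. (h has_derivative D) (at x) \<and> D (axis i 1) = of_real (p' x * exp (- q x))"
    unfolding h by blast
  have "partial_deriv i h = (\<lambda>x. complex_of_real (p' x * exp (- q x)))"
    using p'(2) by (metis (no_types, lifting) ext partial_deriv_eqI)
  with p'(1) show "partial_deriv i h \<in> {\<lambda>x. complex_of_real (p x * exp (- q x)) | p. real_polynomial_function p}" by blast
qed

lemma schwartz_along_poly:
  fixes P :: "real^'m::finite \<Rightarrow> real^'n::finite"
  assumes "real_polynomial_function p" "\<And>x. norm x \<le> c * norm (P x)" "0 \<le> c"
  shows "schwartz_along P (\<lambda>x. of_real (p x))"
proof -
  have "(1 + norm x) ^ N * exp (- 0) \<le> (1 + c) ^ N * (1 + norm (P x)) ^ N" for x N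
  proof -
    have "1 + norm x \<le> (1 + c) * (1 + norm (P x))"
      using assms(2)[of x] assms(3) norm_ge_zero[of "P x"] by (simp add: algebra_simps del: norm_ge_zero)
    then show ?thesis by (simp flip: power_mult_distrib add: power_mono)
  qed
  then have "\<exists>C K. 0 \<le> C \<and> (\<forall>x. (1 + norm x) ^ N * exp (- 0) \<le> C * (1 + norm (P x)) ^ K)" for N
    using assms(3) by (intro exI[of _ "(1 + c) ^ N"] exI[of _ N]) auto
  from schwartz_along_poly_exp[OF assms(1) real_polynomial_function.intros(2) this] show ?thesis by simp
qed

lemma Schwartz_comp_linear:
  assumes "bounded_linear P" "\<And>x. norm x \<le> c * norm (P x)" "0 \<le> c" "\<psi> \<in> Schwartz"
  shows "(\<lambda>x. \<psi> (P x)) \<in> Schwartz"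
  using Schwartz_mult_comp(1)[OF schwartz_along_poly[OF real_polynomial_function.intros(2)[of 1] assms(2,3)] assms(1,4)] by simp

lemma Schwartz_mult_coord:
  assumes "\<psi> \<in> Schwartz" shows "(\<lambda>x. of_real (x $ i) * \<psi> x) \<in> Schwartz"
proof -
  have "schwartz_along (\<lambda>x. x) (\<lambda>x. of_real (x $ i))"
    by (rule schwartz_along_poly[where c = 1]) (auto intro: real_polynomial_function.intros(1))
  from Schwartz_mult_comp(1)[OF this bounded_linear_ident assms] show ?thesis .
qed

text \<open>One term of the exponential series gives \<open>(1 + r) ^ N \<le> fact N * exp (1 + r)\<close>, and completing the
square gives \<open>r - c * r\<^sup>2 \<le> 1 / (4 * c)\<close>.\<close>
lemma power_exp_gaussian_le:
  fixes r c :: real assumes "0 \<le> r" "0 < c"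
  shows "(1 + r) ^ N * exp (- (c * r\<^sup>2)) \<le> fact N * exp (1 + 1 / (4 * c))"
proof -
  have "(1 + r) ^ N / fact N \<le> exp (1 + r)"
  proof -
    have "(\<Sum>n\<in>{N}. (1 + r) ^ n / fact n) \<le> (\<Sum>n. (1 + r) ^ n / fact n)"
      using assms summable_exp[of "1 + r"] by (intro sum_le_suminf) (auto simp: divide_inverse mult.commute)
    then show ?thesis by (simp add: exp_def divide_inverse mult.commute)
  qed
  then have "(1 + r) ^ N \<le> fact N * exp (1 + r)" by (simp add: field_simps)
  then have "(1 + r) ^ N * exp (- (c * r\<^sup>2)) \<le> fact N * (exp (1 + r) * exp (- (c * r\<^sup>2)))"
    by (simp flip: mult.assoc)
  also have "exp (1 + r) * exp (- (c * r\<^sup>2)) \<le> exp (1 + 1 / (4 * c))"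
  proof -
    have "0 \<le> c * (r - 1 / (2 * c))\<^sup>2" using assms by simp
    also have "\<dots> = c * r\<^sup>2 - r + 1 / (4 * c)" using assms by (simp add: power2_eq_square field_simps)
    finally show ?thesis by (simp flip: exp_add)
  qed
  finally show ?thesis by simp
qed

lemma real_polynomial_function_norm_sq:
  assumes "bounded_linear (Q :: real^'m::finite \<Rightarrow> real^'n::finite)"
  shows "real_polynomial_function (\<lambda>x. c * (norm (Q x))\<^sup>2)"
proof -
  have "(\<lambda>x. c * (norm (Q x))\<^sup>2) = (\<lambda>x. c * (\<Sum>i\<in>UNIV. (Q x $ i)\<^sup>2))"
    unfolding power2_norm_eq_inner inner_vec_def by (simp add: power2_eq_square)
  moreover have "real_polynomial_function (\<lambda>x. c * (\<Sum>i\<in>UNIV. (Q x $ i)\<^sup>2))"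
    by (intro real_polynomial_function.intros(4) real_polynomial_function.intros(2) real_polynomial_function_sum
        real_polynomial_function_power real_polynomial_function.intros(1)
        bounded_linear_compose[OF bounded_linear_vec_nth assms]) auto
  ultimately show ?thesis by simp
qed

lemma schwartz_along_gaussian:
  fixes P :: "real^'m::finite \<Rightarrow> real^'n::finite" and Q :: "real^'m \<Rightarrow> real^'l::finite"
  assumes Q: "bounded_linear Q" and PQ: "\<And>x. norm x \<le> norm (P x) + norm (Q x)" and c: "0 < c"
  shows "schwartz_along P (\<lambda>x. of_real (exp (- (c * (norm (Q x))\<^sup>2))))"
proof -
  have "(1 + norm x) ^ N * exp (- (c * (norm (Q x))\<^sup>2)) \<le> (fact N * exp (1 + 1 / (4 * c))) * (1 + norm (P x)) ^ N" for x N
  proof -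
    have "1 + norm x \<le> (1 + norm (P x)) * (1 + norm (Q x))"
      using PQ[of x] mult_nonneg_nonneg[OF norm_ge_zero[of "P x"] norm_ge_zero[of "Q x"]] unfolding distrib_left distrib_right by linarith
    then have "(1 + norm x) ^ N \<le> (1 + norm (P x)) ^ N * (1 + norm (Q x)) ^ N"
      by (simp flip: power_mult_distrib add: power_mono)
    then have "(1 + norm x) ^ N * exp (- (c * (norm (Q x))\<^sup>2)) \<le> (1 + norm (P x)) ^ N * ((1 + norm (Q x)) ^ N * exp (- (c * (norm (Q x))\<^sup>2)))"
      by (simp flip: mult.assoc)
    also have "\<dots> \<le> (1 + norm (P x)) ^ N * (fact N * exp (1 + 1 / (4 * c)))"
      using c by (intro mult_left_mono power_exp_gaussian_le) auto
    finally show ?thesis by (simp add: mult_ac)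
  qed
  then have "\<exists>C K. 0 \<le> C \<and> (\<forall>x. (1 + norm x) ^ N * exp (- (c * (norm (Q x))\<^sup>2)) \<le> C * (1 + norm (P x)) ^ K)" for N
    by (intro exI[of _ "fact N * exp (1 + 1 / (4 * c))"] exI[of _ N]) auto
  from schwartz_along_poly_exp[OF real_polynomial_function.intros(2)[of 1] real_polynomial_function_norm_sq[OF Q] this]
  show ?thesis by simp
qed

lemma Schwartz_if_along_zero:
  assumes "schwartz_along (\<lambda>x. 0 :: real^'n::finite) m" shows "m \<in> Schwartz"
proof (rule SchwartzI)
  fix "is" x show "iter_partial is m differentiable at x"
    using assms unfolding schwartz_along_def by blast
  fix N
  have "schwartz_along (\<lambda>x. 0 :: real^'n) (iter_partial is m)"
    by (induction "is") (auto intro: assms schwartz_along_partial_deriv)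
  from schwartz_along_decay[OF this, of N] obtain C K where
    *: "\<forall>x. (1 + norm x) ^ N * norm (iter_partial is m x) \<le> C * (1 + norm (0 :: real^'n)) ^ K"
    by (elim exE conjE) (rule that)
  have "\<forall>x. (1 + norm x) ^ N * norm (iter_partial is m x) \<le> C" using * by simp
  then show "\<exists>C. \<forall>x. (1 + norm x) ^ N * norm (iter_partial is m x) \<le> C" by (rule exI)
qed

lemma gaussian_Schwartz:
  assumes "0 < \<epsilon>" shows "(gaussian \<epsilon> :: real^'n::finite \<Rightarrow> complex) \<in> Schwartz"
proof -
  have "schwartz_along (\<lambda>x. 0 :: real^'n) (\<lambda>x :: real^'n. of_real (exp (- (inverse (2 * \<epsilon>\<^sup>2) * (norm x)\<^sup>2))))"
    by (rule schwartz_along_gaussian) (use assms in auto)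
  from Schwartz_cmult[OF Schwartz_if_along_zero[OF this], of "of_real ((2 * pi * \<epsilon>\<^sup>2) powr (- real CARD('n) / 2))"]
  moreover have "- (norm x)\<^sup>2 / (2 * \<epsilon>\<^sup>2) = - (inverse (2 * \<epsilon>\<^sup>2) * (norm x)\<^sup>2)" for x :: "real^'n"
    unfolding divide_inverse mult_minus_left by (subst mult.commute) (rule refl)
  ultimately show ?thesis unfolding gaussian_def[abs_def] of_real_mult by (simp only:)
qed


subsection \<open>Differentiation under the integral sign\<close>

lemma norm_integral_le:
  fixes f :: "'u \<Rightarrow> 'b::{banach, second_countable_topology}"
  assumes "integrable \<mu> f" "integrable \<mu> g" "\<And>u. u \<in> space \<mu> \<Longrightarrow> norm (f u) \<le> g u"
  shows "norm (\<integral>u. f u \<partial>\<mu>) \<le> (\<integral>u. g u \<partial>\<mu>)"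
  by (rule order_trans[OF integral_norm_bound integral_mono]) (use assms in auto)

text \<open>A quadratic bound on the remainder, integrable in the parameter, survives integration. For Schwartz
functions such a bound holds uniformly in the base point, so differentiation under the integral
sign reduces to integrating one inequality.\<close>
lemma has_derivative_integral_quadratic:
  fixes F :: "'u \<Rightarrow> real^'n::finite \<Rightarrow> complex"
  assumes F: "\<And>x. integrable \<mu> (\<lambda>u. F u x)" and F': "\<And>i. integrable \<mu> (F' i)" and b: "integrable \<mu> b"
    and rem: "\<And>u h. u \<in> space \<mu> \<Longrightarrow>
      norm (F u (x + h) - F u x - (\<Sum>i\<in>UNIV. (h $ i) *\<^sub>R F' i u)) \<le> b u * (norm h)\<^sup>2"
  shows "((\<lambda>x. \<integral>u. F u x \<partial>\<mu>) has_derivative (\<lambda>h. \<Sum>i\<in>UNIV. (h $ i) *\<^sub>R (\<integral>u. F' i u \<partial>\<mu>))) (at x)"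
  unfolding has_derivative_at
proof
  show "bounded_linear (\<lambda>h. \<Sum>i\<in>UNIV. (h $ i) *\<^sub>R (\<integral>u. F' i u \<partial>\<mu>))"
    by (intro bounded_linear_sum bounded_linear_compose[OF bounded_linear_scaleR_left] bounded_linear_vec_nth)
  have le: "norm ((\<integral>u. F u (x + h) \<partial>\<mu>) - (\<integral>u. F u x \<partial>\<mu>) - (\<Sum>i\<in>UNIV. (h $ i) *\<^sub>R (\<integral>u. F' i u \<partial>\<mu>))) / norm h
      \<le> (\<integral>u. b u \<partial>\<mu>) * norm h" for h
  proof (cases "h = 0")
    case False
    have "(\<integral>u. F u (x + h) \<partial>\<mu>) - (\<integral>u. F u x \<partial>\<mu>) - (\<Sum>i\<in>UNIV. (h $ i) *\<^sub>R (\<integral>u. F' i u \<partial>\<mu>))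
       = (\<integral>u. F u (x + h) - F u x - (\<Sum>i\<in>UNIV. (h $ i) *\<^sub>R F' i u) \<partial>\<mu>)"
      using F F' by (simp add: Bochner_Integration.integral_sum)
    also have "norm \<dots> \<le> (\<integral>u. b u * (norm h)\<^sup>2 \<partial>\<mu>)"
      by (rule norm_integral_le) (use F F' b rem in \<open>auto intro!: Bochner_Integration.integrable_sum\<close>)
    also have "\<dots> = (\<integral>u. b u \<partial>\<mu>) * norm h * norm h" by (simp add: power2_eq_square)
    finally show ?thesis using False by (simp add: field_simps)
  qed simp
  have lim: "(\<lambda>h :: real^'n. (\<integral>u. b u \<partial>\<mu>) * norm h) \<midarrow>0\<rightarrow> 0"
    by (intro tendsto_mult_right_zero tendsto_norm_zero tendsto_ident_at)
  show "(\<lambda>h. norm ((\<integral>u. F u (x + h) \<partial>\<mu>) - (\<integral>u. F u x \<partial>\<mu>) - (\<Sum>i\<in>UNIV. (h $ i) *\<^sub>R (\<integral>u. F' i u \<partial>\<mu>))) / norm h) \<midarrow>0\<rightarrow> 0"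
    by (rule tendsto_sandwich[OF _ _ tendsto_const lim]) (auto intro!: always_eventually simp: le)
qed

lemma onorm_partials_le:
  fixes c :: "'n::finite \<Rightarrow> complex"
  assumes "\<And>i. norm (c i) \<le> C i"
  shows "onorm (\<lambda>h :: real^'n. \<Sum>i\<in>UNIV. (h $ i) *\<^sub>R c i) \<le> (\<Sum>i\<in>UNIV. C i)"
proof (rule onorm_le)
  fix h :: "real^'n"
  have "norm (\<Sum>i\<in>UNIV. (h $ i) *\<^sub>R c i) \<le> (\<Sum>i\<in>UNIV. norm h * C i)"
    using assms component_le_norm_cart[of h] by (intro order_trans[OF norm_sum] sum_mono) (auto intro!: mult_mono)
  then show "norm (\<Sum>i\<in>UNIV. (h $ i) *\<^sub>R c i) \<le> (\<Sum>i\<in>UNIV. C i) * norm h"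
    unfolding sum_distrib_left[symmetric] by (simp only: mult.commute)
qed

lemma Schwartz_bounded:
  "f \<in> Schwartz \<Longrightarrow> norm (f x) \<le> schwartz_seminorm 0 [] f"
  using schwartz_seminorm_ge[of f x 0 "[]"] by simp

lemma Schwartz_Lipschitz:
  fixes f :: "real^'n::finite \<Rightarrow> complex"
  assumes f: "f \<in> Schwartz"
  shows "\<exists>L\<ge>0. \<forall>x y. norm (f x - f y) \<le> L * norm (x - y)"
proof -
  let ?C = "\<lambda>i. schwartz_seminorm 0 [] (partial_deriv i f)"
  have "norm (f x - f y) \<le> (\<Sum>i\<in>UNIV. ?C i) * norm (x - y)" for x y
    by (rule differentiable_bound[of UNIV, OF _ has_derivative_partials[OF Schwartz_differentiable0[OF f]]])
       (auto intro!: onorm_partials_le Schwartz_bounded Schwartz_partial_deriv f)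
  then show ?thesis
    by (intro exI[of _ "\<Sum>i\<in>UNIV. ?C i"] conjI sum_nonneg schwartz_seminorm_nonneg Schwartz_partial_deriv f) auto
qed

text \<open>The first derivatives are Lipschitz, so the mean value inequality applied to the function minus its
linear part gains a second factor \<open>norm h\<close>.\<close>
lemma Schwartz_quadratic_remainder:
  fixes f :: "real^'n::finite \<Rightarrow> complex"
  assumes f: "f \<in> Schwartz"
  shows "\<exists>B\<ge>0. \<forall>a h. norm (f (a + h) - f a - (\<Sum>i\<in>UNIV. (h $ i) *\<^sub>R partial_deriv i f a)) \<le> B * (norm h)\<^sup>2"
proof -
  have "\<forall>i. \<exists>L\<ge>0. \<forall>x y. norm (partial_deriv i f x - partial_deriv i f y) \<le> L * norm (x - y)"
    using Schwartz_Lipschitz[OF Schwartz_partial_deriv[OF f]] by blast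
  then obtain L where L: "\<And>i. L i \<ge> 0" "\<And>i x y. norm (partial_deriv i f x - partial_deriv i f y) \<le> L i * norm (x - y)"
    by metis
  have "norm (f (a + h) - f a - (\<Sum>i\<in>UNIV. (h $ i) *\<^sub>R partial_deriv i f a)) \<le> (\<Sum>i\<in>UNIV. L i) * (norm h)\<^sup>2" for a h
  proof -
    let ?g = "\<lambda>y. f y - (\<Sum>i\<in>UNIV. (y $ i) *\<^sub>R partial_deriv i f a)"
    have lin: "bounded_linear (\<lambda>h :: real^'n. \<Sum>i\<in>UNIV. (h $ i) *\<^sub>R partial_deriv i f a)"
      by (intro bounded_linear_sum bounded_linear_compose[OF bounded_linear_scaleR_left] bounded_linear_vec_nth)
    have der: "(?g has_derivative (\<lambda>h. \<Sum>i\<in>UNIV. (h $ i) *\<^sub>R (partial_deriv i f y - partial_deriv i f a))) (at y within cball a (norm h))" for y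
      unfolding scaleR_diff_right sum_subtractf
      by (rule has_derivative_at_withinI)
         (intro has_derivative_diff has_derivative_partials Schwartz_differentiable0 f bounded_linear_imp_has_derivative lin)
    have bound: "norm (?g (a + h) - ?g a) \<le> (\<Sum>i\<in>UNIV. L i * norm h) * norm (a + h - a)"
    proof (rule differentiable_bound[OF convex_cball der])
      fix y assume "y \<in> cball a (norm h)"
      then have "norm (y - a) \<le> norm h" by (simp add: dist_norm norm_minus_commute)
      then have "norm (partial_deriv i f y - partial_deriv i f a) \<le> L i * norm h" for i
        using L(1)[of i] by (intro order_trans[OF L(2)] mult_left_mono) auto
      then show "onorm (\<lambda>h. \<Sum>i\<in>UNIV. (h $ i) *\<^sub>R (partial_deriv i f y - partial_deriv i f a)) \<le> (\<Sum>i\<in>UNIV. L i * norm h)"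
        by (rule onorm_partials_le)
    qed (auto simp: dist_norm)
    have eq: "?g (a + h) - ?g a = f (a + h) - f a - (\<Sum>i\<in>UNIV. (h $ i) *\<^sub>R partial_deriv i f a)"
      by (simp add: scaleR_add_left sum.distrib)
    show ?thesis using bound unfolding eq by (simp add: sum_distrib_right power2_eq_square mult.assoc)
  qed
  then show ?thesis using L(1) by (intro exI[of _ "\<Sum>i\<in>UNIV. L i"] conjI sum_nonneg) auto
qed

text \<open>Superpositions of translates. Convolutions of Schwartz functions and densities on subspaces
convolved with a Gaussian are both of this form.\<close>
lemma Schwartz_average:
  fixes \<psi> :: "real^'n::finite \<Rightarrow> complex" and c :: "'u \<Rightarrow> real^'n"
  assumes \<psi>: "\<psi> \<in> Schwartz" and [measurable]: "a \<in> borel_measurable \<mu>" "c \<in> borel_measurable \<mu>"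
    and int: "\<And>N. integrable \<mu> (\<lambda>u. (1 + norm (c u)) ^ N * norm (a u :: complex))"
  shows "(\<lambda>x. \<integral>u. a u * \<psi> (x - c u) \<partial>\<mu>) \<in> Schwartz"
proof -
  let ?A = "\<lambda>\<psi> x. \<integral>u. a u * \<psi> (x - c u) \<partial>\<mu>"
  have a: "integrable \<mu> (\<lambda>u. norm (a u))" using int[of 0] by simp
  have integ: "integrable \<mu> (\<lambda>u. a u * \<psi> (x - c u))" if \<psi>: "\<psi> \<in> Schwartz" for \<psi> x
  proof (rule Bochner_Integration.integrable_bound[OF integrable_mult_left[OF a, of "schwartz_seminorm 0 [] \<psi>"]])
    have [measurable]: "\<psi> \<in> borel_measurable borel" using \<psi> by (rule Schwartz_measurable)
    show "(\<lambda>u. a u * \<psi> (x - c u)) \<in> borel_measurable \<mu>" by measurable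
    show "AE u in \<mu>. norm (a u * \<psi> (x - c u)) \<le> norm (norm (a u) * schwartz_seminorm 0 [] \<psi>)"
      by (intro AE_I2) (auto simp: norm_mult abs_mult intro!: mult_left_mono order_trans[OF Schwartz_bounded[OF \<psi>]])
  qed
  have der: "(?A \<psi> has_derivative (\<lambda>h. \<Sum>i\<in>UNIV. (h $ i) *\<^sub>R ?A (partial_deriv i \<psi>) x)) (at x)" if \<psi>: "\<psi> \<in> Schwartz" for \<psi> x
  proof -
    obtain B where B: "B \<ge> 0" "\<And>a h. norm (\<psi> (a + h) - \<psi> a - (\<Sum>i\<in>UNIV. (h $ i) *\<^sub>R partial_deriv i \<psi> a)) \<le> B * (norm h)\<^sup>2"
      using Schwartz_quadratic_remainder[OF \<psi>] by auto
    show ?thesis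
    proof (rule has_derivative_integral_quadratic[OF integ[OF \<psi>] integ[OF Schwartz_partial_deriv[OF \<psi>]] integrable_mult_left[OF a, of B]])
      fix u h
      have "a u * \<psi> (x + h - c u) - a u * \<psi> (x - c u) - (\<Sum>i\<in>UNIV. (h $ i) *\<^sub>R (a u * partial_deriv i \<psi> (x - c u)))
        = a u * (\<psi> ((x - c u) + h) - \<psi> (x - c u) - (\<Sum>i\<in>UNIV. (h $ i) *\<^sub>R partial_deriv i \<psi> (x - c u)))"
        by (simp add: algebra_simps sum_distrib_left)
      also have "norm \<dots> \<le> norm (a u) * (B * (norm h)\<^sup>2)"
        unfolding norm_mult by (intro mult_left_mono B) auto
      finally show "norm (a u * \<psi> (x + h - c u) - a u * \<psi> (x - c u) - (\<Sum>i\<in>UNIV. (h $ i) *\<^sub>R (a u * partial_deriv i \<psi> (x - c u))))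
        \<le> norm (a u) * B * (norm h)\<^sup>2" by (simp add: mult.assoc)
    qed
  qed
  show ?thesis
  proof (rule Schwartz_coinduct[where F = "?A ` Schwartz"])
    show "?A \<psi> \<in> ?A ` Schwartz" using \<psi> by (rule imageI)
  next
    fix f x assume "f \<in> ?A ` Schwartz"
    then show "f differentiable at x" using der unfolding differentiable_def by blast
  next
    fix f N assume "f \<in> ?A ` Schwartz"
    then obtain \<psi> where f: "f = ?A \<psi>" and \<psi>: "\<psi> \<in> Schwartz" by (rule imageE)
    have "(1 + norm x) ^ N * norm (f x) \<le> (\<integral>u. (1 + norm (c u)) ^ N * norm (a u) * schwartz_seminorm N [] \<psi> \<partial>\<mu>)" for x
    proof -
      have "norm ((1 + norm x) ^ N *\<^sub>R (a u * \<psi> (x - c u))) \<le> (1 + norm (c u)) ^ N * norm (a u) * schwartz_seminorm N [] \<psi>" for u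
      proof -
        have "norm x \<le> norm (x - c u) + norm (c u)" using norm_triangle_ineq[of "x - c u" "c u"] by simp
        moreover have "0 \<le> norm (c u) * norm (x - c u)" by simp
        ultimately have "1 + norm x \<le> (1 + norm (c u)) * (1 + norm (x - c u))"
          unfolding distrib_left distrib_right by linarith
        then have "(1 + norm x) ^ N \<le> (1 + norm (c u)) ^ N * (1 + norm (x - c u)) ^ N"
          by (simp flip: power_mult_distrib add: power_mono)
        then have "(1 + norm x) ^ N * (norm (a u) * norm (\<psi> (x - c u)))
            \<le> (1 + norm (c u)) ^ N * (1 + norm (x - c u)) ^ N * (norm (a u) * norm (\<psi> (x - c u)))"
          by (rule mult_right_mono) auto
        also have "\<dots> = (1 + norm (c u)) ^ N * norm (a u) * ((1 + norm (x - c u)) ^ N * norm (\<psi> (x - c u)))"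
          by (simp add: mult_ac)
        also have "\<dots> \<le> (1 + norm (c u)) ^ N * norm (a u) * schwartz_seminorm N [] \<psi>"
          using schwartz_seminorm_ge[OF \<psi>, of _ N "[]"] by (intro mult_left_mono) auto
        finally show ?thesis by (simp add: norm_mult)
      qed
      then have "norm (\<integral>u. (1 + norm x) ^ N *\<^sub>R (a u * \<psi> (x - c u)) \<partial>\<mu>) \<le> (\<integral>u. (1 + norm (c u)) ^ N * norm (a u) * schwartz_seminorm N [] \<psi> \<partial>\<mu>)"
        by (intro norm_integral_le integrable_scaleR_right integ[OF \<psi>] integrable_mult_left int)
      moreover have "norm (\<integral>u. (1 + norm x) ^ N *\<^sub>R (a u * \<psi> (x - c u)) \<partial>\<mu>) = (1 + norm x) ^ N * norm (f x)"
        unfolding f by (simp add: norm_mult)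
      ultimately show ?thesis by linarith
    qed
    then show "\<exists>C. \<forall>x. (1 + norm x) ^ N * norm (f x) \<le> C" by blast
  next
    fix f i assume "f \<in> ?A ` Schwartz"
    then obtain \<psi> where f: "f = ?A \<psi>" and \<psi>: "\<psi> \<in> Schwartz" by (rule imageE)
    have "partial_deriv i f x = ?A (partial_deriv i \<psi>) x" for x
      using partial_deriv_eqI[OF der[OF \<psi>], of i] unfolding f by (simp add: axis_def if_distrib[of "\<lambda>c. c *\<^sub>R _"] cong: if_cong)
    then show "partial_deriv i f \<in> ?A ` Schwartz" using Schwartz_partial_deriv[OF \<psi>] by blast
  qed
qed

subsection \<open>Division by a coordinate\<close>

definition scale_coord :: "'n \<Rightarrow> real \<Rightarrow> real^'n::finite \<Rightarrow> real^'n" where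
  "scale_coord j t x = (\<chi> i. if i = j then t * x $ i else x $ i)"

lemma bounded_linear_vec_lambda:
  fixes f :: "'a::real_normed_vector \<Rightarrow> real^'n::finite"
  assumes "\<And>i. bounded_linear (\<lambda>x. f x $ i)"
  shows "bounded_linear f"
proof -
  have "f = (\<lambda>x. \<Sum>i\<in>UNIV. (f x $ i) *\<^sub>R axis i 1)"
    by (rule ext) (simp only: scalar_mult_eq_scaleR[symmetric] basis_expansion)
  moreover have "bounded_linear (\<lambda>x. \<Sum>i\<in>UNIV. (f x $ i) *\<^sub>R (axis i 1 :: real^'n))"
    by (intro bounded_linear_sum bounded_linear_compose[OF bounded_linear_scaleR_left] assms)
  ultimately show ?thesis by metis
qed

lemma bounded_linear_scale_coord: "bounded_linear (scale_coord j t)"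
proof (rule bounded_linear_vec_lambda)
  fix i
  show "bounded_linear (\<lambda>x. scale_coord j t x $ i)"
    by (cases "i = j") (auto simp: scale_coord_def intro: bounded_linear_const_mult bounded_linear_vec_nth)
qed

lemma norm_scale_coord_le:
  assumes "0 \<le> t" "t \<le> 1" shows "norm (scale_coord j t x) \<le> norm x"
  unfolding norm_vec_def scale_coord_def
  by (rule L2_set_mono) (use assms in \<open>auto simp: abs_mult mult_left_le_one_le\<close>)

lemma scale_coord_add: "scale_coord j t (x + h) = scale_coord j t x + scale_coord j t h"
  by (simp add: scale_coord_def vec_eq_iff algebra_simps)

lemma continuous_scale_coord: "continuous_on A (\<lambda>t. scale_coord j t x)"
  unfolding scale_coord_def
proof (rule continuous_on_vec_lambda)
  fix i show "continuous_on A (\<lambda>t. if i = j then t * x $ i else x $ i)"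
    by (cases "i = j") (auto intro!: continuous_intros)
qed

abbreviation unit_interval :: "real measure" where
  "unit_interval \<equiv> restrict_space lborel {0..1}"

text \<open>The factor \<open>t ^ a\<close> is present because differentiation in direction \<open>j\<close> brings out one factor \<open>t\<close>.\<close>
definition segment_average :: "'n \<Rightarrow> nat \<Rightarrow> (real^'n::finite \<Rightarrow> complex) \<Rightarrow> real^'n \<Rightarrow> complex" where
  "segment_average j a \<phi> x = (\<integral>t. of_real (t ^ a) * \<phi> (scale_coord j t x) \<partial>unit_interval)"

lemma finite_measure_unit_interval: "finite_measure unit_interval"
  by (rule finite_measureI) (simp add: emeasure_restrict_space)

lemma integrable_segment_average:
  assumes \<phi>: "\<phi> \<in> Schwartz"
  shows "integrable unit_interval (\<lambda>t. of_real (t ^ a) * \<phi> (scale_coord j t x))"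
proof (rule finite_measure.integrable_const_bound[OF finite_measure_unit_interval])
  show "AE t in unit_interval. norm (of_real (t ^ a) * \<phi> (scale_coord j t x)) \<le> 1 * schwartz_seminorm 0 [] \<phi>"
    unfolding norm_mult
    by (intro AE_I2 mult_mono Schwartz_bounded \<phi>) (auto simp: norm_power abs_mult power_le_one)
  have "(\<lambda>t. of_real (t ^ a) * \<phi> (scale_coord j t x)) \<in> borel_measurable borel"
    by (intro borel_measurable_continuous_onI continuous_intros
        continuous_on_compose2[OF Schwartz_continuous[OF \<phi>] continuous_scale_coord]) auto
  then show "(\<lambda>t. of_real (t ^ a) * \<phi> (scale_coord j t x)) \<in> borel_measurable unit_interval"
    by (intro measurable_restrict_space1) simp
qed

lemma partial_deriv_segment_average:
  assumes \<phi>: "\<phi> \<in> Schwartz"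
  shows "segment_average j a \<phi> differentiable at x"
    and "partial_deriv i (segment_average j a \<phi>) x = segment_average j (if i = j then Suc a else a) (partial_deriv i \<phi>) x"
proof -
  obtain B where B: "B \<ge> 0" "\<And>a h. norm (\<phi> (a + h) - \<phi> a - (\<Sum>i\<in>UNIV. (h $ i) *\<^sub>R partial_deriv i \<phi> a)) \<le> B * (norm h)\<^sup>2"
    using Schwartz_quadratic_remainder[OF \<phi>] by auto
  let ?F' = "\<lambda>i t. of_real (t ^ (if i = j then Suc a else a)) * partial_deriv i \<phi> (scale_coord j t x)"
  have d: "((\<lambda>x. \<integral>t. of_real (t ^ a) * \<phi> (scale_coord j t x) \<partial>unit_interval) has_derivative
     (\<lambda>h. \<Sum>i\<in>UNIV. (h $ i) *\<^sub>R (\<integral>t. ?F' i t \<partial>unit_interval))) (at x)"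
  proof (rule has_derivative_integral_quadratic[OF integrable_segment_average[OF \<phi>]
        integrable_segment_average[OF Schwartz_partial_deriv[OF \<phi>]] finite_measure.integrable_const[OF finite_measure_unit_interval, of B]])
    fix t h assume "t \<in> space unit_interval"
    then have t: "0 \<le> t" "t \<le> 1" by auto
    have "of_real (t ^ a) * \<phi> (scale_coord j t (x + h)) - of_real (t ^ a) * \<phi> (scale_coord j t x) - (\<Sum>i\<in>UNIV. (h $ i) *\<^sub>R ?F' i t)
      = of_real (t ^ a) * (\<phi> (scale_coord j t x + scale_coord j t h) - \<phi> (scale_coord j t x)
           - (\<Sum>i\<in>UNIV. (scale_coord j t h $ i) *\<^sub>R partial_deriv i \<phi> (scale_coord j t x)))"
      unfolding right_diff_distrib sum_distrib_left scale_coord_add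
      by (intro arg_cong2[where f = minus] refl sum.cong) (auto simp: scale_coord_def scaleR_conv_of_real mult_ac)
    also have "norm \<dots> \<le> 1 * (B * (norm (scale_coord j t h))\<^sup>2)"
      unfolding norm_mult using t by (intro mult_mono B(2)) (auto simp: norm_power power_le_one)
    also have "\<dots> \<le> B * (norm h)\<^sup>2"
      using norm_scale_coord_le[OF t] B(1) by (auto intro!: mult_left_mono power_mono)
    finally show "norm (of_real (t ^ a) * \<phi> (scale_coord j t (x + h)) - of_real (t ^ a) * \<phi> (scale_coord j t x) - (\<Sum>i\<in>UNIV. (h $ i) *\<^sub>R ?F' i t))
      \<le> B * (norm h)\<^sup>2" .
  qed
  have e: "segment_average j a \<phi> = (\<lambda>x. \<integral>t. of_real (t ^ a) * \<phi> (scale_coord j t x) \<partial>unit_interval)"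
    by (rule ext) (simp add: segment_average_def)
  show "segment_average j a \<phi> differentiable at x" unfolding e using d by (rule differentiableI)
  show "partial_deriv i (segment_average j a \<phi>) x = segment_average j (if i = j then Suc a else a) (partial_deriv i \<phi>) x"
    unfolding e partial_deriv_eqI[OF d]
    by (simp add: segment_average_def axis_def if_distrib[of "\<lambda>c. c *\<^sub>R _"] cong: if_cong)
qed

lemma iter_partial_segment_average:
  assumes \<phi>: "\<phi> \<in> Schwartz"
  shows "\<exists>b. iter_partial is (segment_average j a \<phi>) = segment_average j b (iter_partial is \<phi>)"
proof (induction "is")
  case (Cons i "is")
  then obtain b where b: "iter_partial is (segment_average j a \<phi>) = segment_average j b (iter_partial is \<phi>)" by blast
  show ?case
    by (rule exI[of _ "if i = j then Suc b else b"], rule ext)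
       (simp add: b partial_deriv_segment_average(2)[OF Schwartz_iter_partial[OF \<phi>]])
qed auto

lemma segment_average_integrates:
  assumes \<phi>: "\<phi> \<in> Schwartz"
  shows "of_real (x $ j) * segment_average j 0 (partial_deriv j \<phi>) x = \<phi> x - \<phi> (scale_coord j 0 x)"
proof -
  have "((\<lambda>t. \<phi> (scale_coord j t x)) has_vector_derivative of_real (x $ j) * partial_deriv j \<phi> (scale_coord j t x)) (at t within {0..1})" for t
  proof -
    have s: "((\<lambda>t. scale_coord j t x) has_derivative (\<lambda>h. h *\<^sub>R axis j (x $ j))) (at t)"
    proof -
      have "(\<lambda>t. scale_coord j t x) = (\<lambda>t. scale_coord j 0 x + t *\<^sub>R axis j (x $ j))"
        by (auto simp: scale_coord_def axis_def vec_eq_iff)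
      then show ?thesis by (auto intro!: derivative_eq_intros)
    qed
    have "((\<lambda>t. \<phi> (scale_coord j t x)) has_derivative (\<lambda>h. \<Sum>i\<in>UNIV. ((h *\<^sub>R axis j (x $ j)) $ i) *\<^sub>R partial_deriv i \<phi> (scale_coord j t x))) (at t)"
      using diff_chain_at[OF s has_derivative_partials[OF Schwartz_differentiable0[OF \<phi>]]] by (simp add: o_def)
    moreover have "(\<Sum>i\<in>UNIV. ((h *\<^sub>R axis j (x $ j)) $ i) *\<^sub>R partial_deriv i \<phi> (scale_coord j t x))
       = h *\<^sub>R (of_real (x $ j) * partial_deriv j \<phi> (scale_coord j t x))" for h
    proof -
      have "(\<Sum>i\<in>UNIV. ((h *\<^sub>R axis j (x $ j)) $ i) *\<^sub>R partial_deriv i \<phi> (scale_coord j t x))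
         = (\<Sum>i\<in>UNIV. if i = j then (h * x $ j) *\<^sub>R partial_deriv j \<phi> (scale_coord j t x) else 0)"
        by (rule sum.cong) (auto simp: axis_def)
      then show ?thesis by (simp add: scaleR_conv_of_real mult_ac)
    qed
    ultimately show ?thesis unfolding has_vector_derivative_def by (auto intro: has_derivative_at_withinI)
  qed
  then have "(\<integral>t. indicator {0..1} t *\<^sub>R (of_real (x $ j) * partial_deriv j \<phi> (scale_coord j t x)) \<partial>lborel)
      = \<phi> (scale_coord j 1 x) - \<phi> (scale_coord j 0 x)"
    by (intro integral_FTC_atLeastAtMost continuous_intros
        continuous_on_compose2[OF Schwartz_continuous[OF Schwartz_partial_deriv[OF \<phi>]] continuous_scale_coord]) auto
  moreover have "scale_coord j 1 x = x" by (simp add: scale_coord_def vec_eq_iff)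
  moreover have "of_real (x $ j) * segment_average j 0 (partial_deriv j \<phi>) x =
     (\<integral>t. indicator {0..1} t *\<^sub>R (of_real (x $ j) * partial_deriv j \<phi> (scale_coord j t x)) \<partial>lborel)"
    unfolding segment_average_def by (simp add: integral_restrict_space flip: mult_scaleR_right)
  ultimately show ?thesis by simp
qed

lemma partial_deriv_sum_list:
  assumes "\<And>l. l \<in> set L \<Longrightarrow> f l differentiable at x"
  shows "(\<lambda>x. \<Sum>l\<leftarrow>L. f l x) differentiable at x \<and>
    partial_deriv i (\<lambda>x. \<Sum>l\<leftarrow>L. f l x) x = (\<Sum>l\<leftarrow>L. partial_deriv i (f l) x)"
  using assms by (induction L) (auto simp: partial_deriv_add intro!: differentiable_add)

text \<open>The terms of the sum arise by dropping one occurrence of \<open>j\<close> from the list of derivatives. All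
that matters is that these lists are shorter, which makes the equation solvable for
\<open>iter_partial is \<theta>\<close> by induction on the length.\<close>
lemma iter_partial_mult_coord:
  fixes \<theta> :: "real^'n::finite \<Rightarrow> complex"
  assumes \<theta>: "\<And>is x. iter_partial is \<theta> differentiable at x"
  shows "\<exists>L. (\<forall>l\<in>set L. length l < length is) \<and>
    iter_partial is (\<lambda>x. of_real (x $ j) * \<theta> x) = (\<lambda>x. of_real (x $ j) * iter_partial is \<theta> x + (\<Sum>l\<leftarrow>L. iter_partial l \<theta> x))"
proof (induction "is")
  case Nil
  then show ?case by (intro exI[of _ "[]"]) auto
next
  case (Cons i "is")
  then obtain L where L: "\<forall>l\<in>set L. length l < length is"
    "iter_partial is (\<lambda>x. of_real (x $ j) * \<theta> x) = (\<lambda>x. of_real (x $ j) * iter_partial is \<theta> x + (\<Sum>l\<leftarrow>L. iter_partial l \<theta> x))" by blast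
  have coord: "((\<lambda>x :: real^'n. complex_of_real (x $ j)) has_derivative (\<lambda>h. of_real (h $ j))) (at x)" for x
    by (intro bounded_linear_imp_has_derivative bounded_linear_compose[OF bounded_linear_of_real] bounded_linear_vec_nth)
  have step: "partial_deriv i (\<lambda>x. of_real (x $ j) * iter_partial is \<theta> x + (\<Sum>l\<leftarrow>L. iter_partial l \<theta> x)) x =
      of_real (x $ j) * iter_partial (i # is) \<theta> x + (\<Sum>l\<leftarrow>(if i = j then [is] else []) @ map (Cons i) L. iter_partial l \<theta> x)" for x
  proof -
    have c: "(\<lambda>x :: real^'n. complex_of_real (x $ j)) differentiable at x" using coord by (rule differentiableI)
    have "partial_deriv i (\<lambda>x :: real^'n. complex_of_real (x $ j)) x = (if i = j then 1 else 0)"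
      by (simp add: partial_deriv_eqI[OF coord] axis_def)
    moreover have "(\<lambda>x. of_real (x $ j) * iter_partial is \<theta> x) differentiable at x"
      using c \<theta> by (rule differentiable_mult)
    ultimately show ?thesis using c \<theta>
      by (simp add: partial_deriv_add partial_deriv_mult partial_deriv_sum_list o_def)
  qed
  show ?case
  proof (intro exI[of _ "(if i = j then [is] else []) @ map (Cons i) L"] conjI ext)
    show "\<forall>l\<in>set ((if i = j then [is] else []) @ map (Cons i) L). length l < length (i # is)" using L(1) by auto
    fix x
    show "iter_partial (i # is) (\<lambda>x. of_real (x $ j) * \<theta> x) x = of_real (x $ j) * iter_partial (i # is) \<theta> x
        + (\<Sum>l\<leftarrow>(if i = j then [is] else []) @ map (Cons i) L. iter_partial l \<theta> x)"
      unfolding step[symmetric] by (simp only: iter_partial.simps(2) L(2))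
  qed
qed

text \<open>Hadamard's lemma. The quotient is the average of the derivative over the segment from \<open>scale_coord j 0 x\<close> to
\<open>x\<close>, which shows that it is smooth. The average decays only in the directions along the
hyperplane, because the segment starts on it; far from the hyperplane the decay comes from the differentiated
equation \<open>\<phi> = x\<^sub>j \<theta>\<close>, divided by \<open>x\<^sub>j\<close>.\<close>
theorem Schwartz_divide_coord:
  fixes \<phi> :: "real^'n::finite \<Rightarrow> complex"
  assumes \<phi>: "\<phi> \<in> Schwartz" and zero: "\<And>x. x $ j = 0 \<Longrightarrow> \<phi> x = 0"
  obtains \<theta> where "\<theta> \<in> Schwartz" "\<phi> = (\<lambda>x. of_real (x $ j) * \<theta> x)"
proof -
  define \<theta> where "\<theta> = segment_average j 0 (partial_deriv j \<phi>)"
  note \<phi>' = Schwartz_partial_deriv[OF \<phi>, of j]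
  have eq: "\<phi> x = of_real (x $ j) * \<theta> x" for x
    using segment_average_integrates[OF \<phi>, of x j] zero[of "scale_coord j 0 x"]
    by (simp add: \<theta>_def scale_coord_def)
  have smooth: "iter_partial is \<theta> differentiable at x" for "is" x
    unfolding \<theta>_def using iter_partial_segment_average[OF \<phi>', of "is" j 0]
      partial_deriv_segment_average(1)[OF Schwartz_iter_partial[OF \<phi>']] by metis
  have decay: "\<exists>C. \<forall>x. (1 + norm x) ^ N * norm (iter_partial is \<theta> x) \<le> C" for "is" N
  proof (induction "length is" arbitrary: "is" rule: less_induct)
    case less
    obtain L where L: "\<forall>l\<in>set L. length l < length is"
      "iter_partial is (\<lambda>x. of_real (x $ j) * \<theta> x) = (\<lambda>x. of_real (x $ j) * iter_partial is \<theta> x + (\<Sum>l\<leftarrow>L. iter_partial l \<theta> x))"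
      using iter_partial_mult_coord[OF smooth, of "is" j] by blast
    have "\<forall>l\<in>set L. \<exists>C. \<forall>x. (1 + norm x) ^ N * norm (iter_partial l \<theta> x) \<le> C" using less L(1) by blast
    then obtain C where C: "\<And>l x. l \<in> set L \<Longrightarrow> (1 + norm x) ^ N * norm (iter_partial l \<theta> x) \<le> C l" by metis
    obtain b where b: "iter_partial is \<theta> = segment_average j b (iter_partial is (partial_deriv j \<phi>))"
      unfolding \<theta>_def using iter_partial_segment_average[OF \<phi>'] by blast
    define A where "A = schwartz_seminorm N is (partial_deriv j \<phi>)"
    define E where "E = schwartz_seminorm N is \<phi> + (\<Sum>l\<leftarrow>L. C l)"
    have "(1 + norm x) ^ N * norm (iter_partial is \<theta> x) \<le> max (2 ^ N * A) E" for x
    proof (cases "\<bar>x $ j\<bar> \<le> 1")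
      case True
      have "norm ((1 + norm x) ^ N *\<^sub>R (of_real (t ^ b) * iter_partial is (partial_deriv j \<phi>) (scale_coord j t x))) \<le> 2 ^ N * A"
        if "t \<in> space unit_interval" for t
      proof -
        have t: "0 \<le> t" "t \<le> 1" using that by auto
        have "norm (x - scale_coord j t x) \<le> 1"
        proof -
          have "x - scale_coord j t x = ((1 - t) * x $ j) *\<^sub>R axis j 1"
            by (auto simp: scale_coord_def axis_def vec_eq_iff algebra_simps)
          then show ?thesis using t True mult_mono[of "\<bar>1 - t\<bar>" 1 "\<bar>x $ j\<bar>" 1] by (simp add: abs_mult)
        qed
        moreover have "norm x \<le> norm (scale_coord j t x) + norm (x - scale_coord j t x)"
          using norm_triangle_ineq[of "scale_coord j t x" "x - scale_coord j t x"] by simp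
        ultimately have "1 + norm x \<le> 2 * (1 + norm (scale_coord j t x))"
          using norm_ge_zero[of "scale_coord j t x"] unfolding distrib_left by linarith
        then have "(1 + norm x) ^ N \<le> 2 ^ N * (1 + norm (scale_coord j t x)) ^ N"
          by (simp flip: power_mult_distrib add: power_mono)
        then have "(1 + norm x) ^ N * norm (iter_partial is (partial_deriv j \<phi>) (scale_coord j t x))
          \<le> 2 ^ N * ((1 + norm (scale_coord j t x)) ^ N * norm (iter_partial is (partial_deriv j \<phi>) (scale_coord j t x)))"
          unfolding mult.assoc[symmetric] by (rule mult_right_mono) auto
        also have "\<dots> \<le> 2 ^ N * A"
          unfolding A_def by (intro mult_left_mono schwartz_seminorm_ge \<phi>') auto
        finally have *: "(1 + norm x) ^ N * norm (iter_partial is (partial_deriv j \<phi>) (scale_coord j t x)) \<le> 2 ^ N * A" .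
        have "norm ((1 + norm x) ^ N *\<^sub>R (of_real (t ^ b) * iter_partial is (partial_deriv j \<phi>) (scale_coord j t x)))
          = t ^ b * ((1 + norm x) ^ N * norm (iter_partial is (partial_deriv j \<phi>) (scale_coord j t x)))"
          using t by (simp add: norm_mult norm_power mult_ac)
        also have "\<dots> \<le> 1 * ((1 + norm x) ^ N * norm (iter_partial is (partial_deriv j \<phi>) (scale_coord j t x)))"
          using t by (intro mult_right_mono) (auto simp: power_le_one)
        finally show ?thesis using * by simp
      qed
      then have "norm (\<integral>t. (1 + norm x) ^ N *\<^sub>R (of_real (t ^ b) * iter_partial is (partial_deriv j \<phi>) (scale_coord j t x)) \<partial>unit_interval)
          \<le> (\<integral>t. 2 ^ N * A \<partial>unit_interval)"
        by (intro norm_integral_le integrable_scaleR_right integrable_segment_average Schwartz_iter_partial \<phi>'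
            finite_measure.integrable_const[OF finite_measure_unit_interval])
      moreover have "measure unit_interval (space unit_interval) = 1"
        by (simp add: measure_restrict_space)
      ultimately have "(1 + norm x) ^ N * norm (iter_partial is \<theta> x) \<le> 2 ^ N * A"
        unfolding b segment_average_def by simp
      then show ?thesis by simp
    next
      case False
      have "iter_partial is \<phi> x = of_real (x $ j) * iter_partial is \<theta> x + (\<Sum>l\<leftarrow>L. iter_partial l \<theta> x)"
        using L(2) eq by (metis (no_types, lifting) ext)
      then have "of_real (x $ j) * iter_partial is \<theta> x = iter_partial is \<phi> x - (\<Sum>l\<leftarrow>L. iter_partial l \<theta> x)" by simp
      then have "\<bar>x $ j\<bar> * norm (iter_partial is \<theta> x) \<le> norm (iter_partial is \<phi> x) + norm (\<Sum>l\<leftarrow>L. iter_partial l \<theta> x)"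
        by (metis norm_mult norm_of_real norm_triangle_ineq4)
      moreover have "1 * norm (iter_partial is \<theta> x) \<le> \<bar>x $ j\<bar> * norm (iter_partial is \<theta> x)"
        using False by (intro mult_right_mono) auto
      moreover have "norm (\<Sum>l\<leftarrow>L. iter_partial l \<theta> x) \<le> (\<Sum>l\<leftarrow>L. norm (iter_partial l \<theta> x))"
        by (induction L) (auto intro: order_trans[OF norm_triangle_ineq])
      ultimately have "norm (iter_partial is \<theta> x) \<le> norm (iter_partial is \<phi> x) + (\<Sum>l\<leftarrow>L. norm (iter_partial l \<theta> x))"
        by linarith
      then have "(1 + norm x) ^ N * norm (iter_partial is \<theta> x)
          \<le> (1 + norm x) ^ N * norm (iter_partial is \<phi> x) + (1 + norm x) ^ N * (\<Sum>l\<leftarrow>L. norm (iter_partial l \<theta> x))"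
        unfolding distrib_left[symmetric] by (rule mult_left_mono) auto
      also have "\<dots> \<le> E"
        unfolding E_def sum_list_const_mult[symmetric]
        by (intro add_mono schwartz_seminorm_ge \<phi> sum_list_mono C)
      finally show ?thesis by simp
    qed
    then show ?case by blast
  qed
  have "\<theta> \<in> Schwartz" by (rule SchwartzI) (use smooth decay in auto)
  moreover have "\<phi> = (\<lambda>x. of_real (x $ j) * \<theta> x)" using eq by (rule ext)
  ultimately show ?thesis by (rule that)
qed


section \<open>Tempered distributions\<close>

lemma schwartz_seminorm_zero [simp]: "schwartz_seminorm N is (\<lambda>x. 0) = 0"
proof -
  have "iter_partial is (\<lambda>x. 0) = (\<lambda>x. 0)" by (induction "is") auto
  then show ?thesis unfolding schwartz_seminorm_def by simp
qed

lemma topspace_schwartz_topology [simp]: "topspace schwartz_topology = (Schwartz :: (real^'n::finite \<Rightarrow> complex) set)"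
proof -
  have "f \<in> \<Union>{{g \<in> Schwartz. schwartz_seminorm N is (\<lambda>x. g x - f x) < e} | f N is e. f \<in> Schwartz \<and> 0 < e}"
    if "f \<in> Schwartz" for f :: "real^'n \<Rightarrow> complex"
    using that by (intro UnionI[of "{g \<in> Schwartz. schwartz_seminorm 0 [] (\<lambda>x. g x - f x) < 1}"] CollectI
        exI[of _ f] exI[of _ 0] exI[of _ "[]"] exI[of _ "1::real"]) auto
  then show ?thesis unfolding schwartz_topology_def topology_generated_by_topspace by blast
qed

lemma openin_schwartz_ball:
  assumes "finite J" "f \<in> Schwartz" "0 < e"
  shows "openin schwartz_topology {g \<in> Schwartz. \<forall>(N, is)\<in>J. schwartz_seminorm N is (\<lambda>x. g x - f x) < e}"
  using assms(1)
proof induction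
  case empty
  then show ?case using openin_topspace[of schwartz_topology] by simp
next
  case (insert p J)
  obtain N "is" where p: "p = (N, is)" by fastforce
  have "openin schwartz_topology {g \<in> Schwartz. schwartz_seminorm N is (\<lambda>x. g x - f x) < e}"
    unfolding schwartz_topology_def using assms by (intro topology_generated_by_Basis) blast
  from openin_Int[OF this insert.IH] show ?case
    by (rule back_subst[of "openin schwartz_topology"]) (auto simp: p)
qed

lemma openin_schwartzI:
  assumes "U \<subseteq> Schwartz"
    and "\<And>f. f \<in> U \<Longrightarrow> \<exists>J e. finite J \<and> 0 < e \<and> {g \<in> Schwartz. \<forall>(N, is)\<in>J. schwartz_seminorm N is (\<lambda>x. g x - f x) < e} \<subseteq> U"
  shows "openin schwartz_topology U"
proof (subst openin_subopen, intro ballI)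
  fix f assume f: "f \<in> U"
  with assms obtain J e where J: "finite J" "0 < e"
    "{g \<in> Schwartz. \<forall>(N, is)\<in>J. schwartz_seminorm N is (\<lambda>x. g x - f x) < e} \<subseteq> U" by meson
  have "f \<in> Schwartz" using f assms(1) by blast
  with J show "\<exists>T. openin schwartz_topology T \<and> f \<in> T \<and> T \<subseteq> U"
    by (intro exI[of _ "{g \<in> Schwartz. \<forall>(N, is)\<in>J. schwartz_seminorm N is (\<lambda>x. g x - f x) < e}"])
       (auto intro!: openin_schwartz_ball)
qed

lemma seminorm_bound_small:
  assumes "finite J" "0 \<le> C" "0 < e" and le: "d \<le> C * (\<Sum>(K, js)\<in>J. schwartz_seminorm K js h)"
    and small: "\<forall>(K, js)\<in>J. schwartz_seminorm K js h < e / (C * card J + 1)"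
  shows "d < e"
proof -
  have pos: "0 < C * card J + 1" using assms by (simp add: add_nonneg_pos)
  have "(\<Sum>(K, js)\<in>J. schwartz_seminorm K js h) \<le> (\<Sum>(K, js)\<in>J. e / (C * card J + 1))"
    using small by (intro sum_mono) (auto intro: less_imp_le)
  also have "\<dots> = card J * (e / (C * card J + 1))" by simp
  finally have "d \<le> C * (card J * (e / (C * card J + 1)))"
    using le assms(2) by (meson mult_left_mono order_trans)
  also have "\<dots> = e * ((C * card J) / (C * card J + 1))" by simp
  also have "\<dots> < e * 1" using assms(3) pos by (intro mult_strict_left_mono) (auto simp: field_simps)
  finally show ?thesis by simp
qed

text \<open>A bound on differences, rather than on values, suits maps that are only real linear, such as those involving
conjugation.\<close>
lemma continuous_map_schwartz_euclidean:
  fixes T :: "(real^'n::finite \<Rightarrow> complex) \<Rightarrow> 'b::metric_space"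
  assumes J: "finite J" "0 \<le> C"
    and le: "\<And>\<phi> \<psi>. \<phi> \<in> Schwartz \<Longrightarrow> \<psi> \<in> Schwartz \<Longrightarrow>
      dist (T \<phi>) (T \<psi>) \<le> C * (\<Sum>(K, js)\<in>J. schwartz_seminorm K js (\<lambda>x. \<phi> x - \<psi> x))"
  shows "continuous_map schwartz_topology euclidean T"
  unfolding continuous_map_def
proof (intro conjI allI impI)
  fix U :: "'b set" assume U: "openin euclidean U"
  show "openin schwartz_topology {\<phi> \<in> topspace schwartz_topology. T \<phi> \<in> U}"
  proof (rule openin_schwartzI)
    fix f assume "f \<in> {\<phi> \<in> topspace schwartz_topology. T \<phi> \<in> U}"
    then have f: "f \<in> Schwartz" "T f \<in> U" by auto
    from U f(2) obtain e where e: "0 < e" "ball (T f) e \<subseteq> U" by (auto simp: open_contains_ball)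
    let ?d = "e / (C * card J + 1)"
    have "{g \<in> Schwartz. \<forall>(N, is)\<in>J. schwartz_seminorm N is (\<lambda>x. g x - f x) < ?d} \<subseteq> {\<phi> \<in> topspace schwartz_topology. T \<phi> \<in> U}"
    proof safe
      fix g assume g: "g \<in> Schwartz" "\<forall>(N, is)\<in>J. schwartz_seminorm N is (\<lambda>x. g x - f x) < ?d"
      then have "dist (T g) (T f) < e" by (intro seminorm_bound_small[OF J e(1) le] f)
      then show "T g \<in> U" using e(2) by (auto simp: dist_commute)
    qed auto
    then show "\<exists>J e. finite J \<and> 0 < e \<and>
        {g \<in> Schwartz. \<forall>(N, is)\<in>J. schwartz_seminorm N is (\<lambda>x. g x - f x) < e} \<subseteq> {\<phi> \<in> topspace schwartz_topology. T \<phi> \<in> U}"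
      using J e(1) by (intro exI[of _ J] exI[of _ ?d]) (auto simp: add_nonneg_pos)
  qed auto
qed auto

lemma continuous_map_schwartz_schwartz:
  fixes L :: "(real^'n::finite \<Rightarrow> complex) \<Rightarrow> real^'m::finite \<Rightarrow> complex"
  assumes L: "\<And>\<phi>. \<phi> \<in> Schwartz \<Longrightarrow> L \<phi> \<in> Schwartz"
    and le: "\<And>N is. \<exists>J C. finite J \<and> 0 \<le> C \<and> (\<forall>\<phi>\<in>Schwartz. \<forall>\<psi>\<in>Schwartz.
      schwartz_seminorm N is (\<lambda>x. L \<phi> x - L \<psi> x) \<le> C * (\<Sum>(K, js)\<in>J. schwartz_seminorm K js (\<lambda>x. \<phi> x - \<psi> x)))"
  shows "continuous_map schwartz_topology schwartz_topology L"
proof -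
  let ?B = "{{g \<in> Schwartz. schwartz_seminorm N is (\<lambda>x. g x - f x) < e} | f N is e. f \<in> Schwartz \<and> 0 < e}
    :: (real^'m \<Rightarrow> complex) set set"
  have sp: "\<Union>?B = Schwartz"
    using topspace_schwartz_topology unfolding schwartz_topology_def topology_generated_by_topspace .
  have "continuous_map (schwartz_topology :: (real^'n \<Rightarrow> complex) topology) (topology_generated_by ?B) L"
  proof (rule continuous_on_generated_topo)
    show "L ` topspace schwartz_topology \<subseteq> \<Union>?B" using L unfolding sp by auto
    fix U assume "U \<in> ?B"
    then obtain f N "is" e where U: "U = {g \<in> Schwartz. schwartz_seminorm N is (\<lambda>x. g x - f x) < e}"
      and f: "f \<in> Schwartz" "0 < e" by blast
    from le[of N "is"] obtain J C where J: "finite J" "0 \<le> C" and le: "\<And>\<phi> \<psi>. \<phi> \<in> Schwartz \<Longrightarrow> \<psi> \<in> Schwartz \<Longrightarrow>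
      schwartz_seminorm N is (\<lambda>x. L \<phi> x - L \<psi> x) \<le> C * (\<Sum>(K, js)\<in>J. schwartz_seminorm K js (\<lambda>x. \<phi> x - \<psi> x))" by blast
    show "openin schwartz_topology (L -` U \<inter> topspace schwartz_topology)"
    proof (rule openin_schwartzI)
      fix \<psi> assume "\<psi> \<in> L -` U \<inter> topspace schwartz_topology"
      then have \<psi>: "\<psi> \<in> Schwartz" "schwartz_seminorm N is (\<lambda>x. L \<psi> x - f x) < e" by (auto simp: U)
      let ?e = "e - schwartz_seminorm N is (\<lambda>x. L \<psi> x - f x)"
      let ?d = "?e / (C * card J + 1)"
      have e: "0 < ?e" using \<psi>(2) by simp
      have "{g \<in> Schwartz. \<forall>(N, is)\<in>J. schwartz_seminorm N is (\<lambda>x. g x - \<psi> x) < ?d} \<subseteq> L -` U \<inter> topspace schwartz_topology"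
      proof
        fix g assume "g \<in> {g \<in> Schwartz. \<forall>(N, is)\<in>J. schwartz_seminorm N is (\<lambda>x. g x - \<psi> x) < ?d}"
        then have g: "g \<in> Schwartz" "\<forall>(N, is)\<in>J. schwartz_seminorm N is (\<lambda>x. g x - \<psi> x) < ?d" by auto
        then have "schwartz_seminorm N is (\<lambda>x. L g x - L \<psi> x) < ?e"
          by (intro seminorm_bound_small[OF J e le] \<psi>(1))
        then have "schwartz_seminorm N is (\<lambda>x. L g x - f x) < e"
          using schwartz_seminorm_triangle[OF L[OF g(1)] L[OF \<psi>(1)] f(1), of N "is"] by linarith
        then show "g \<in> L -` U \<inter> topspace schwartz_topology" using g L[OF g(1)] by (simp add: U)
      qed
      moreover have "0 < ?d" using e J(2) by (simp add: add_nonneg_pos)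
      ultimately show "\<exists>J e. finite J \<and> 0 < e \<and>
        {g \<in> Schwartz. \<forall>(N, is)\<in>J. schwartz_seminorm N is (\<lambda>x. g x - \<psi> x) < e} \<subseteq> L -` U \<inter> topspace schwartz_topology"
        using J(1) by blast
    qed auto
  qed
  then show ?thesis by (simp only: schwartz_topology_def)
qed

lemma continuous_map_mult_comp:
  assumes m: "schwartz_along P m" and P: "bounded_linear P"
  shows "continuous_map schwartz_topology schwartz_topology (\<lambda>\<psi> x. m x * \<psi> (P x))"
proof (rule continuous_map_schwartz_schwartz)
  fix N "is"
  from Schwartz_mult_comp(2)[OF m P, of N "is"] obtain J C where J: "finite J" "0 \<le> C"
    "\<And>\<psi>. \<psi> \<in> Schwartz \<Longrightarrow> schwartz_seminorm N is (\<lambda>x. m x * \<psi> (P x)) \<le> C * (\<Sum>(K, js)\<in>J. schwartz_seminorm K js \<psi>)" by blast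
  then show "\<exists>J C. finite J \<and> 0 \<le> C \<and> (\<forall>\<phi>\<in>Schwartz. \<forall>\<psi>\<in>Schwartz.
      schwartz_seminorm N is (\<lambda>x. m x * \<phi> (P x) - m x * \<psi> (P x)) \<le> C * (\<Sum>(K, js)\<in>J. schwartz_seminorm K js (\<lambda>x. \<phi> x - \<psi> x)))"
    using J(3)[OF Schwartz_diff]
    by (intro exI[of _ J] exI[of _ C]) (auto simp: right_diff_distrib[symmetric])
qed (rule Schwartz_mult_comp(1)[OF m P])

lemma continuous_map_schwartz_cnj:
  "continuous_map schwartz_topology schwartz_topology (\<lambda>\<psi> x. cnj (\<psi> x))"
proof (rule continuous_map_schwartz_schwartz)
  fix N and "is" :: "'a list"
  have "schwartz_seminorm N is (\<lambda>x. cnj (\<phi> x) - cnj (\<psi> x)) = schwartz_seminorm N is (\<lambda>x. \<phi> x - \<psi> x)"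
    if "\<phi> \<in> Schwartz" "\<psi> \<in> Schwartz" for \<phi> \<psi>
    using Schwartz_bounded_linear(2)[OF bounded_linear_cnj Schwartz_diff[OF that], of "is"]
    by (simp add: schwartz_seminorm_def)
  then show "\<exists>J C. finite J \<and> 0 \<le> C \<and> (\<forall>\<phi>\<in>Schwartz. \<forall>\<psi>\<in>Schwartz.
      schwartz_seminorm N is (\<lambda>x. cnj (\<phi> x) - cnj (\<psi> x)) \<le> C * (\<Sum>(K, js)\<in>J. schwartz_seminorm K js (\<lambda>x. \<phi> x - \<psi> x)))"
    by (intro exI[of _ "{(N, is)}"] exI[of _ 1]) auto
qed (rule Schwartz_cnj)

lemma
  assumes "T \<in> tempered"
  shows tempered_add: "\<phi> \<in> Schwartz \<Longrightarrow> \<psi> \<in> Schwartz \<Longrightarrow> T (\<lambda>x. \<phi> x + \<psi> x) = T \<phi> + T \<psi>"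
    and tempered_cmult: "\<phi> \<in> Schwartz \<Longrightarrow> T (\<lambda>x. c * \<phi> x) = c * T \<phi>"
    and tempered_continuous: "continuous_map schwartz_topology euclidean T"
    and tempered_extensional: "T \<in> extensional Schwartz"
  using assms unfolding tempered_def by blast+

lemma tempered_zero: "T \<in> tempered \<Longrightarrow> T (\<lambda>x. 0) = 0"
  using tempered_cmult[OF _ Schwartz_zero, of T 0] by simp

lemma tempered_diff:
  assumes "T \<in> tempered" "\<phi> \<in> Schwartz" "\<psi> \<in> Schwartz"
  shows "T (\<lambda>x. \<phi> x - \<psi> x) = T \<phi> - T \<psi>"
  using tempered_add[OF assms(1,2) Schwartz_cmult[OF assms(3), of "-1"]] tempered_cmult[OF assms(1,3), of "-1"] by simp

lemma tempered_sum:
  assumes T: "T \<in> tempered" and f: "\<And>i. i \<in> A \<Longrightarrow> f i \<in> Schwartz"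
  shows "T (\<lambda>x. \<Sum>i\<in>A. f i x) = (\<Sum>i\<in>A. T (f i))"
  using f
proof (induction A rule: infinite_finite_induct)
  case (insert i A)
  then show ?case using tempered_add[OF T, of "f i" "\<lambda>x. \<Sum>i\<in>A. f i x"] by (auto intro: Schwartz_sum)
qed (auto simp: tempered_zero[OF T])

section \<open>Distributions annihilated by coordinates\<close>

text \<open>Split off one coordinate \<open>j\<close> at a time. The function \<open>\<phi>\<close> restricted to the hyperplane, extended
constantly and cut off by a Gaussian in \<open>x\<^sub>j\<close>, agrees with \<open>\<phi>\<close> on the hyperplane. So the
difference is \<open>x\<^sub>j\<close> times a Schwartz function and is killed by \<open>T\<close>, while the extension vanishes
on the larger subspace given by the remaining coordinates.\<close>
lemma vanish_on_coordinate_subspace: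
  fixes T :: "(real^'n::finite \<Rightarrow> complex) \<Rightarrow> complex"
  assumes add: "\<And>\<phi> \<psi>. \<phi> \<in> Schwartz \<Longrightarrow> \<psi> \<in> Schwartz \<Longrightarrow> T (\<lambda>x. \<phi> x + \<psi> x) = T \<phi> + T \<psi>"
    and ann: "\<And>j \<phi>. j \<in> S \<Longrightarrow> \<phi> \<in> Schwartz \<Longrightarrow> T (\<lambda>x. of_real (x $ j) * \<phi> x) = 0"
    and \<phi>: "\<phi> \<in> Schwartz" and zero: "\<And>x :: real^'n. (\<And>j. j \<in> S \<Longrightarrow> x $ j = 0) \<Longrightarrow> \<phi> x = 0"
  shows "T \<phi> = 0"
proof -
  have "finite S" by simp
  from this ann \<phi> zero show ?thesis
  proof (induction S arbitrary: \<phi>)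
    case empty
    then have "\<phi> = (\<lambda>x. 0)" by auto
    moreover have "T (\<lambda>x. 0) = 0" using add[OF Schwartz_zero Schwartz_zero] by simp
    ultimately show ?case by simp
  next
    case (insert j S)
    define Q where "Q = (\<lambda>x :: real^'n. \<chi> i. if i = j then x $ j else 0)"
    define \<phi>1 where "\<phi>1 = (\<lambda>x. of_real (exp (- (1 * (norm (Q x))\<^sup>2))) * \<phi> (scale_coord j 0 x))"
    have Q: "bounded_linear Q"
    proof (rule bounded_linear_vec_lambda)
      fix i show "bounded_linear (\<lambda>x. Q x $ i)"
        by (cases "i = j") (auto simp: Q_def bounded_linear_vec_nth bounded_linear_zero)
    qed
    have "norm x \<le> norm (scale_coord j 0 x) + norm (Q x)" for x
    proof -
      have "x = scale_coord j 0 x + Q x" by (simp add: vec_eq_iff scale_coord_def Q_def)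
      then show ?thesis by (metis norm_triangle_ineq)
    qed
    then have \<phi>1: "\<phi>1 \<in> Schwartz"
      unfolding \<phi>1_def by (intro Schwartz_mult_comp(1) schwartz_along_gaussian Q bounded_linear_scale_coord insert.prems) auto
    have "T \<phi>1 = 0"
    proof (rule insert.IH[OF _ \<phi>1])
      fix x :: "real^'n" assume x: "\<And>i. i \<in> S \<Longrightarrow> x $ i = 0"
      have "\<phi> (scale_coord j 0 x) = 0"
        by (rule insert.prems) (use x in \<open>auto simp: scale_coord_def\<close>)
      then show "\<phi>1 x = 0" by (simp add: \<phi>1_def)
    qed (use insert.prems in auto)
    moreover have "T (\<lambda>x. \<phi> x - \<phi>1 x) = 0"
    proof -
      have "\<phi> x - \<phi>1 x = 0" if "x $ j = 0" for x :: "real^'n"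
      proof -
        have "scale_coord j 0 x = x" "Q x = 0" using that by (auto simp: scale_coord_def Q_def vec_eq_iff)
        then show ?thesis by (simp add: \<phi>1_def)
      qed
      then obtain \<theta> where "\<theta> \<in> Schwartz" "(\<lambda>x. \<phi> x - \<phi>1 x) = (\<lambda>x. of_real (x $ j) * \<theta> x)"
        using Schwartz_divide_coord[OF Schwartz_diff[OF insert.prems(2) \<phi>1]] by metis
      then show ?thesis using insert.prems(1)[of j \<theta>] by simp
    qed
    ultimately show ?case
      using add[OF \<phi>1 Schwartz_diff[OF insert.prems(2) \<phi>1]] by simp
  qed
qed

definition tangential :: "('k::finite \<Rightarrow> 'n::finite) \<Rightarrow> real^'n \<Rightarrow> real^'k" where
  "tangential \<iota> x = (\<chi> i. x $ \<iota> i)"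

definition normal :: "('k::finite \<Rightarrow> 'n::finite) \<Rightarrow> real^'n \<Rightarrow> real^'n" where
  "normal \<iota> x = (\<chi> j. if j \<in> range \<iota> then 0 else x $ j)"

lemma embed_nth:
  assumes "inj \<iota>"
  shows "embed \<iota> y $ \<iota> i = y $ i" and "j \<notin> range \<iota> \<Longrightarrow> embed \<iota> y $ j = 0"
proof -
  have *: "embed \<iota> y $ j = (\<Sum>k\<in>UNIV. if \<iota> k = j then y $ k else 0)" for j
    unfolding embed_def sum_component by (rule sum.cong) (auto simp: axis_def)
  have "(\<Sum>k\<in>UNIV. if \<iota> k = \<iota> i then y $ k else 0) = (\<Sum>k\<in>UNIV. if k = i then y $ k else 0)"
    using assms by (intro sum.cong) (auto dest: injD)
  then show "embed \<iota> y $ \<iota> i = y $ i" unfolding * by simp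
  show "j \<notin> range \<iota> \<Longrightarrow> embed \<iota> y $ j = 0" unfolding * by (rule sum.neutral) auto
qed

lemma embed_tangential_normal:
  assumes "inj \<iota>" shows "x = embed \<iota> (tangential \<iota> x) + normal \<iota> x"
proof -
  have "x $ j = embed \<iota> (tangential \<iota> x) $ j + normal \<iota> x $ j" for j
    by (cases "j \<in> range \<iota>") (auto simp: embed_nth[OF assms] tangential_def normal_def)
  then show ?thesis by (simp add: vec_eq_iff)
qed

lemma norm_embed:
  assumes "inj \<iota>" shows "norm (embed \<iota> y) = norm y"
proof -
  have "(\<Sum>j\<in>UNIV. (embed \<iota> y $ j)\<^sup>2) = (\<Sum>j\<in>range \<iota>. (embed \<iota> y $ j)\<^sup>2)"
    by (rule sum.mono_neutral_right) (auto simp: embed_nth[OF assms])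
  also have "\<dots> = (\<Sum>i\<in>UNIV. (y $ i)\<^sup>2)"
    by (subst sum.reindex[OF assms]) (simp add: embed_nth[OF assms])
  finally show ?thesis by (simp add: norm_vec_def L2_set_def)
qed

lemma bounded_linear_embed: "bounded_linear (embed \<iota>)"
proof (rule bounded_linear_vec_lambda)
  fix j
  show "bounded_linear (\<lambda>y. embed \<iota> y $ j)"
    unfolding embed_def sum_component
  proof (rule bounded_linear_sum)
    fix i show "bounded_linear (\<lambda>y. axis (\<iota> i) (y $ i) $ j)"
      by (cases "j = \<iota> i") (auto simp: axis_def bounded_linear_vec_nth bounded_linear_zero)
  qed
qed

lemma norm_orthogonal_matrix:
  fixes U :: "real^'n::finite^'n"
  assumes "orthogonal_matrix U" shows "norm (U *v x) = norm x"
proof -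
  have "orthogonal_transformation ((*v) U)"
    using assms by (simp add: orthogonal_transformation_matrix)
  then show ?thesis by (rule orthogonal_transformation_norm)
qed

lemma orthogonal_matrix_mult_transpose:
  fixes U :: "real^'n::finite^'n"
  assumes "orthogonal_matrix U"
  shows "transpose U *v (U *v x) = x" "U *v (transpose U *v x) = x"
  using assms unfolding orthogonal_matrix_def by (simp_all only: matrix_vector_mul_assoc matrix_vector_mul_lid)

lemma bounded_linear_matrix_mult: "bounded_linear ((*v) (U :: real^'n::finite^'m::finite))"
  by (rule matrix_vector_mul_bounded_linear)

lemma Schwartz_comp_matrix:
  assumes "orthogonal_matrix U" "\<phi> \<in> Schwartz" shows "(\<lambda>x. \<phi> (U *v x)) \<in> Schwartz"
  by (rule Schwartz_comp_linear[where c = 1])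
     (use assms in \<open>auto simp: norm_orthogonal_matrix bounded_linear_matrix_mult\<close>)

lemma Schwartz_comp_embed:
  assumes "inj \<iota>" "\<phi> \<in> Schwartz" shows "(\<lambda>y. \<phi> (embed \<iota> y)) \<in> Schwartz"
  by (rule Schwartz_comp_linear[where c = 1])
     (use assms in \<open>auto simp: norm_embed bounded_linear_embed\<close>)

text \<open>The distribution \<open>g\<close> on the subspace is \<open>T\<close> applied to an extension of the test function by a Gaussian
in the normal directions, a continuous operator on Schwartz functions. By the previous vanishing lemma \<open>T\<close> cannot tell
a test function from the extension of its restriction.\<close>
theorem G_temperedI:
  fixes \<iota> :: "'k::finite \<Rightarrow> 'n::finite" and U :: "real^'n^'n"
  assumes \<iota>: "inj \<iota>" and T: "T \<in> tempered" and U: "orthogonal_matrix U"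
    and ann: "\<And>j \<phi>. j \<notin> range \<iota> \<Longrightarrow> \<phi> \<in> Schwartz \<Longrightarrow> T (\<lambda>x. of_real ((U *v x) $ j) * \<phi> x) = 0"
  shows "T \<in> G_tempered \<iota>"
proof -
  define P where "P = (\<lambda>x. tangential \<iota> (U *v x))"
  define Q where "Q = (\<lambda>x. normal \<iota> (U *v x))"
  define E where "E = (\<lambda>(\<psi> :: real^'k \<Rightarrow> complex) x. of_real (exp (- (1 * (norm (Q x))\<^sup>2))) * \<psi> (P x))"
  define g where "g = (\<lambda>\<psi>\<in>Schwartz. T (E \<psi>))"
  have P: "bounded_linear P" unfolding P_def tangential_def
    by (intro bounded_linear_vec_lambda) (simp add: bounded_linear_compose[OF bounded_linear_vec_nth bounded_linear_matrix_mult])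
  have Q: "bounded_linear Q"
  proof (rule bounded_linear_vec_lambda)
    fix i show "bounded_linear (\<lambda>x. Q x $ i)"
      by (cases "i \<in> range \<iota>") (auto simp: Q_def normal_def bounded_linear_zero bounded_linear_compose[OF bounded_linear_vec_nth bounded_linear_matrix_mult])
  qed
  have PQ: "norm x \<le> norm (P x) + norm (Q x)" for x
  proof -
    have "norm (U *v x) \<le> norm (embed \<iota> (tangential \<iota> (U *v x))) + norm (normal \<iota> (U *v x))"
      using embed_tangential_normal[OF \<iota>] norm_triangle_ineq by metis
    then show ?thesis by (simp add: norm_orthogonal_matrix[OF U] norm_embed[OF \<iota>] P_def Q_def)
  qed
  have along: "schwartz_along P (\<lambda>x. of_real (exp (- (1 * (norm (Q x))\<^sup>2))))"
    by (rule schwartz_along_gaussian[OF Q PQ]) simp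
  have E: "E \<psi> \<in> Schwartz" if "\<psi> \<in> Schwartz" for \<psi>
    unfolding E_def using Schwartz_mult_comp(1)[OF along P that] .
  have "continuous_map schwartz_topology euclidean (T \<circ> E)"
    unfolding E_def by (rule continuous_map_compose[OF continuous_map_mult_comp[OF along P] tempered_continuous[OF T]])
  then have "continuous_map schwartz_topology euclidean g"
    by (rule continuous_map_eq) (simp add: g_def)
  then have "g \<in> tempered"
    unfolding tempered_def mem_Collect_eq
  proof (intro conjI ballI allI)
    show "g \<in> extensional Schwartz" unfolding g_def by (rule restrict_extensional)
    fix \<phi> \<psi> :: "real^'k \<Rightarrow> complex" assume \<phi>: "\<phi> \<in> Schwartz" and \<psi>: "\<psi> \<in> Schwartz"
    show "g (\<lambda>x. \<phi> x + \<psi> x) = g \<phi> + g \<psi>"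
      using tempered_add[OF T E[OF \<phi>] E[OF \<psi>]] Schwartz_add[OF \<phi> \<psi>] \<phi> \<psi> by (simp add: g_def E_def distrib_left)
  next
    fix c and \<phi> :: "real^'k \<Rightarrow> complex" assume \<phi>: "\<phi> \<in> Schwartz"
    show "g (\<lambda>x. c * \<phi> x) = c * g \<phi>"
      using tempered_cmult[OF T E[OF \<phi>], of c] Schwartz_cmult[OF \<phi>, of c] \<phi> by (simp add: g_def E_def mult.left_commute)
  qed
  moreover have "T = rotate_dist U (tensor_delta \<iota> g)"
  proof (rule extensionalityI[OF tempered_extensional[OF T]])
    show "rotate_dist U (tensor_delta \<iota> g) \<in> extensional Schwartz"
      unfolding rotate_dist_def by (rule restrict_extensional)
    fix \<phi> :: "real^'n \<Rightarrow> complex" assume \<phi>: "\<phi> \<in> Schwartz"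
    let ?\<psi> = "\<lambda>y. \<phi> (transpose U *v embed \<iota> y)"
    have tU: "orthogonal_matrix (transpose U)" using U by (simp add: orthogonal_matrix_transpose)
    note \<phi>U = Schwartz_comp_matrix[OF tU \<phi>]
    note \<psi> = Schwartz_comp_embed[OF \<iota> \<phi>U]
    have "T (\<lambda>x. \<phi> x - E ?\<psi> x) = 0"
    proof -
      define T' where "T' = (\<lambda>h :: real^'n \<Rightarrow> complex. T (\<lambda>x. h (U *v x)))"
      define h where "h = (\<lambda>x. \<phi> (transpose U *v x) - E ?\<psi> (transpose U *v x))"
      have "T' h = 0"
      proof (rule vanish_on_coordinate_subspace[where T = T' and \<phi> = h and S = "- range \<iota>"])
        show "h \<in> Schwartz" unfolding h_def
          by (rule Schwartz_comp_matrix[OF tU Schwartz_diff[OF \<phi> E[OF \<psi>]]])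
        show "T' (\<lambda>x. \<phi> x + \<psi> x) = T' \<phi> + T' \<psi>" if "\<phi> \<in> Schwartz" "\<psi> \<in> Schwartz" for \<phi> \<psi>
          unfolding T'_def by (intro tempered_add[OF T] Schwartz_comp_matrix U that)
        show "T' (\<lambda>x. of_real (x $ j) * \<phi> x) = 0" if "j \<in> - range \<iota>" "\<phi> \<in> Schwartz" for j \<phi>
          unfolding T'_def using that by (intro ann Schwartz_comp_matrix U) auto
        fix x :: "real^'n" assume x: "\<And>j. j \<in> - range \<iota> \<Longrightarrow> x $ j = 0"
        then have "normal \<iota> x = 0" by (simp add: normal_def vec_eq_iff)
        moreover from this have "embed \<iota> (tangential \<iota> x) = x" using embed_tangential_normal[OF \<iota>, of x] by simp
        ultimately show "h x = 0"
          unfolding h_def E_def P_def Q_def orthogonal_matrix_mult_transpose[OF U] by simp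
      qed
      then show ?thesis unfolding T'_def h_def by (simp only: orthogonal_matrix_mult_transpose[OF U])
    qed
    then have "T \<phi> = T (E ?\<psi>)" using tempered_diff[OF T \<phi> E[OF \<psi>]] by simp
    then show "T \<phi> = rotate_dist U (tensor_delta \<iota> g) \<phi>"
      using \<phi> \<phi>U \<psi> by (simp add: rotate_dist_def tensor_delta_def g_def)
  qed
  ultimately show ?thesis unfolding G_tempered_def using U by blast
qed


section \<open>Integrals over Euclidean space\<close>

lemma norm_le_norm_real: "0 \<le> a \<Longrightarrow> a \<le> b \<Longrightarrow> norm a \<le> norm (b :: real)"
  by simp

lemma
  fixes f :: "'a::euclidean_space \<Rightarrow> real \<Rightarrow> real"
  assumes nn: "\<And>b t. b \<in> Basis \<Longrightarrow> 0 \<le> f b t" and int: "\<And>b. b \<in> Basis \<Longrightarrow> integrable lborel (f b)"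
  shows integrable_lborel_prod: "integrable lborel (\<lambda>x::'a. \<Prod>b\<in>Basis. f b (x \<bullet> b))"
    and integral_lborel_prod: "(\<integral>x. (\<Prod>b\<in>Basis. f b (x \<bullet> b)) \<partial>lborel) = (\<Prod>b\<in>Basis. (\<integral>t. f b t \<partial>lborel))"
proof -
  have m[measurable]: "f b \<in> borel_measurable borel" if "b \<in> Basis" for b
    using int[OF that] by auto
  have pos: "0 \<le> (\<Prod>b\<in>Basis. f b (x \<bullet> b))" for x by (intro prod_nonneg nn)
  have "(\<integral>\<^sup>+x. ennreal (\<Prod>b\<in>Basis. f b (x \<bullet> b)) \<partial>lborel)
      = (\<integral>\<^sup>+x. (\<Prod>b\<in>Basis. ennreal (f b (x \<bullet> b))) \<partial>lborel)"
    by (intro nn_integral_cong) (simp add: prod_ennreal nn)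
  also have "\<dots> = (\<Prod>b\<in>Basis. (\<integral>\<^sup>+t. ennreal (f b t) \<partial>lborel))"
    by (rule nn_integral_lborel_prod) auto
  also have "\<dots> = (\<Prod>b\<in>Basis. ennreal (\<integral>t. f b t \<partial>lborel))"
    by (intro prod.cong refl nn_integral_eq_integral int) (auto simp: nn)
  also have "\<dots> = ennreal (\<Prod>b\<in>Basis. (\<integral>t. f b t \<partial>lborel))"
    by (intro prod_ennreal integral_nonneg_AE) (auto simp: nn)
  finally have e: "(\<integral>\<^sup>+x. ennreal (\<Prod>b\<in>Basis. f b (x \<bullet> b)) \<partial>lborel) = ennreal (\<Prod>b\<in>Basis. (\<integral>t. f b t \<partial>lborel))" .
  have mm: "(\<lambda>x::'a. \<Prod>b\<in>Basis. f b (x \<bullet> b)) \<in> borel_measurable lborel" by measurable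
  have "has_bochner_integral lborel (\<lambda>x::'a. \<Prod>b\<in>Basis. f b (x \<bullet> b)) (\<Prod>b\<in>Basis. (\<integral>t. f b t \<partial>lborel))"
    by (rule has_bochner_integral_nn_integral[OF mm _ _ e])
       (auto simp: pos nn intro!: prod_nonneg integral_nonneg_AE)
  then show "integrable lborel (\<lambda>x::'a. \<Prod>b\<in>Basis. f b (x \<bullet> b))"
    "(\<integral>x. (\<Prod>b\<in>Basis. f b (x \<bullet> b)) \<partial>lborel) = (\<Prod>b\<in>Basis. (\<integral>t. f b t \<partial>lborel))"
    by (auto simp: has_bochner_integral_iff)
qed

text \<open>The weight is dominated by the product of the one-dimensional densities \<open>inverse (1 + t\<^sup>2)\<close>.\<close>
lemma integrable_inverse_power_norm:
  "integrable lborel (\<lambda>x :: real^'n::finite. inverse ((1 + norm x) ^ (2 * DIM(real^'n))))"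
proof -
  have 1: "integrable lborel (\<lambda>t::real. inverse (1 + t\<^sup>2))"
    using integrable_inverse_1_plus_square by (simp add: set_integrable_def)
  have "integrable lborel (\<lambda>x :: real^'n. \<Prod>b\<in>Basis. inverse (1 + (x \<bullet> b)\<^sup>2))"
    by (rule integrable_lborel_prod) (auto simp: 1 add_nonneg_nonneg)
  then show ?thesis
  proof (rule Bochner_Integration.integrable_bound)
    show "AE x in lborel. norm (inverse ((1 + norm (x :: real^'n)) ^ (2 * DIM(real^'n)))) \<le> norm (\<Prod>b\<in>Basis. inverse (1 + (x \<bullet> b)\<^sup>2))"
    proof (rule AE_I2)
      fix x :: "real^'n"
      have "(\<Prod>b\<in>Basis. 1 + (x \<bullet> b)\<^sup>2) \<le> (\<Prod>b\<in>(Basis :: (real^'n) set). (1 + norm x)\<^sup>2)"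
      proof (rule prod_mono)
        fix b :: "real^'n" assume b: "b \<in> Basis"
        have "(x \<bullet> b)\<^sup>2 \<le> (norm x)\<^sup>2" using Basis_le_norm[OF b, of x] by (metis abs_le_square_iff abs_norm_cancel)
        moreover have "(1 + norm x)\<^sup>2 = 1 + 2 * norm x + (norm x)\<^sup>2" by (simp add: power2_sum)
        moreover have "0 \<le> norm x" by simp
        ultimately have "1 + (x \<bullet> b)\<^sup>2 \<le> (1 + norm x)\<^sup>2" by linarith
        then show "0 \<le> 1 + (x \<bullet> b)\<^sup>2 \<and> 1 + (x \<bullet> b)\<^sup>2 \<le> (1 + norm x)\<^sup>2" by (simp add: add_nonneg_nonneg)
      qed
      also have "\<dots> = (1 + norm x) ^ (2 * DIM(real^'n))" by (simp add: power_mult)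
      finally have le: "(\<Prod>b\<in>Basis. 1 + (x \<bullet> b)\<^sup>2) \<le> (1 + norm x) ^ (2 * DIM(real^'n))" .
      have pos: "0 < (\<Prod>b\<in>Basis. 1 + (x \<bullet> b)\<^sup>2)" by (intro prod_pos) (auto simp: add_pos_nonneg)
      have "inverse ((1 + norm x) ^ (2 * DIM(real^'n))) \<le> inverse (\<Prod>b\<in>Basis. 1 + (x \<bullet> b)\<^sup>2)"
        using le pos by (rule le_imp_inverse_le)
      moreover have "inverse (\<Prod>b\<in>Basis. 1 + (x \<bullet> b)\<^sup>2) = (\<Prod>b\<in>Basis. inverse (1 + (x \<bullet> b)\<^sup>2))"
        using prod_inversef[of "\<lambda>b. 1 + (x \<bullet> b)\<^sup>2" Basis] by (simp add: o_def)
      ultimately have main: "inverse ((1 + norm x) ^ (2 * DIM(real^'n))) \<le> (\<Prod>b\<in>Basis. inverse (1 + (x \<bullet> b)\<^sup>2))"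
        by (simp only:)
      then show "norm (inverse ((1 + norm x) ^ (2 * DIM(real^'n)))) \<le> norm (\<Prod>b\<in>Basis. inverse (1 + (x \<bullet> b)\<^sup>2))"
        by (intro norm_le_norm_real) auto
    qed
  qed simp
qed

lemma integrable_Schwartz_weighted:
  fixes f :: "real^'n::finite \<Rightarrow> complex"
  assumes f: "f \<in> Schwartz" shows "integrable lborel (\<lambda>x. (1 + norm x) ^ N * norm (f x))"
proof (rule Bochner_Integration.integrable_bound[OF integrable_mult_right[OF integrable_inverse_power_norm]])
  let ?C = "schwartz_seminorm (N + 2 * DIM(real^'n)) [] f"
  have [measurable]: "f \<in> borel_measurable borel" using f by (rule Schwartz_measurable)
  show "(\<lambda>x. (1 + norm x) ^ N * norm (f x)) \<in> borel_measurable lborel" by simp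
  show "AE x in lborel. norm ((1 + norm x) ^ N * norm (f x)) \<le> norm (?C * inverse ((1 + norm x) ^ (2 * DIM(real^'n))))"
  proof (rule AE_I2)
    fix x :: "real^'n"
    have "(1 + norm x) ^ N * norm (f x) * (1 + norm x) ^ (2 * DIM(real^'n)) \<le> ?C"
      using schwartz_seminorm_ge[OF f, of x "N + 2 * DIM(real^'n)" "[]"] by (simp add: power_add mult_ac)
    then have "(1 + norm x) ^ N * norm (f x) \<le> ?C * inverse ((1 + norm x) ^ (2 * DIM(real^'n)))"
      by (simp add: divide_inverse[symmetric] pos_le_divide_eq add_pos_nonneg)
    then show "norm ((1 + norm x) ^ N * norm (f x)) \<le> norm (?C * inverse ((1 + norm x) ^ (2 * DIM(real^'n))))"
      by (intro norm_le_norm_real) auto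
  qed
qed

lemma integrable_Schwartz: "f \<in> Schwartz \<Longrightarrow> integrable lborel f"
  using integrable_Schwartz_weighted[of f 0] Schwartz_measurable[of f] by (simp add: integrable_norm_iff)

lemma integrable_mult_bounded:
  fixes f g :: "'a \<Rightarrow> complex"
  assumes "integrable \<mu> f" "g \<in> borel_measurable \<mu>" "\<And>x. norm (g x) \<le> C"
  shows "integrable \<mu> (\<lambda>x. f x * g x)"
proof (rule Bochner_Integration.integrable_bound[OF integrable_mult_right[OF integrable_norm[OF assms(1)], of C]])
  show "(\<lambda>x. f x * g x) \<in> borel_measurable \<mu>" using assms by measurable
  have "0 \<le> C" using assms(3)[of undefined] norm_ge_zero order_trans by blast
  then show "AE x in \<mu>. norm (f x * g x) \<le> norm (C * norm (f x))"
    using assms(3) by (intro AE_I2) (auto simp: norm_mult abs_mult mult.commute[of C] intro!: mult_left_mono)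
qed

lemma integrable_mult_Schwartz:
  assumes "integrable lborel f" "\<phi> \<in> Schwartz" shows "integrable lborel (\<lambda>x. f x * \<phi> x)"
  by (rule integrable_mult_bounded[OF assms(1) _ Schwartz_bounded[OF assms(2)]]) (simp add: Schwartz_measurable assms(2))

lemma fun_dist_lborel:
  assumes [measurable]: "f \<in> borel_measurable borel"
  shows "fun_dist f = (\<lambda>\<phi>\<in>Schwartz. LINT x|lborel. f x * \<phi> x)"
  unfolding fun_dist_def
  by (rule restrict_ext, rule integral_completion) (use Schwartz_measurable in measurable)

lemma fun_dist_tempered:
  fixes f :: "real^'n::finite \<Rightarrow> complex"
  assumes f: "f \<in> Schwartz" shows "fun_dist f \<in> tempered"
proof -
  note fm = Schwartz_measurable[OF f]
  note int = integrable_mult_Schwartz[OF integrable_Schwartz[OF f]]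
  have "continuous_map schwartz_topology euclidean (fun_dist f)"
  proof (rule continuous_map_schwartz_euclidean)
    fix \<phi> \<psi> :: "real^'n \<Rightarrow> complex" assume \<phi>: "\<phi> \<in> Schwartz" and \<psi>: "\<psi> \<in> Schwartz"
    have "fun_dist f \<phi> - fun_dist f \<psi> = (LINT x|lborel. f x * (\<phi> x - \<psi> x))"
      using \<phi> \<psi> int by (simp add: fun_dist_lborel[OF fm] right_diff_distrib)
    also have "norm \<dots> \<le> (LINT x|lborel. norm (f x) * schwartz_seminorm 0 [] (\<lambda>x. \<phi> x - \<psi> x))"
      by (rule norm_integral_le[OF int[OF Schwartz_diff[OF \<phi> \<psi>]]])
         (auto intro!: integrable_Schwartz f mult_left_mono Schwartz_bounded[OF Schwartz_diff[OF \<phi> \<psi>]] simp: norm_mult)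
    finally show "dist (fun_dist f \<phi>) (fun_dist f \<psi>)
       \<le> (LINT x|lborel. norm (f x)) * (\<Sum>(K, js)\<in>{(0, [])}. schwartz_seminorm K js (\<lambda>x. \<phi> x - \<psi> x))"
      by (simp add: dist_norm)
  qed auto
  then show ?thesis
    unfolding tempered_def mem_Collect_eq
    using int by (auto simp: fun_dist_lborel[OF fm] Schwartz_add Schwartz_cmult distrib_left mult.left_commute)
qed

lemma
  fixes f :: "'a::euclidean_space \<Rightarrow> 'b::{banach, second_countable_topology}"
  assumes "f \<in> borel_measurable borel"
  shows integral_lborel_translate: "(LINT x|lborel. f (x - c)) = (LINT x|lborel. f x)"
    and integrable_lborel_translate: "integrable lborel (\<lambda>x. f (x - c)) \<longleftrightarrow> integrable lborel f"
  using integral_distr[of "(+) (- c)" lborel borel f] integrable_distr_eq[of "(+) (- c)" lborel borel f] assms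
  by (simp_all add: lborel_distr_plus)

subsection \<open>The Gaussian\<close>

definition gauss :: "real \<Rightarrow> real^'n::finite \<Rightarrow> real" where
  "gauss \<epsilon> x = (2 * pi * \<epsilon>\<^sup>2) powr (- real CARD('n) / 2) * exp (- (norm x)\<^sup>2 / (2 * \<epsilon>\<^sup>2))"

lemma gaussian_eq_gauss: "gaussian \<epsilon> x = of_real (gauss \<epsilon> x)"
  by (simp add: gaussian_def gauss_def)

lemma gauss_nonneg: "0 \<le> gauss \<epsilon> x"
  by (simp add: gauss_def)

lemma gauss_minus: "gauss \<epsilon> (x - y) = gauss \<epsilon> (y - x)"
  by (simp add: gauss_def norm_minus_commute)

lemma gauss_measurable [measurable]: "gauss \<epsilon> \<in> borel_measurable borel"
  unfolding gauss_def by measurable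

lemma gauss_eq_prod:
  assumes "0 < \<epsilon>"
  shows "gauss \<epsilon> (x :: real^'n::finite) = (\<Prod>b\<in>Basis. normal_density 0 \<epsilon> (x \<bullet> b))"
proof -
  have "(\<Prod>b\<in>(Basis :: (real^'n) set). normal_density 0 \<epsilon> (x \<bullet> b)) =
    (1 / sqrt (2 * pi * \<epsilon>\<^sup>2)) ^ CARD('n) * exp (\<Sum>b\<in>Basis. - (x \<bullet> b)\<^sup>2 / (2 * \<epsilon>\<^sup>2))"
    by (simp add: normal_density_def prod.distrib exp_sum prod_dividef power_one_over)
  also have "(\<Sum>b\<in>Basis. - (x \<bullet> b)\<^sup>2 / (2 * \<epsilon>\<^sup>2)) = - (norm x)\<^sup>2 / (2 * \<epsilon>\<^sup>2)"
    unfolding power2_norm_eq_inner euclidean_inner[of x x] by (simp add: power2_eq_square sum_negf sum_divide_distrib)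
  also have "(1 / sqrt (2 * pi * \<epsilon>\<^sup>2)) ^ CARD('n) = (2 * pi * \<epsilon>\<^sup>2) powr (- real CARD('n) / 2)"
  proof -
    have "1 / sqrt (2 * pi * \<epsilon>\<^sup>2) = (2 * pi * \<epsilon>\<^sup>2) powr (- 1 / 2)"
      using assms by (simp add: powr_minus_divide powr_half_sqrt)
    then have "(1 / sqrt (2 * pi * \<epsilon>\<^sup>2)) ^ CARD('n) = ((2 * pi * \<epsilon>\<^sup>2) powr (- 1 / 2)) powr real CARD('n)"
      using assms by (simp add: powr_realpow)
    then show ?thesis by (simp add: powr_powr)
  qed
  finally show ?thesis by (simp add: gauss_def)
qed

lemma integrable_gauss:
  assumes "0 < \<epsilon>" shows "integrable lborel (gauss \<epsilon> :: real^'n::finite \<Rightarrow> real)"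
proof -
  have "(gauss \<epsilon> :: real^'n \<Rightarrow> real) = (\<lambda>x. \<Prod>b\<in>Basis. normal_density 0 \<epsilon> (x \<bullet> b))"
    using gauss_eq_prod[OF assms] by (rule ext)
  then show ?thesis
    using integrable_lborel_prod[of "\<lambda>_ :: real^'n. normal_density 0 \<epsilon>"] assms by simp
qed

lemma integral_gauss:
  assumes "0 < \<epsilon>" shows "(LINT x|lborel. gauss \<epsilon> (x :: real^'n::finite)) = 1"
  using integral_lborel_prod[of "\<lambda>_ :: real^'n. normal_density 0 \<epsilon>"] assms
  by (simp add: gauss_eq_prod)

text \<open>The factor \<open>norm x\<close> is absorbed by half of the exponent, \<open>norm x * exp (- (norm x)\<^sup>2 / (4 * \<epsilon>\<^sup>2)) \<le> 2 * \<epsilon>\<close>,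
and the other half is a Gaussian of width \<open>sqrt 2 * \<epsilon>\<close>. This \<open>O(\<epsilon>)\<close> drives all estimates
for \<open>\<epsilon> \<rightarrow> 0\<close>.\<close>
lemma gauss_first_moment:
  "\<exists>K\<ge>0. \<forall>\<epsilon>>0. integrable lborel (\<lambda>x :: real^'n::finite. norm x * gauss \<epsilon> x) \<and>
    (LINT x|lborel. norm (x :: real^'n) * gauss \<epsilon> x) \<le> K * \<epsilon>"
proof -
  define K where "K = 2 * 2 powr (real CARD('n) / 2)"
  have le: "norm x * gauss \<epsilon> x \<le> K * \<epsilon> * gauss (sqrt 2 * \<epsilon>) x" if \<epsilon>: "0 < \<epsilon>" for \<epsilon> and x :: "real^'n"
  proof -
    define t where "t = norm x / (2 * \<epsilon>)"
    have "t \<le> exp (t\<^sup>2)"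
    proof -
      have "0 \<le> (t - 1)\<^sup>2 + t\<^sup>2" by simp
      then have "t \<le> 1 + t\<^sup>2" by (simp add: power2_eq_square algebra_simps)
      then show ?thesis using exp_ge_add_one_self[of "t\<^sup>2"] by linarith
    qed
    then have "t * exp (- t\<^sup>2) \<le> 1" by (simp add: exp_minus field_simps)
    then have 1: "norm x * exp (- t\<^sup>2) \<le> 2 * \<epsilon>" using \<epsilon> by (simp add: t_def field_simps)
    have t2: "t\<^sup>2 = (norm x)\<^sup>2 / (4 * \<epsilon>\<^sup>2)" by (simp add: t_def power_divide power_mult_distrib)
    have 2: "exp (- (norm x)\<^sup>2 / (2 * \<epsilon>\<^sup>2)) = exp (- t\<^sup>2) * exp (- (norm x)\<^sup>2 / (2 * (sqrt 2 * \<epsilon>)\<^sup>2))"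
      unfolding exp_add[symmetric] t2 using \<epsilon> by (simp add: power_mult_distrib field_simps)
    have 3: "(2 * pi * \<epsilon>\<^sup>2) powr (- real CARD('n) / 2) = 2 powr (real CARD('n) / 2) * (2 * pi * (sqrt 2 * \<epsilon>)\<^sup>2) powr (- real CARD('n) / 2)"
    proof -
      have "(2 * pi * (sqrt 2 * \<epsilon>)\<^sup>2) = 2 * (2 * pi * \<epsilon>\<^sup>2)" by (simp add: power_mult_distrib)
      then have "(2 * pi * (sqrt 2 * \<epsilon>)\<^sup>2) powr (- real CARD('n) / 2) = 2 powr (- real CARD('n) / 2) * (2 * pi * \<epsilon>\<^sup>2) powr (- real CARD('n) / 2)"
        by (simp only:) (subst powr_mult; simp)
      moreover have "2 powr (real CARD('n) / 2) * 2 powr (- real CARD('n) / 2) = (1::real)"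
        by (simp flip: powr_add)
      ultimately show ?thesis by (simp flip: mult.assoc)
    qed
    have "norm x * gauss \<epsilon> x = (norm x * exp (- t\<^sup>2)) * (2 powr (real CARD('n) / 2) * gauss (sqrt 2 * \<epsilon>) x)"
      unfolding gauss_def 2 3 by (simp add: mult_ac)
    also have "\<dots> \<le> (2 * \<epsilon>) * (2 powr (real CARD('n) / 2) * gauss (sqrt 2 * \<epsilon>) x)"
      by (intro mult_right_mono 1) (simp add: gauss_nonneg)
    finally show ?thesis by (simp add: K_def mult_ac)
  qed
  have K: "0 \<le> K" by (simp add: K_def)
  have "integrable lborel (\<lambda>x :: real^'n. norm x * gauss \<epsilon> x) \<and> (LINT x|lborel. norm (x :: real^'n) * gauss \<epsilon> x) \<le> K * \<epsilon>"
    if \<epsilon>: "0 < \<epsilon>" for \<epsilon>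
  proof
    have int: "integrable lborel (\<lambda>x :: real^'n. K * \<epsilon> * gauss (sqrt 2 * \<epsilon>) x)"
      using \<epsilon> by (intro integrable_mult_right integrable_gauss) auto
    then show 1: "integrable lborel (\<lambda>x :: real^'n. norm x * gauss \<epsilon> x)"
      by (rule Bochner_Integration.integrable_bound)
         (use le[OF \<epsilon>] \<epsilon> K in \<open>auto intro!: AE_I2 simp: abs_mult gauss_nonneg\<close>)
    have "(LINT x|lborel. norm (x :: real^'n) * gauss \<epsilon> x) \<le> (LINT x|lborel. K * \<epsilon> * gauss (sqrt 2 * \<epsilon>) (x :: real^'n))"
      by (rule integral_mono[OF 1 int le[OF \<epsilon>]])
    also have "\<dots> = K * \<epsilon>" using \<epsilon> by (simp add: integral_gauss)
    finally show "(LINT x|lborel. norm (x :: real^'n) * gauss \<epsilon> x) \<le> K * \<epsilon>" .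
  qed
  with K show ?thesis by blast
qed

lemma integrable_gaussian: "0 < \<epsilon> \<Longrightarrow> integrable lborel (gaussian \<epsilon>)"
  unfolding gaussian_eq_gauss[abs_def] by (intro integrable_of_real integrable_gauss)

lemma gaussian_minus: "gaussian \<epsilon> (x - y) = gaussian \<epsilon> (y - x)"
  unfolding gaussian_eq_gauss by (subst gauss_minus) (rule refl)

lemma gaussian_measurable [measurable]: "gaussian \<epsilon> \<in> borel_measurable borel"
  unfolding gaussian_eq_gauss[abs_def] by measurable

lemma
  fixes x :: "real^'n::finite"
  assumes \<epsilon>: "0 < \<epsilon>"
  shows integrable_gaussian_reflect: "integrable lborel (\<lambda>y. gaussian \<epsilon> (x - y))"
    and integral_gaussian_reflect: "(LINT y|lborel. gaussian \<epsilon> (x - y)) = 1"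
    and integrable_moment_reflect: "integrable lborel (\<lambda>y. norm (x - y) * gauss \<epsilon> (x - y))"
    and integral_moment_reflect: "(LINT y|lborel. norm (x - y) * gauss \<epsilon> (x - y)) =
      (LINT u|lborel. norm (u :: real^'n) * gauss \<epsilon> u)"
proof -
  show "integrable lborel (\<lambda>y. gaussian \<epsilon> (x - y))" "(LINT y|lborel. gaussian \<epsilon> (x - y)) = 1"
    unfolding gaussian_minus[of \<epsilon> x]
    using integrable_lborel_translate[of "gaussian \<epsilon>" x] integral_lborel_translate[of "gaussian \<epsilon>" x]
      integrable_gaussian[OF \<epsilon>] integral_gauss[OF \<epsilon>]
    by (simp_all add: gaussian_eq_gauss)
  have q: "integrable lborel (\<lambda>u :: real^'n. norm u * gauss \<epsilon> u)" using gauss_first_moment \<epsilon> by blast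
  show "integrable lborel (\<lambda>y. norm (x - y) * gauss \<epsilon> (x - y))"
    "(LINT y|lborel. norm (x - y) * gauss \<epsilon> (x - y)) = (LINT u|lborel. norm (u :: real^'n) * gauss \<epsilon> u)"
    unfolding gauss_minus[of \<epsilon> x] norm_minus_commute[of x]
    using integrable_lborel_translate[of "\<lambda>y. norm y * gauss \<epsilon> y" x]
      integral_lborel_translate[of "\<lambda>y. norm y * gauss \<epsilon> y" x] q
    by simp_all
qed

subsection \<open>Smearing a density on a subspace\<close>

text \<open>The convolution of \<open>k\<close> with the image under \<open>B\<close> of the measure with density \<open>a\<close>. For \<open>B = (\<lambda>y. y)\<close>
it is an ordinary convolution.\<close>
definition smear :: "(real^'k::finite \<Rightarrow> real^'n::finite) \<Rightarrow> (real^'k \<Rightarrow> 'b) \<Rightarrow> (real^'n \<Rightarrow> 'b) \<Rightarrow> real^'n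
    \<Rightarrow> 'b::{real_normed_field, banach, second_countable_topology}" where
  "smear B a k x = (LINT y|lborel. a y * k (x - B y))"

lemma
  fixes a :: "real^'k::finite \<Rightarrow> 'b::{real_normed_field, banach, second_countable_topology}" and B :: "real^'k \<Rightarrow> real^'n::finite"
  assumes a: "integrable lborel a" and k: "integrable lborel k" and B [measurable]: "B \<in> borel_measurable borel"
  shows integrable_smear_product: "integrable (lborel \<Otimes>\<^sub>M lborel) (\<lambda>(y, x). a y * k (x - B y))"
    and integrable_smear: "integrable lborel (smear B a k)"
    and smear_L1: "(LINT x|lborel. norm (smear B a k x)) \<le> (LINT y|lborel. norm (a y)) * (LINT x|lborel. norm (k x))"
    and smear_AE: "AE x in lborel. integrable lborel (\<lambda>y. a y * k (x - B y))"
proof -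
  have [measurable]: "a \<in> borel_measurable borel" "k \<in> borel_measurable borel" using a k by auto
  have n: "(LINT x|lborel. norm (a y * k (x - B y))) = norm (a y) * (LINT x|lborel. norm (k x))" for y
    using integral_lborel_translate[of "\<lambda>x. norm (k x)" "B y"] by (simp add: norm_mult)
  have nk: "integrable lborel (\<lambda>x. k (x - B y))" for y
    using integrable_lborel_translate[of k "B y"] k by simp
  show prod: "integrable (lborel \<Otimes>\<^sub>M lborel) (\<lambda>(y, x). a y * k (x - B y))"
  proof (rule lborel_pair.Fubini_integrable)
    show "(\<lambda>(y, x). a y * k (x - B y)) \<in> borel_measurable (lborel \<Otimes>\<^sub>M lborel)" by measurable
    show "integrable lborel (\<lambda>y. LINT x|lborel. norm (case (y, x) of (y, x) \<Rightarrow> a y * k (x - B y)))"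
      using a by (simp add: n)
    show "AE y in lborel. integrable lborel (\<lambda>x. case (y, x) of (y, x) \<Rightarrow> a y * k (x - B y))"
      using nk by simp
  qed
  show "integrable lborel (smear B a k)"
    using lborel_pair.integrable_snd[OF prod] by (simp add: smear_def[abs_def])
  show "AE x in lborel. integrable lborel (\<lambda>y. a y * k (x - B y))"
    using lborel_pair.AE_integrable_snd[OF prod] .
  have prodn: "integrable (lborel \<Otimes>\<^sub>M lborel) (\<lambda>(y, x). norm (a y * k (x - B y)))"
    using integrable_norm[OF prod] by (simp add: case_prod_beta')
  have "(LINT x|lborel. norm (smear B a k x)) \<le> (LINT x|lborel. LINT y|lborel. norm (a y * k (x - B y)))"
    unfolding smear_def
    by (intro integral_mono integral_norm_bound integrable_norm lborel_pair.integrable_snd[OF prod] lborel_pair.integrable_snd[OF prodn])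
  also have "\<dots> = (LINT y|lborel. LINT x|lborel. norm (a y * k (x - B y)))"
    by (rule lborel_pair.Fubini_integral[OF prodn])
  also have "\<dots> = (LINT y|lborel. norm (a y)) * (LINT x|lborel. norm (k x))"
    unfolding n by simp
  finally show "(LINT x|lborel. norm (smear B a k x)) \<le> (LINT y|lborel. norm (a y)) * (LINT x|lborel. norm (k x))" .
qed

lemma norm_smear_ident_diff_le:
  fixes \<phi> :: "real^'n::finite \<Rightarrow> complex"
  assumes \<epsilon>: "0 < \<epsilon>" and i: "integrable lborel (\<lambda>y. \<phi> y * gaussian \<epsilon> (z - y))" and w: "integrable lborel w"
    and le: "\<And>y. norm (\<phi> y - c) * gauss \<epsilon> (z - y) \<le> w y"
  shows "norm (smear (\<lambda>y. y) \<phi> (gaussian \<epsilon>) z - c) \<le> (LINT y|lborel. w y)"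
proof -
  note g = integrable_gaussian_reflect[OF \<epsilon>, of z]
  have "smear (\<lambda>y. y) \<phi> (gaussian \<epsilon>) z - c = (LINT y|lborel. \<phi> y * gaussian \<epsilon> (z - y)) - (LINT y|lborel. c * gaussian \<epsilon> (z - y))"
    by (simp add: smear_def integral_gaussian_reflect[OF \<epsilon>])
  also have "\<dots> = (LINT y|lborel. \<phi> y * gaussian \<epsilon> (z - y) - c * gaussian \<epsilon> (z - y))"
    by (rule Bochner_Integration.integral_diff[symmetric]) (intro i integrable_mult_right g)+
  also have "norm \<dots> \<le> (LINT y|lborel. w y)"
  proof (rule norm_integral_le[OF _ w])
    show "integrable lborel (\<lambda>y. \<phi> y * gaussian \<epsilon> (z - y) - c * gaussian \<epsilon> (z - y))"
      by (intro Bochner_Integration.integrable_diff i integrable_mult_right g)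
    fix y
    have "norm (\<phi> y * gaussian \<epsilon> (z - y) - c * gaussian \<epsilon> (z - y)) = norm (\<phi> y - c) * gauss \<epsilon> (z - y)"
      unfolding left_diff_distrib[symmetric] norm_mult gaussian_eq_gauss norm_of_real by (simp add: gauss_nonneg)
    with le show "norm (\<phi> y * gaussian \<epsilon> (z - y) - c * gaussian \<epsilon> (z - y)) \<le> w y" by simp
  qed
  finally show ?thesis .
qed

lemma smear_Schwartz:
  fixes B :: "real^'k::finite \<Rightarrow> real^'n::finite"
  assumes "\<psi> \<in> Schwartz" "a \<in> borel_measurable lborel" "B \<in> borel_measurable borel"
    "\<And>N. integrable lborel (\<lambda>y. (1 + norm (B y)) ^ N * norm (a y))"
  shows "smear B a \<psi> \<in> Schwartz"
  unfolding smear_def[abs_def] by (rule Schwartz_average) (use assms in auto)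

lemma smear_Schwartz_Schwartz:
  fixes B :: "real^'k::finite \<Rightarrow> real^'n::finite"
  assumes \<psi>: "\<psi> \<in> Schwartz" and a: "a \<in> Schwartz" and B: "bounded_linear B"
  shows "smear B a \<psi> \<in> Schwartz"
proof (rule smear_Schwartz[OF \<psi>])
  show "a \<in> borel_measurable lborel" using Schwartz_measurable[OF a] by simp
  show Bm: "B \<in> borel_measurable borel"
    by (intro borel_measurable_continuous_onI linear_continuous_on B)
  fix N
  obtain K where K: "0 < K" "\<And>y. norm (B y) \<le> norm y * K" using bounded_linear.pos_bounded[OF B] by blast
  show "integrable lborel (\<lambda>y. (1 + norm (B y)) ^ N * norm (a y))"
  proof (rule Bochner_Integration.integrable_bound[OF integrable_mult_right[OF integrable_Schwartz_weighted[OF a, of N], of "(1 + K) ^ N"]])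
    show "(\<lambda>y. (1 + norm (B y)) ^ N * norm (a y)) \<in> borel_measurable lborel"
      using Bm Schwartz_measurable[OF a] by simp
    have "(1 + norm (B y)) ^ N * norm (a y) \<le> (1 + K) ^ N * ((1 + norm y) ^ N * norm (a y))" for y
    proof -
      have "1 + norm (B y) \<le> (1 + K) * (1 + norm y)"
        using K(2)[of y] K(1) norm_ge_zero[of y] unfolding distrib_left distrib_right mult.commute[of K] by linarith
      then have "(1 + norm (B y)) ^ N \<le> (1 + K) ^ N * (1 + norm y) ^ N"
        by (simp flip: power_mult_distrib add: power_mono)
      then show ?thesis unfolding mult.assoc[symmetric] by (rule mult_right_mono) simp
    qed
    then show "AE y in lborel. norm ((1 + norm (B y)) ^ N * norm (a y)) \<le> norm ((1 + K) ^ N * ((1 + norm y) ^ N * norm (a y)))"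
      using K(1) by (intro AE_I2) (simp add: abs_mult)
  qed
qed

text \<open>The distribution of the image measure under \<open>B\<close>. Both kinds of distributions whose forms have to be
computed are of this type: Schwartz functions (\<open>B\<close> the identity) and elements of \<open>G_schwartz\<close>
(\<open>B\<close> an isometric embedding).\<close>
definition push_dist :: "(real^'k::finite \<Rightarrow> real^'n::finite) \<Rightarrow> (real^'k \<Rightarrow> complex) \<Rightarrow> 'n dist" where
  "push_dist B a = (\<lambda>\<phi>\<in>Schwartz. LINT y|lborel. a y * \<phi> (B y))"

lemma test_function_conv_gaussian:
  fixes \<phi> :: "real^'n::finite \<Rightarrow> complex"
  assumes \<phi>: "\<phi> \<in> Schwartz" and \<epsilon>: "0 < \<epsilon>"
  shows "(\<lambda>x. LINT y|lebesgue. gaussian \<epsilon> (y - x) * \<phi> y) = smear (\<lambda>y. y) \<phi> (gaussian \<epsilon>)"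
    and "smear (\<lambda>y. y) \<phi> (gaussian \<epsilon>) \<in> Schwartz"
proof -
  have [measurable]: "\<phi> \<in> borel_measurable borel" using \<phi> by (rule Schwartz_measurable)
  show "(\<lambda>x. LINT y|lebesgue. gaussian \<epsilon> (y - x) * \<phi> y) = smear (\<lambda>y. y) \<phi> (gaussian \<epsilon>)"
    unfolding smear_def
    by (rule ext, subst integral_completion) (auto simp: gaussian_minus[of \<epsilon> _ "_ :: real^'n"] mult.commute)
  show "smear (\<lambda>y. y) \<phi> (gaussian \<epsilon>) \<in> Schwartz"
    by (rule smear_Schwartz_Schwartz[OF gaussian_Schwartz[OF \<epsilon>] \<phi> bounded_linear_ident])
qed

text \<open>The convolved test function is again a Schwartz function, so the distribution may be applied to
it as an integral; what remains is Fubini's theorem.\<close>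
lemma dist_conv_push_dist:
  fixes B :: "real^'k::finite \<Rightarrow> real^'n::finite"
  assumes a: "integrable lborel a" and B [measurable]: "B \<in> borel_measurable borel" and \<epsilon>: "0 < \<epsilon>"
  shows "dist_conv (push_dist B a) (gaussian \<epsilon>) = fun_dist (smear B a (gaussian \<epsilon>))"
proof -
  have [measurable]: "a \<in> borel_measurable borel" using a by auto
  have sm: "smear B a (gaussian \<epsilon>) \<in> borel_measurable borel"
    using integrable_smear[OF a integrable_gaussian[OF \<epsilon>] B] by auto
  have "dist_conv (push_dist B a) (gaussian \<epsilon>) \<phi> = (LINT x|lborel. smear B a (gaussian \<epsilon>) x * \<phi> x)"
    if \<phi>: "\<phi> \<in> Schwartz" for \<phi>
  proof -
    have [measurable]: "\<phi> \<in> borel_measurable borel" using \<phi> by (rule Schwartz_measurable)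
    let ?h = "\<lambda>x. LINT y|lebesgue. gaussian \<epsilon> (y - x) * \<phi> y"
    have hS: "?h \<in> Schwartz" unfolding test_function_conv_gaussian(1)[OF \<phi> \<epsilon>] by (rule test_function_conv_gaussian(2)[OF \<phi> \<epsilon>])
    have prod: "integrable (lborel \<Otimes>\<^sub>M lborel) (\<lambda>(y, x). a y * gaussian \<epsilon> (x - B y) * \<phi> x)"
      using integrable_mult_bounded[OF integrable_smear_product[OF a integrable_gaussian[OF \<epsilon>] B] _ Schwartz_bounded[OF \<phi>], of snd]
      by (simp add: case_prod_beta')
    have "dist_conv (push_dist B a) (gaussian \<epsilon>) \<phi> = (LINT y|lborel. a y * ?h (B y))"
      using \<phi> hS by (simp add: dist_conv_def push_dist_def)
    also have "\<dots> = (LINT y|lborel. LINT x|lborel. a y * gaussian \<epsilon> (x - B y) * \<phi> x)"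
    proof (rule Bochner_Integration.integral_cong[OF refl])
      fix y
      have "(LINT x|lebesgue. gaussian \<epsilon> (x - B y) * \<phi> x) = (LINT x|lborel. gaussian \<epsilon> (x - B y) * \<phi> x)"
        by (rule integral_completion) simp
      then show "a y * (LINT x|lebesgue. gaussian \<epsilon> (x - B y) * \<phi> x) = (LINT x|lborel. a y * gaussian \<epsilon> (x - B y) * \<phi> x)"
        by (simp add: mult.assoc)
    qed
    also have "\<dots> = (LINT x|lborel. LINT y|lborel. a y * gaussian \<epsilon> (x - B y) * \<phi> x)"
      by (rule lborel_pair.Fubini_integral[OF prod, symmetric])
    also have "\<dots> = (LINT x|lborel. smear B a (gaussian \<epsilon>) x * \<phi> x)"
      unfolding smear_def by simp
    finally show ?thesis .
  qed
  then show ?thesis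
    unfolding fun_dist_lborel[OF sm] by (auto simp: dist_conv_def restrict_def fun_eq_iff)
qed

subsection \<open>An integrable function is determined by its distribution\<close>

text \<open>Off the boundary the indicator is constant on a ball of radius \<open>r\<close>, so it differs from its
value at \<open>x\<close> by at most \<open>norm (x - y) / r\<close>, and the first moment of the Gaussian is \<open>O(\<epsilon>)\<close>.\<close>
lemma smear_box_tendsto:
  fixes x :: "real^'n::finite"
  assumes "x \<notin> cbox l u - box l u"
  shows "((\<lambda>\<epsilon>. smear (\<lambda>y. y) (indicator (box l u)) (gaussian \<epsilon>) x) \<longlongrightarrow> indicator (box l u) x) (at_right 0)"
proof -
  have "x \<in> box l u \<or> x \<in> - cbox l u" using assms by auto
  then obtain r where r: "0 < r" "\<And>y. norm (x - y) < r \<Longrightarrow> (y \<in> box l u \<longleftrightarrow> x \<in> box l u)"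
  proof
    assume x: "x \<in> box l u"
    then obtain r where "0 < r" "ball x r \<subseteq> box l u" using open_box open_contains_ball by blast
    with x show ?thesis by (intro that[of r]) (auto simp: dist_norm)
  next
    assume x: "x \<in> - cbox l u"
    then obtain r where r: "0 < r" "ball x r \<subseteq> - cbox l u"
      using closed_cbox open_Compl open_contains_ball by blast
    have "x \<notin> box l u" using x box_subset_cbox by blast
    moreover have "y \<notin> box l u" if "norm (x - y) < r" for y
      using that r(2) box_subset_cbox[of l u] by (auto simp: dist_norm)
    ultimately show ?thesis using r(1) by (intro that[of r]) auto
  qed
  obtain K where K: "0 \<le> K" "\<And>\<epsilon>. 0 < \<epsilon> \<Longrightarrow> integrable lborel (\<lambda>x :: real^'n. norm x * gauss \<epsilon> x)"
    "\<And>\<epsilon>. 0 < \<epsilon> \<Longrightarrow> (LINT x|lborel. norm (x :: real^'n) * gauss \<epsilon> x) \<le> K * \<epsilon>"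
    using gauss_first_moment by blast
  have le: "norm (smear (\<lambda>y. y) (indicator (box l u)) (gaussian \<epsilon>) x - indicator (box l u) x) \<le> K * \<epsilon> / r" if \<epsilon>: "0 < \<epsilon>" for \<epsilon>
  proof -
    have "norm (smear (\<lambda>y. y) (indicator (box l u)) (gaussian \<epsilon>) x - indicator (box l u) x)
      \<le> (LINT y|lborel. (norm (x - y) * gauss \<epsilon> (x - y)) / r)"
    proof (rule norm_smear_ident_diff_le[OF \<epsilon>])
      show "integrable lborel (\<lambda>y. indicator (box l u) y * gaussian \<epsilon> (x - y))"
        using integrable_mult_bounded[OF integrable_gaussian_reflect[OF \<epsilon>, of x], of "indicator (box l u)" 1]
        by (simp add: mult.commute indicator_def)
      show "integrable lborel (\<lambda>y. (norm (x - y) * gauss \<epsilon> (x - y)) / r)"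
        by (rule integrable_divide, rule integrable_moment_reflect[OF \<epsilon>])
      fix y
      have "norm (indicator (box l u) y - indicator (box l u) x :: complex) \<le> norm (x - y) / r"
      proof (cases "norm (x - y) < r")
        case True
        then show ?thesis using r(2)[OF True] r(1) by (simp add: indicator_def)
      next
        case False
        then have "1 \<le> norm (x - y) / r" using r(1) by simp
        then show ?thesis by (auto simp: indicator_def)
      qed
      from mult_right_mono[OF this gauss_nonneg]
      show "norm (indicator (box l u) y - indicator (box l u) x :: complex) * gauss \<epsilon> (x - y) \<le> (norm (x - y) * gauss \<epsilon> (x - y)) / r"
        by simp
    qed
    also have "\<dots> \<le> K * \<epsilon> / r"
      using K(3)[OF \<epsilon>] r(1) by (simp add: integral_moment_reflect[OF \<epsilon>] divide_right_mono)
    finally show ?thesis .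
  qed
  have "((\<lambda>\<epsilon>. K * \<epsilon> / r) \<longlongrightarrow> K * 0 / r) (at_right 0)" using r(1) by (intro tendsto_intros) auto
  then have lim: "((\<lambda>\<epsilon>. K * \<epsilon> / r) \<longlongrightarrow> 0) (at_right 0)" by simp
  have "\<forall>\<^sub>F \<epsilon> in at_right 0. norm (smear (\<lambda>y. y) (indicator (box l u)) (gaussian \<epsilon>) x - indicator (box l u) x) \<le> K * \<epsilon> / r"
    using eventually_at_right_less by (rule eventually_mono) (rule le)
  from Lim_null_comparison[OF this lim] show ?thesis unfolding LIM_zero_iff .
qed

lemma smear_box_Schwartz:
  assumes "0 < \<epsilon>" shows "smear (\<lambda>y. y) (indicator (box l u)) (gaussian \<epsilon>) \<in> Schwartz"
proof (rule smear_Schwartz[OF gaussian_Schwartz[OF assms]])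
  fix N
  obtain b where b: "\<And>y. y \<in> box l u \<Longrightarrow> norm y \<le> b" using bounded_box[of l u] unfolding bounded_iff by blast
  show "integrable lborel (\<lambda>y. (1 + norm y) ^ N * norm (indicator (box l u) y :: complex))"
  proof (rule Bochner_Integration.integrable_bound[of _ "\<lambda>y. (1 + b) ^ N * indicator (box l u) y"])
    show "integrable lborel (\<lambda>y. (1 + b) ^ N * indicator (box l u) y :: real)"
      by (intro integrable_mult_right integrable_real_indicator emeasure_lborel_box_finite) simp
    show "AE y in lborel. norm ((1 + norm y) ^ N * norm (indicator (box l u) y :: complex)) \<le> norm ((1 + b) ^ N * indicator (box l u) y :: real)"
      by (intro AE_I2) (auto simp: indicator_def power_mono b intro: order_trans[OF _ abs_ge_self])
  qed simp
qed auto

lemma smear_box_bounded: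
  assumes "0 < \<epsilon>" shows "norm (smear (\<lambda>y. y) (indicator (box l u)) (gaussian \<epsilon>) (x :: real^'n::finite)) \<le> 1"
proof -
  have g: "integrable lborel (\<lambda>y. gauss \<epsilon> (x - y))" "(LINT y|lborel. gauss \<epsilon> (x - y)) = 1"
    unfolding gauss_minus[of \<epsilon> x]
    using integrable_lborel_translate[of "gauss \<epsilon>" x] integral_lborel_translate[of "gauss \<epsilon>" x]
      integrable_gauss[OF assms] integral_gauss[OF assms]
    by simp_all
  have "norm (smear (\<lambda>y. y) (indicator (box l u)) (gaussian \<epsilon>) x) \<le> (LINT y|lborel. gauss \<epsilon> (x - y))"
    unfolding smear_def
  proof (rule norm_integral_le[OF _ g(1)])
    have "integrable lborel (\<lambda>y. complex_of_real (gauss \<epsilon> (x - y)))" using g(1) by simp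
    from integrable_mult_bounded[OF this, of "indicator (box l u)" 1]
    show "integrable lborel (\<lambda>y. indicator (box l u) y * gaussian \<epsilon> (x - y))"
      by (simp add: gaussian_eq_gauss mult.commute indicator_def)
  qed (auto simp: gaussian_eq_gauss norm_mult indicator_def gauss_nonneg)
  then show ?thesis using g(2) by simp
qed

lemma integral_box_zero:
  fixes d :: "real^'n::finite \<Rightarrow> complex"
  assumes d: "integrable lborel d" and zero: "\<And>\<phi>. \<phi> \<in> Schwartz \<Longrightarrow> (LINT x|lborel. d x * \<phi> x) = 0"
  shows "(LINT x|lborel. d x * indicator (box l u) x) = 0"
proof -
  let ?s = "\<lambda>\<epsilon>. smear (\<lambda>y. y) (indicator (box l u)) (gaussian \<epsilon>)"
  have [measurable]: "d \<in> borel_measurable borel" using d by auto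
  define \<epsilon> where "\<epsilon> n = inverse (real (Suc n))" for n
  have \<epsilon>: "0 < \<epsilon> n" for n by (simp add: \<epsilon>_def)
  have \<epsilon>0: "filterlim \<epsilon> (at_right 0) sequentially"
    unfolding filterlim_at using \<epsilon> LIMSEQ_inverse_real_of_nat by (auto simp: \<epsilon>_def[abs_def])
  have [measurable]: "?s (\<epsilon> n) \<in> borel_measurable borel" for n
    by (rule Schwartz_measurable[OF smear_box_Schwartz[OF \<epsilon>]])
  have "(\<lambda>n. LINT x|lborel. d x * ?s (\<epsilon> n) x) \<longlonglongrightarrow> (LINT x|lborel. d x * indicator (box l u) x)"
  proof (rule integral_dominated_convergence[where w = "\<lambda>x. norm (d x)"])
    have "emeasure lborel (cbox l u - box l u) = 0"
      by (subst emeasure_Diff) (auto simp: emeasure_lborel_box_finite box_subset_cbox emeasure_lborel_cbox_eq emeasure_lborel_box_eq)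
    then have "cbox l u - box l u \<in> null_sets lborel" by auto
    then have "AE x in lborel. x \<notin> cbox l u - box l u" by (rule AE_not_in)
    then show "AE x in lborel. (\<lambda>n. d x * ?s (\<epsilon> n) x) \<longlonglongrightarrow> d x * indicator (box l u) x"
      by eventually_elim (intro tendsto_mult tendsto_const filterlim_compose[OF smear_box_tendsto \<epsilon>0])
    show "AE x in lborel. norm (d x * ?s (\<epsilon> n) x) \<le> norm (d x)" for n
      by (intro AE_I2) (auto simp: norm_mult intro!: mult_left_le smear_box_bounded \<epsilon>)
  qed (use d in auto)
  moreover have "(LINT x|lborel. d x * ?s (\<epsilon> n) x) = 0" for n
    by (rule zero[OF smear_box_Schwartz[OF \<epsilon>]])
  ultimately show ?thesis by (simp add: LIMSEQ_const_iff)
qed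

text \<open>Smeared indicators of boxes are Schwartz functions, so the integral of \<open>d\<close> over every box vanishes; boxes
generate the Borel sets. The restriction to a large box \<open>Q n\<close> makes complements harmless in the
induction over the generated sets.\<close>
lemma AE_zero_if_Schwartz_integrals_zero:
  fixes d :: "real^'n::finite \<Rightarrow> complex"
  assumes d: "integrable lborel d" and zero: "\<And>\<phi>. \<phi> \<in> Schwartz \<Longrightarrow> (LINT x|lborel. d x * \<phi> x) = 0"
  shows "AE x in lborel. d x = 0"
proof -
  have [measurable]: "d \<in> borel_measurable borel" using d by auto
  define Q where "Q n = box (- (real n *\<^sub>R One)) (real n *\<^sub>R One :: real^'n)" for n
  have Q [measurable]: "Q n \<in> sets borel" for n by (simp add: Q_def)
  have int: "integrable lborel (\<lambda>x. d x * indicator (Q n) x)" for n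
    by (rule integrable_mult_bounded[OF d, of _ 1]) (auto simp: indicator_def)
  have "AE x in lborel. d x * indicator (Q n) x = 0" for n
  proof (rule sigma_finite_measure.density_zero[OF sigma_finite_lborel int])
    fix A :: "(real^'n) set" assume "A \<in> sets lborel"
    then have "A \<in> sigma_sets UNIV (range (\<lambda>(a, b). box a b))" by (simp add: borel_eq_box)
    then have "A \<in> sets borel \<and> (LINT x|lborel. (d x * indicator (Q n) x) * indicator A x) = 0"
    proof (induction rule: sigma_sets_induct_disjoint[rotated 2, consumes 1, case_names basic empty compl union Int_stable Pow])
      case Int_stable
      then show ?case by (auto simp: Int_stable_def box_Int_box)
    next
      case (basic A)
      then obtain a b where A: "A = box a b" by auto
      obtain l u where lu: "Q n \<inter> A = box l u" unfolding Q_def A box_Int_box by blast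
      have "(LINT x|lborel. (d x * indicator (Q n) x) * indicator A x) = (LINT x|lborel. d x * indicator (box l u) x)"
        unfolding lu[symmetric] by (simp add: indicator_inter_arith mult.assoc)
      then show ?case using integral_box_zero[OF d zero] A by simp
    next
      case (compl A)
      then have [measurable]: "A \<in> sets borel" by simp
      have "(LINT x|lborel. (d x * indicator (Q n) x) * indicator (UNIV - A) x)
         = (LINT x|lborel. d x * indicator (Q n) x - (d x * indicator (Q n) x) * indicator A x)"
        by (intro Bochner_Integration.integral_cong) (auto simp: indicator_def)
      also have "\<dots> = (LINT x|lborel. d x * indicator (Q n) x) - (LINT x|lborel. (d x * indicator (Q n) x) * indicator A x)"
        by (intro Bochner_Integration.integral_diff int integrable_mult_bounded[OF int, of _ 1]) (auto simp: indicator_def)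
      also have "\<dots> = 0" using compl integral_box_zero[OF d zero] by (simp add: Q_def)
      finally show ?case by simp
    next
      case (union A)
      then have [measurable]: "A i \<in> sets borel" for i by simp
      have meas: "(\<Union>i. A i) \<in> sets lborel" by simp
      have si: "set_integrable lborel (\<Union>i. A i) (\<lambda>x. d x * indicator (Q n) x)"
        unfolding set_integrable_def using int by (intro integrable_mult_indicator) auto
      have "set_lebesgue_integral lborel (\<Union>i. A i) (\<lambda>x. d x * indicator (Q n) x) = (\<Sum>i. set_lebesgue_integral lborel (A i) (\<lambda>x. d x * indicator (Q n) x))"
        by (rule lebesgue_integral_countable_add) (use union(1) si in \<open>auto simp: disjoint_family_on_def\<close>)
      also have "\<dots> = 0"
        using union by (simp add: set_lebesgue_integral_def scaleR_conv_of_real of_real_indicator mult.commute)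
      finally show ?case
        by (simp add: set_lebesgue_integral_def scaleR_conv_of_real of_real_indicator mult.commute)
    qed auto
    then show "set_lebesgue_integral lborel A (\<lambda>x. d x * indicator (Q n) x) = 0"
      by (simp add: set_lebesgue_integral_def scaleR_conv_of_real of_real_indicator mult.commute)
  qed
  then have "AE x in lborel. \<forall>n. d x * indicator (Q n) x = 0" unfolding AE_all_countable by blast
  then show ?thesis
  proof eventually_elim
    fix x assume *: "\<forall>n. d x * indicator (Q n) x = 0"
    have "x \<in> (\<Union>n. Q n)" unfolding Q_def UN_box_eq_UNIV by simp
    then obtain n where "x \<in> Q n" by blast
    then show "d x = 0" using *[rule_format, of n] by simp
  qed
qed

lemma borel_version:
  fixes f :: "'a::euclidean_space \<Rightarrow> complex"
  assumes "f \<in> borel_measurable lebesgue"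
  obtains f' where "f' \<in> borel_measurable borel" "AE x in lebesgue. f x = f' x"
proof -
  have "(\<lambda>x. Re (f x)) \<in> borel_measurable lebesgue" "(\<lambda>x. Im (f x)) \<in> borel_measurable lebesgue"
    using assms by auto
  from this[THEN completion_ex_borel_measurable_real] obtain a b where ab: "a \<in> borel_measurable lborel" "AE x in lborel. Re (f x) = a x"
    "b \<in> borel_measurable lborel" "AE x in lborel. Im (f x) = b x"
    by (elim bexE) (rule that)
  have "AE x in lborel. f x = Complex (a x) (b x)"
    using ab(2,4) by eventually_elim (simp add: complex_eq_iff)
  then have "AE x in lebesgue. f x = Complex (a x) (b x)" by (rule AE_completion)
  moreover have "(\<lambda>x. Complex (a x) (b x)) \<in> borel_measurable borel"
    using ab(1,3) unfolding Complex_eq by simp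
  ultimately show ?thesis using that by blast
qed

text \<open>The functions \<open>f\<^sub>\<epsilon>\<close> in the definition of \<open>has_form\<close> are given only through their distributions.
By this uniqueness they may be replaced by explicit ones.\<close>
theorem fun_dist_unique:
  fixes f g :: "real^'n::finite \<Rightarrow> complex"
  assumes f: "integrable lebesgue f" and g: "integrable lebesgue g" and eq: "fun_dist f = fun_dist g"
  shows "AE x in lebesgue. f x = g x"
proof -
  have int: "integrable lebesgue (\<lambda>x. f x - g x)" using f g by simp
  then obtain d where d [measurable]: "d \<in> borel_measurable borel" and AE: "AE x in lebesgue. f x - g x = d x"
    using borel_version[of "\<lambda>x. f x - g x"] by auto
  have "integrable lebesgue d"
    using integrable_cong_AE_imp[OF int _ AE] d by (simp add: measurable_completion)
  then have dint: "integrable lborel d" by (simp add: integrable_completion)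
  have "AE x in lborel. d x = 0"
  proof (rule AE_zero_if_Schwartz_integrals_zero[OF dint])
    fix \<phi> :: "real^'n \<Rightarrow> complex" assume \<phi>: "\<phi> \<in> Schwartz"
    have \<phi>m[measurable]: "\<phi> \<in> borel_measurable borel" using \<phi> by (rule Schwartz_measurable)
    have \<phi>l: "\<phi> \<in> borel_measurable lebesgue" by (simp add: measurable_completion)
    note i = integrable_mult_bounded[OF _ \<phi>l Schwartz_bounded[OF \<phi>]]
    have "(LINT x|lborel. d x * \<phi> x) = (LINT x|lebesgue. d x * \<phi> x)"
      by (rule integral_completion[symmetric]) simp
    also have "\<dots> = (LINT x|lebesgue. (f x - g x) * \<phi> x)"
      using AE by (intro integral_cong_AE borel_measurable_times borel_measurable_integrable[OF int] \<phi>l) (auto simp: measurable_completion)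
    also have "\<dots> = (LINT x|lebesgue. f x * \<phi> x) - (LINT x|lebesgue. g x * \<phi> x)"
      unfolding left_diff_distrib by (rule Bochner_Integration.integral_diff) (intro i f g)+
    also have "\<dots> = 0" using fun_cong[OF eq, of \<phi>] \<phi> by (simp add: fun_dist_def)
    finally show "(LINT x|lborel. d x * \<phi> x) = 0" .
  qed
  then have "AE x in lebesgue. d x = 0" by (rule AE_completion)
  with AE show ?thesis by eventually_elim simp
qed


section \<open>Symmetric matrices and the Ky Fan principle\<close>

lemma symmetric_matrix_inner:
  fixes A :: "real^'n::finite^'n"
  assumes "transpose A = A" shows "(A *v x) \<bullet> y = x \<bullet> (A *v y)"
  using dot_lmul_matrix[of x A y] assms by (metis transpose_matrix_vector)

text \<open>A maximizer \<open>u\<close> of the quadratic form on the unit sphere of \<open>S\<close> is an eigenvector: the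
form \<open>q\<close> below is nonnegative on \<open>S\<close> and vanishes at \<open>u\<close>, and moving from \<open>u\<close> against the
residual \<open>w\<close> would make it negative unless \<open>w = 0\<close>.\<close>
lemma symmetric_matrix_eigenvector:
  fixes A :: "real^'n::finite^'n"
  assumes A: "transpose A = A" and S: "subspace S" and inv: "\<And>x. x \<in> S \<Longrightarrow> A *v x \<in> S"
    and x0: "x0 \<in> S" "x0 \<noteq> 0"
  shows "\<exists>v\<in>S. norm v = 1 \<and> (\<exists>c. A *v v = c *\<^sub>R v)"
proof -
  let ?K = "sphere 0 1 \<inter> S"
  have "compact ?K" by (intro compact_Int_closed compact_sphere closed_subspace S)
  moreover have "(1 / norm x0) *\<^sub>R x0 \<in> ?K" using x0 S by (auto simp: subspace_scale)
  then have "?K \<noteq> {}" by blast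
  moreover have "continuous_on ?K (\<lambda>x. x \<bullet> (A *v x))"
    by (intro continuous_intros linear_continuous_on matrix_vector_mul_bounded_linear)
  ultimately obtain u where u: "u \<in> ?K" "\<And>x. x \<in> ?K \<Longrightarrow> x \<bullet> (A *v x) \<le> u \<bullet> (A *v u)"
    using continuous_attains_sup[of ?K "\<lambda>x. x \<bullet> (A *v x)"] by blast
  define c where "c = u \<bullet> (A *v u)"
  define q where "q x = c * (x \<bullet> x) - x \<bullet> (A *v x)" for x
  have uS: "u \<in> S" "norm u = 1" using u(1) by auto
  have q: "0 \<le> q x" if x: "x \<in> S" for x
  proof (cases "x = 0")
    case False
    have "(1 / norm x) *\<^sub>R x \<in> ?K" using x False S by (auto simp: subspace_scale)
    from u(2)[OF this] have "(x \<bullet> (A *v x)) / (norm x)\<^sup>2 \<le> c"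
      by (simp add: c_def matrix_vector_mult_scaleR power2_eq_square)
    then have "x \<bullet> (A *v x) \<le> c * (norm x)\<^sup>2" using False by (simp add: pos_divide_le_eq)
    then show ?thesis by (simp add: q_def power2_norm_eq_inner)
  qed (simp add: q_def)
  define w where "w = c *\<^sub>R u - A *v u"
  have w: "w \<in> S" unfolding w_def by (intro subspace_diff subspace_scale S uS inv)
  have expand: "q (u + t *\<^sub>R w) = 2 * t * (w \<bullet> w) + t\<^sup>2 * q w" for t
  proof -
    have uu: "u \<bullet> u = 1" using uS(2) by (simp add: norm_eq_1)
    have sym: "u \<bullet> (A *v w) = w \<bullet> (A *v u)" using symmetric_matrix_inner[OF A, of u w] by (simp add: inner_commute)
    have ww: "w \<bullet> w = c * (u \<bullet> w) - w \<bullet> (A *v u)"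
    proof -
      have "w \<bullet> w = w \<bullet> (c *\<^sub>R u - A *v u)" by (simp add: w_def)
      then show ?thesis by (simp add: inner_diff_right inner_commute)
    qed
    show ?thesis
      unfolding ww unfolding q_def matrix_vector_right_distrib matrix_vector_mult_scaleR
      by (simp add: inner_add_left inner_add_right uu sym inner_commute[of w u] c_def[symmetric] power2_eq_square algebra_simps)
  qed
  have "w \<bullet> w = 0"
  proof (rule ccontr)
    assume "w \<bullet> w \<noteq> 0"
    then have pos: "0 < w \<bullet> w" using inner_ge_zero[of w] by linarith
    define t where "t = (w \<bullet> w) / (q w + 1)"
    have q1: "0 < q w + 1" using q[OF w] by simp
    have t: "0 < t" using pos q1 by (simp add: t_def)
    have "u + (- t) *\<^sub>R w \<in> S" using uS(1) w S by (intro subspace_add subspace_scale)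
    then have "0 \<le> 2 * (- t) * (w \<bullet> w) + (- t)\<^sup>2 * q w" using q expand by metis
    then have "2 * t * (w \<bullet> w) \<le> t * (t * q w)" by (simp add: power2_eq_square)
    then have "2 * (w \<bullet> w) \<le> t * q w" using t by simp
    moreover have "t * q w \<le> w \<bullet> w"
      using q1 pos q[OF w] by (simp add: t_def divide_le_eq mult_left_mono)
    ultimately show False using pos by linarith
  qed
  then have "A *v u = c *\<^sub>R u" by (simp add: w_def)
  then show ?thesis using uS by blast
qed

lemma orthonormal_eigenvectors:
  fixes A :: "real^'n::finite^'n"
  assumes A: "transpose A = A" and "k \<le> CARD('n)"
  shows "\<exists>B. finite B \<and> card B = k \<and> pairwise orthogonal B \<and> (\<forall>b\<in>B. norm b = 1 \<and> (\<exists>c. A *v b = c *\<^sub>R b))"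
  using assms(2)
proof (induction k)
  case 0
  then show ?case by (intro exI[of _ "{}"]) auto
next
  case (Suc k)
  then obtain B where B: "finite B" "card B = k" "pairwise orthogonal B" "\<forall>b\<in>B. norm b = 1 \<and> (\<exists>c. A *v b = c *\<^sub>R b)"
    by auto
  let ?S = "{y. \<forall>b\<in>B. orthogonal b y}"
  have S: "subspace ?S" by (rule subspace_orthogonal_to_vectors)
  have "dim B < DIM(real^'n)" using dim_le_card'[OF B(1)] B(2) Suc.prems by simp
  then obtain x where x: "x \<noteq> 0" "\<And>y. y \<in> span B \<Longrightarrow> orthogonal x y"
    using orthogonal_to_subspace_exists[of B] by blast
  have "x \<in> ?S" using x(2) span_base by (auto simp: orthogonal_commute)
  moreover have "A *v y \<in> ?S" if "y \<in> ?S" for y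
  proof safe
    fix b assume b: "b \<in> B"
    then obtain c where "A *v b = c *\<^sub>R b" using B(4) by blast
    then have "b \<bullet> (A *v y) = c * (b \<bullet> y)" using symmetric_matrix_inner[OF A, of b y] by simp
    then show "orthogonal b (A *v y)" using that b by (simp add: orthogonal_def)
  qed
  ultimately obtain v where v: "v \<in> ?S" "norm v = 1" "\<exists>c. A *v v = c *\<^sub>R v"
    using symmetric_matrix_eigenvector[OF A S _ _ x(1)] by blast
  have "v \<notin> B" using v(1,2) by (auto simp: orthogonal_def norm_eq_1)
  then show ?case using B v
    by (intro exI[of _ "insert v B"]) (auto simp: pairwise_insert orthogonal_commute)
qed

theorem spectral_theorem_symmetric:
  fixes A :: "real^'n::finite^'n"
  assumes A: "transpose A = A"
  obtains Q d where "orthogonal_matrix Q" "\<And>i. A *v row i Q = d i *\<^sub>R row i Q"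
proof -
  obtain B where B: "finite B" "card B = CARD('n)" "pairwise orthogonal B" "\<forall>b\<in>B. norm b = 1 \<and> (\<exists>c. A *v b = c *\<^sub>R b)"
    using orthonormal_eigenvectors[OF A, of "CARD('n)"] by auto
  then obtain f :: "'n \<Rightarrow> real^'n" where f: "bij_betw f UNIV B"
    using finite_same_card_bij[of "UNIV :: 'n set" B] by auto
  define Q where "Q = (\<chi> i. f i)"
  have row: "row i Q = f i" for i by (simp add: Q_def row_def vec_eq_iff)
  have fB: "f i \<in> B" for i using f by (auto simp: bij_betw_def)
  have "f i \<noteq> f j" if "i \<noteq> j" for i j using f that by (auto simp: bij_betw_def inj_on_def)
  then have "orthogonal_matrix Q"
    unfolding orthogonal_matrix_orthonormal_rows row using B(3,4) fB by (auto simp: pairwise_def)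
  moreover have "\<forall>i. \<exists>c. A *v f i = c *\<^sub>R f i" using B(4) fB by blast
  then obtain d where "\<And>i. A *v f i = d i *\<^sub>R f i" by metis
  ultimately show ?thesis using that[of Q d] unfolding row by blast
qed

lemma const_poly_sum: "[:sum f S:] = (\<Sum>i\<in>S. [:f i:])"
proof (induction S rule: infinite_finite_induct)
  case (insert x S)
  have "[:f x + sum f S:] = [:f x:] + [:sum f S:]" by simp
  then show ?case using insert.IH by (simp only: sum.insert[OF insert.hyps])
qed auto

text \<open>With \<open>C\<close> the transpose of \<open>Q\<close>, regarded as a matrix of constant polynomials, the eigenvector
equations say that the characteristic matrix \<open>X\<close> satisfies \<open>X ** C = C ** D\<close> with \<open>D\<close> diagonal,
and \<open>det C\<close> is a unit.\<close>
lemma proots_charac_poly: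
  fixes A :: "real^'n::finite^'n"
  assumes Q: "orthogonal_matrix Q" and eig: "\<And>i. A *v row i Q = d i *\<^sub>R row i Q"
  shows "proots (charac_poly A) = image_mset d (mset_set UNIV)"
proof -
  define X where "X = (\<chi> i j. (if i = j then [:0, 1:] else 0) - [:A $ i $ j:])"
  define C where "C = (\<chi> i j. [:Q $ j $ i:])"
  define D where "D = (\<chi> i j. if i = j then [:- d i, 1:] else 0)"
  have "X ** C = C ** D"
  proof -
    have "(\<Sum>l\<in>UNIV. X $ i $ l * C $ l $ j) = (\<Sum>l\<in>UNIV. C $ i $ l * D $ l $ j)" for i j
    proof -
      have "(\<Sum>l\<in>UNIV. A $ i $ l * Q $ j $ l) = d j * Q $ j $ i"
        using arg_cong[OF eig[of j], of "\<lambda>v. v $ i"] by (simp add: matrix_vector_mult_def row_def)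
      then have e: "(\<Sum>l\<in>UNIV. [:A $ i $ l:] * [:Q $ j $ l:]) = [:d j * Q $ j $ i:]"
        by (simp add: const_poly_sum[symmetric] mult.commute)
      have "(\<Sum>l\<in>UNIV. X $ i $ l * C $ l $ j) = (\<Sum>l\<in>UNIV. (if i = l then [:0, 1:] * [:Q $ j $ l:] else 0) - [:A $ i $ l:] * [:Q $ j $ l:])"
        by (intro sum.cong) (auto simp: X_def C_def left_diff_distrib)
      also have "\<dots> = [:0, 1:] * [:Q $ j $ i:] - [:d j * Q $ j $ i:]"
        unfolding sum_subtractf e by simp
      also have "\<dots> = [:Q $ j $ i:] * [:- d j, 1:]" by simp
      also have "\<dots> = (\<Sum>l\<in>UNIV. if l = j then [:Q $ l $ i:] * [:- d l, 1:] else 0)" by simp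
      also have "\<dots> = (\<Sum>l\<in>UNIV. C $ i $ l * D $ l $ j)"
        by (intro sum.cong) (auto simp: C_def D_def)
      finally show ?thesis .
    qed
    then show ?thesis by (simp add: matrix_matrix_mult_def vec_eq_iff)
  qed
  then have "det X * det C = det C * det D" by (metis det_mul)
  moreover have "det C \<noteq> 0"
  proof -
    have "(transpose C ** C) = mat 1"
    proof -
      have "(\<Sum>l\<in>UNIV. [:Q $ i $ l:] * [:Q $ j $ l:]) = (if i = j then 1 else 0)" for i j
      proof -
        have "row i Q \<bullet> row j Q = (if i = j then 1 else 0)"
          using Q unfolding orthogonal_matrix_orthonormal_rows by (auto simp: orthogonal_def norm_eq_1)
        then have "(\<Sum>l\<in>UNIV. Q $ i $ l * Q $ j $ l) = (if i = j then 1 else 0)"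
          by (simp add: inner_vec_def row_def)
        moreover have "(\<Sum>l\<in>UNIV. [:Q $ i $ l:] * [:Q $ j $ l:]) = [:\<Sum>l\<in>UNIV. Q $ i $ l * Q $ j $ l:]"
          unfolding const_poly_sum by (rule sum.cong) auto
        ultimately show ?thesis by (simp add: one_pCons)
      qed
      then show ?thesis
        by (simp add: matrix_matrix_mult_def vec_eq_iff C_def transpose_def mat_def)
    qed
    then have "det (transpose C) * det C = 1" by (metis det_mul det_I)
    then show ?thesis by auto
  qed
  ultimately have "det X = det D" by (simp add: mult.commute)
  also have "\<dots> = (\<Prod>i\<in>UNIV. [:- d i, 1:])"
    by (subst det_diagonal) (auto simp: D_def)
  finally have "charac_poly A = (\<Prod>i\<in>UNIV. [:- d i, 1:])" by (simp add: charac_poly_def X_def)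
  then have "proots (charac_poly A) = (\<Sum>i\<in>UNIV. proots [:- d i, 1:])"
    by (simp add: proots_prod)
  also have "\<dots> = (\<Sum>i\<in>UNIV. {#d i#})" by simp
  also have "\<dots> = image_mset d (mset_set UNIV)"
    by (rule finite_induct[OF finite_class.finite_UNIV]) auto
  finally show ?thesis .
qed

lemma ky_fan_antinorm_eigenvalues:
  fixes A :: "real^'n::finite^'n"
  assumes Q: "orthogonal_matrix Q" and eig: "\<And>i. A *v row i Q = d i *\<^sub>R row i Q" and m: "m \<le> CARD('n)"
  obtains E where "card E = m" "ky_fan_antinorm m A = (\<Sum>i\<in>E. d i)" "\<And>i j. i \<in> E \<Longrightarrow> j \<notin> E \<Longrightarrow> d i \<le> d j"
proof -
  obtain ys where ys: "set ys = (UNIV :: 'n set)" "distinct ys" using finite_distinct_list[OF finite_class.finite_UNIV] by blast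
  define xs where "xs = sort_key d ys"
  have xs: "set xs = UNIV" "distinct xs" "sorted (map d xs)" using ys by (auto simp: xs_def)
  have len: "length xs = CARD('n)" using distinct_card[OF xs(2)] xs(1) by simp
  have "mset xs = mset_set UNIV" using mset_set_set[OF xs(2)] xs(1) by simp
  then have "proots (charac_poly A) = mset (map d xs)" unfolding proots_charac_poly[OF Q eig] by simp
  then have "sorted_list_of_multiset (proots (charac_poly A)) = sort (map d xs)"
    by (simp only: sorted_list_of_multiset_mset)
  also have "\<dots> = map d xs" using xs(3) by (rule sorted_sort_id)
  finally have "sorted_list_of_multiset (proots (charac_poly A)) = map d xs" .
  then have "ky_fan_antinorm m A = sum_list (map d (take m xs))"
    by (simp add: ky_fan_antinorm_def take_map)
  also have "\<dots> = (\<Sum>i\<in>set (take m xs). d i)" using xs(2) by (intro sum_list_distinct_conv_sum_set) auto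
  finally have "ky_fan_antinorm m A = (\<Sum>i\<in>set (take m xs). d i)" .
  moreover have "card (set (take m xs)) = m" using xs(2) m len by (subst distinct_card) auto
  moreover have "d i \<le> d j" if "i \<in> set (take m xs)" "j \<notin> set (take m xs)" for i j
  proof -
    have "j \<in> set (take m xs @ drop m xs)" using xs(1) by simp
    then have "j \<in> set (drop m xs)" using that(2) by (auto simp del: append_take_drop_id)
    moreover have "sorted (map d (take m xs) @ map d (drop m xs))" using xs(3) by (simp flip: map_append)
    ultimately show ?thesis using that(1) unfolding sorted_append by auto
  qed
  ultimately show ?thesis using that by blast
qed

text \<open>The eigenvectors are permuted in such a way that those of the smallest eigenvalues get the indices in \<open>S\<close>,
the coordinates reserved for the Dirac delta.\<close>
lemma ky_fan_attained:
  fixes A :: "real^'n::finite^'n" and S :: "'n set"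
  assumes A: "transpose A = A"
  obtains U where "orthogonal_matrix U" "ky_fan_antinorm (card S) A = (\<Sum>j\<in>S. row j U \<bullet> (A *v row j U))"
proof -
  obtain Q d where Q: "orthogonal_matrix Q" "\<And>i. A *v row i Q = d i *\<^sub>R row i Q"
    using spectral_theorem_symmetric[OF A] by blast
  have "card S \<le> CARD('n)" by (rule card_mono) auto
  then obtain E where E: "card E = card S" "ky_fan_antinorm (card S) A = (\<Sum>i\<in>E. d i)"
    using ky_fan_antinorm_eigenvalues[OF Q] by metis
  obtain f where f: "bij_betw f S E" using finite_same_card_bij[of S E] E(1) by auto
  have "card (- S) = card (- E)" using E(1) by (simp add: Compl_eq_Diff_UNIV card_Diff_subset)
  then obtain g where g: "bij_betw g (- S) (- E)" using finite_same_card_bij[of "- S" "- E"] by auto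
  define p where "p j = (if j \<in> S then f j else g j)" for j
  have pS: "bij_betw p S E" using f by (rule bij_betw_cong[THEN iffD1, rotated]) (simp add: p_def)
  have "bij_betw p (- S) (- E)" using g by (rule bij_betw_cong[THEN iffD1, rotated]) (simp add: p_def)
  from bij_betw_combine[OF pS this] have "inj p" by (auto simp: bij_betw_def)
  define U where "U = (\<chi> j. row (p j) Q)"
  have row: "row j U = row (p j) Q" for j by (simp add: U_def row_def vec_eq_iff)
  have "orthogonal_matrix U"
    using Q(1) \<open>inj p\<close> unfolding orthogonal_matrix_orthonormal_rows row by (auto dest: injD)
  moreover have "ky_fan_antinorm (card S) A = (\<Sum>j\<in>S. row j U \<bullet> (A *v row j U))"
  proof -
    have "row i Q \<bullet> row i Q = 1" for i using Q(1) unfolding orthogonal_matrix_orthonormal_rows by (simp add: norm_eq_1)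
    then have "(\<Sum>j\<in>S. row j U \<bullet> (A *v row j U)) = (\<Sum>j\<in>S. d (p j))" by (simp add: row Q(2))
    also have "\<dots> = (\<Sum>i\<in>E. d i)" by (rule sum.reindex_bij_betw[OF pS])
    finally show ?thesis using E(2) by simp
  qed
  ultimately show ?thesis by (rule that)
qed

lemma inner_orthonormal_rows:
  fixes Q :: "real^'n::finite^'n"
  assumes "orthogonal_matrix Q"
  shows "x \<bullet> y = (\<Sum>i\<in>UNIV. (row i Q \<bullet> x) * (row i Q \<bullet> y))"
proof -
  have "orthogonal_transformation ((*v) Q)" using assms by (simp add: orthogonal_transformation_matrix)
  then have "x \<bullet> y = (Q *v x) \<bullet> (Q *v y)" by (simp add: orthogonal_transformation_def)
  moreover have "(Q *v x) $ i = row i Q \<bullet> x" for x i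
    by (simp add: matrix_vector_mult_def row_def inner_vec_def)
  ultimately show ?thesis by (simp add: inner_vec_def)
qed

text \<open>In an eigenbasis the right-hand side is a weighted sum of the eigenvalues with weights \<open>w i\<close> between \<open>0\<close>
and \<open>1\<close> of total mass \<open>card S\<close>. Such a sum is smallest when the mass sits on the
smallest eigenvalues.\<close>
theorem ky_fan_le:
  fixes A :: "real^'n::finite^'n" and S :: "'n set"
  assumes A: "transpose A = A" and U: "orthogonal_matrix U"
  shows "ky_fan_antinorm (card S) A \<le> (\<Sum>j\<in>S. row j U \<bullet> (A *v row j U))"
proof -
  obtain Q d where Q: "orthogonal_matrix Q" "\<And>i. A *v row i Q = d i *\<^sub>R row i Q"
    using spectral_theorem_symmetric[OF A] by blast
  have "card S \<le> CARD('n)" by (rule card_mono) auto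
  then obtain E where E: "card E = card S" "ky_fan_antinorm (card S) A = (\<Sum>i\<in>E. d i)"
    "\<And>i j. i \<in> E \<Longrightarrow> j \<notin> E \<Longrightarrow> d i \<le> d j"
    using ky_fan_antinorm_eigenvalues[OF Q] by metis
  define w where "w i = (\<Sum>j\<in>S. (row j U \<bullet> row i Q)\<^sup>2)" for i
  have nU: "row j U \<bullet> row j U = 1" for j using U unfolding orthogonal_matrix_orthonormal_rows by (simp add: norm_eq_1)
  have nQ: "row j Q \<bullet> row j Q = 1" for j using Q(1) unfolding orthogonal_matrix_orthonormal_rows by (simp add: norm_eq_1)
  have w0: "0 \<le> w i" for i unfolding w_def by (intro sum_nonneg) auto
  have w1: "w i \<le> 1" for i
  proof -
    have "w i \<le> (\<Sum>j\<in>UNIV. (row j U \<bullet> row i Q)\<^sup>2)" unfolding w_def by (intro sum_mono2) auto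
    also have "\<dots> = row i Q \<bullet> row i Q" unfolding inner_orthonormal_rows[OF U, of "row i Q" "row i Q"] by (simp add: power2_eq_square)
    finally show ?thesis by (simp add: nQ)
  qed
  have "(\<Sum>i\<in>UNIV. w i) = (\<Sum>j\<in>S. \<Sum>i\<in>UNIV. (row j U \<bullet> row i Q)\<^sup>2)" unfolding w_def by (rule sum.swap)
  also have "\<dots> = (\<Sum>j\<in>S. row j U \<bullet> row j U)"
  proof (rule sum.cong[OF refl])
    fix j
    show "(\<Sum>i\<in>UNIV. (row j U \<bullet> row i Q)\<^sup>2) = row j U \<bullet> row j U"
      unfolding inner_orthonormal_rows[OF Q(1), of "row j U" "row j U"] by (simp add: power2_eq_square inner_commute)
  qed
  finally have wsum: "(\<Sum>i\<in>UNIV. w i) = card S" by (simp add: nU)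
  have quad: "x \<bullet> (A *v x) = (\<Sum>i\<in>UNIV. d i * (row i Q \<bullet> x)\<^sup>2)" for x
  proof -
    have "row i Q \<bullet> (A *v x) = d i * (row i Q \<bullet> x)" for i
      using symmetric_matrix_inner[OF A, of "row i Q" x] Q(2) by simp
    then show ?thesis unfolding inner_orthonormal_rows[OF Q(1), of x "A *v x"] by (simp add: power2_eq_square mult_ac)
  qed
  have rhs: "(\<Sum>j\<in>S. row j U \<bullet> (A *v row j U)) = (\<Sum>i\<in>UNIV. w i * d i)"
    unfolding quad w_def sum_distrib_right by (subst sum.swap) (simp add: inner_commute mult.commute)
  show ?thesis
  proof (cases "S = {}")
    case True
    then have "E = {}" using E(1) by simp
    then show ?thesis using E(2) True by simp
  next
    case False
    then have "E \<noteq> {}" using E(1) by (auto simp: card_eq_0_iff)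
    \<comment> \<open>the threshold between the eigenvalues in \<open>E\<close> and the others; subtracting it is free of charge as the masses agree\<close>
    define t where "t = Max (d ` E)"
    have tE: "d i \<le> t" if "i \<in> E" for i unfolding t_def using that by (intro Max_ge) auto
    have "t \<in> d ` E" unfolding t_def using \<open>E \<noteq> {}\<close> by (intro Max_in) auto
    then have tnE: "t \<le> d j" if "j \<notin> E" for j using E(3) that by blast
    have sE: "(\<Sum>i\<in>E. g i) = (\<Sum>i\<in>UNIV. indicator E i * g i)" for g :: "'n \<Rightarrow> real"
      by (simp add: indicator_def sum.If_cases)
    have "0 \<le> (\<Sum>i\<in>UNIV. (w i - indicator E i) * (d i - t))"
    proof (rule sum_nonneg)
      fix i
      show "0 \<le> (w i - indicator E i) * (d i - t)"
        using w0[of i] w1[of i] tE[of i] tnE[of i] by (cases "i \<in> E") (auto simp: mult_nonpos_nonpos)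
    qed
    also have "\<dots> = (\<Sum>i\<in>UNIV. w i * d i) - (\<Sum>i\<in>E. d i) - t * ((\<Sum>i\<in>UNIV. w i) - (\<Sum>i\<in>E. 1))"
      unfolding sE by (simp add: algebra_simps sum.distrib sum_subtractf sum_distrib_left)
    also have "\<dots> = (\<Sum>i\<in>UNIV. w i * d i) - (\<Sum>i\<in>E. d i)" unfolding wsum using E(1) by simp
    finally show ?thesis unfolding rhs E(2) by simp
  qed
qed


section \<open>The sesquilinear form of a kernel\<close>

lemma lebesgue_measurable_cong_AE:
  fixes f g :: "'a::euclidean_space \<Rightarrow> complex"
  assumes g: "g \<in> borel_measurable lebesgue" and AE: "AE x in lebesgue. f x = g x"
  shows "f \<in> borel_measurable lebesgue"
proof (rule borel_measurableI)
  fix V :: "complex set" assume "open V"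
  then have "g -` V \<inter> space lebesgue \<in> sets lebesgue" using g by measurable
  then show "f -` V \<inter> space lebesgue \<in> sets lebesgue"
    by (rule completion.in_sets_AE[rotated]) (use AE in \<open>auto elim!: eventually_mono\<close>)
qed

text \<open>Kernels and functions in \<open>L2\<close> are only Lebesgue measurable, while Fubini's theorem is applied to
Borel functions on a product; this lemma passes from the former to the latter. Since Lebesgue
measure is complete, \<open>f\<close> inherits measurability from \<open>g\<close>.\<close>
lemma lebesgue_integral_cong_borel:
  fixes f g :: "'a::euclidean_space \<Rightarrow> complex"
  assumes g: "g \<in> borel_measurable borel" and AE: "AE x in lebesgue. f x = g x"
  shows "(LINT x|lebesgue. f x) = (LINT x|lborel. g x)"
    and "integrable lebesgue f \<longleftrightarrow> integrable lborel g"
proof -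
  have gl: "g \<in> borel_measurable lebesgue" using g by (simp add: measurable_completion)
  have fl: "f \<in> borel_measurable lebesgue" by (rule lebesgue_measurable_cong_AE[OF gl AE])
  have "(LINT x|lebesgue. f x) = (LINT x|lebesgue. g x)" by (rule integral_cong_AE[OF fl gl AE])
  also have "\<dots> = (LINT x|lborel. g x)" using g by (intro integral_completion) simp
  finally show "(LINT x|lebesgue. f x) = (LINT x|lborel. g x)" .
  have "integrable lebesgue f \<longleftrightarrow> integrable lebesgue g" by (rule integrable_cong_AE[OF fl gl AE])
  also have "\<dots> \<longleftrightarrow> integrable lborel g" using g by (intro integrable_completion) simp
  finally show "integrable lebesgue f \<longleftrightarrow> integrable lborel g" .
qed

lemma borel_measurable_cnj [measurable]:
  "f \<in> borel_measurable N \<Longrightarrow> (\<lambda>x. cnj (f x)) \<in> borel_measurable N"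
  by (rule measurable_compose[OF _ borel_measurable_continuous_onI]) (auto intro: continuous_intros)

lemma borel_measurable_comp_fst_snd:
  fixes f :: "'a::euclidean_space \<Rightarrow> 'c::topological_space" and g :: "'b::euclidean_space \<Rightarrow> 'c"
  shows "f \<in> borel_measurable borel \<Longrightarrow> (\<lambda>p :: 'a \<times> 'b. f (fst p)) \<in> borel_measurable borel"
    and "g \<in> borel_measurable borel \<Longrightarrow> (\<lambda>p :: 'a \<times> 'b. g (snd p)) \<in> borel_measurable borel"
  by (rule measurable_compose[OF borel_measurable_continuous_onI], intro continuous_intros, assumption)+

lemma
  fixes a :: "'a::euclidean_space \<Rightarrow> complex" and b :: "'b::euclidean_space \<Rightarrow> complex"
  assumes a: "a \<in> borel_measurable borel" and b: "b \<in> borel_measurable borel"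
  shows kernel_integrand_borel: "M \<in> borel_measurable borel \<Longrightarrow>
      (\<lambda>(x, y). cnj (a x) * M (x, y) * b y) \<in> borel_measurable borel"
    and kernel_integrand_lebesgue: "M \<in> borel_measurable lebesgue \<Longrightarrow>
      (\<lambda>(x, y). cnj (a x) * M (x, y) * b y) \<in> borel_measurable lebesgue"
proof -
  have "(\<lambda>x. cnj (a x)) \<in> borel_measurable borel" using a by measurable
  then have 1: "(\<lambda>p :: 'a \<times> 'b. cnj (a (fst p))) \<in> borel_measurable borel" by (rule borel_measurable_comp_fst_snd(1))
  have 2: "(\<lambda>p :: 'a \<times> 'b. b (snd p)) \<in> borel_measurable borel" using b by (rule borel_measurable_comp_fst_snd(2))
  have e: "(\<lambda>(x, y). cnj (a x) * M (x, y) * b y) = (\<lambda>p. cnj (a (fst p)) * M p * b (snd p))" for M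
    by (auto simp: fun_eq_iff)
  show "(\<lambda>(x, y). cnj (a x) * M (x, y) * b y) \<in> borel_measurable borel" if "M \<in> borel_measurable borel"
    unfolding e by (intro borel_measurable_times 1 2 that)
  show "(\<lambda>(x, y). cnj (a x) * M (x, y) * b y) \<in> borel_measurable lebesgue" if "M \<in> borel_measurable lebesgue"
    unfolding e by (intro borel_measurable_times that; rule measurable_completion) (use 1 2 in simp_all)
qed

lemma AE_lebesgue_prod:
  fixes P :: "'a::euclidean_space \<Rightarrow> bool" and Q :: "'b::euclidean_space \<Rightarrow> bool"
  assumes "AE x in lebesgue. P x" "AE y in lebesgue. Q y"
  shows "AE p in (lebesgue :: ('a \<times> 'b) measure). P (fst p) \<and> Q (snd p)"
proof -
  have ae: "AE x in lborel. P x" "AE y in lborel. Q y" using assms unfolding AE_completion_iff .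
  from ae(1) obtain N where N: "N \<in> null_sets lborel" "{x. \<not> P x} \<subseteq> N"
    unfolding eventually_ae_filter by auto
  from ae(2) obtain N' where N': "N' \<in> null_sets lborel" "{y. \<not> Q y} \<subseteq> N'"
    unfolding eventually_ae_filter by auto
  have "N \<times> UNIV \<in> null_sets (lborel \<Otimes>\<^sub>M lborel)" by (rule lborel.times_in_null_sets1[OF N(1)]) simp
  then have 1: "AE p in (lborel :: ('a \<times> 'b) measure). p \<notin> N \<times> UNIV" unfolding lborel_prod by (rule AE_not_in)
  have "UNIV \<times> N' \<in> null_sets (lborel \<Otimes>\<^sub>M lborel)" by (rule lborel.times_in_null_sets2[OF _ N'(1)]) simp
  then have 2: "AE p in (lborel :: ('a \<times> 'b) measure). p \<notin> UNIV \<times> N'" unfolding lborel_prod by (rule AE_not_in)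
  from 1 2 have "AE p in (lborel :: ('a \<times> 'b) measure). P (fst p) \<and> Q (snd p)"
    by eventually_elim (use N(2) N'(2) in auto)
  then show ?thesis by (rule AE_completion)
qed

lemma L1_form_cong_AE:
  assumes "AE x in lebesgue. f x = f' x" "AE x in lebesgue. g x = g' x"
    and f': "f' \<in> borel_measurable borel" and g': "g' \<in> borel_measurable borel" and M: "M \<in> borel_measurable lebesgue"
  shows "L1_form M f g = L1_form M f' g'"
proof -
  have AE: "AE p in lebesgue. (case p of (x, y) \<Rightarrow> cnj (f x) * M (x, y) * g y) = (case p of (x, y) \<Rightarrow> cnj (f' x) * M (x, y) * g' y)"
    using AE_lebesgue_prod[OF assms(1,2)] by eventually_elim (auto simp: case_prod_beta)
  note m = kernel_integrand_lebesgue[OF f' g' M]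
  show ?thesis unfolding L1_form_def
    by (rule integral_cong_AE[OF lebesgue_measurable_cong_AE[OF m AE] m AE])
qed

lemma integrable_product_mult:
  fixes a :: "'a::euclidean_space \<Rightarrow> real" and b :: "'b::euclidean_space \<Rightarrow> real"
  assumes "integrable lborel a" "integrable lborel b"
  shows "integrable (lborel \<Otimes>\<^sub>M lborel) (\<lambda>(x, y). a x * b y)"
    and "integral\<^sup>L (lborel \<Otimes>\<^sub>M lborel) (\<lambda>(x, y). a x * b y) = (LINT x|lborel. a x) * (LINT y|lborel. b y)"
proof -
  have [measurable]: "a \<in> borel_measurable borel" "b \<in> borel_measurable borel" using assms by auto
  show i: "integrable (lborel \<Otimes>\<^sub>M lborel) (\<lambda>(x, y). a x * b y)"
  proof (rule lborel_pair.Fubini_integrable)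
    show "(\<lambda>(x, y). a x * b y) \<in> borel_measurable (lborel \<Otimes>\<^sub>M lborel)" by measurable
  qed (use assms in \<open>auto simp: abs_mult\<close>)
  show "integral\<^sup>L (lborel \<Otimes>\<^sub>M lborel) (\<lambda>(x, y). a x * b y) = (LINT x|lborel. a x) * (LINT y|lborel. b y)"
    using lborel_pair.integral_fst[OF i] by simp
qed

locale bounded_kernel =
  fixes M :: "(real^'n::finite) \<times> (real^'n) \<Rightarrow> complex" and K :: real
  assumes M: "M \<in> borel_measurable lebesgue" and K: "\<And>p. norm (M p) \<le> K"
begin

lemma K_nonneg: "0 \<le> K"
  using K norm_ge_zero order_trans by blast

lemma
  assumes a: "integrable lborel a" and b: "integrable lborel b"
  shows integrable_L1_form: "integrable lebesgue (\<lambda>(x, y). cnj (a x) * M (x, y) * b y)"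
    and L1_form_bound: "norm (L1_form M a b) \<le> K * (LINT x|lborel. norm (a x)) * (LINT x|lborel. norm (b x))"
proof -
  have [measurable]: "a \<in> borel_measurable borel" "b \<in> borel_measurable borel" using a b by auto
  let ?g = "\<lambda>p. K * (case p of (x, y) \<Rightarrow> norm (a x) * norm (b y))"
  note ab = integrable_product_mult[OF integrable_norm[OF a] integrable_norm[OF b], unfolded lborel_prod]
  have gi: "integrable lborel ?g" using ab(1) by simp
  then have gm: "?g \<in> borel_measurable borel" using borel_measurable_integrable by fastforce
  with gi have gl: "integrable lebesgue ?g" using gm by (subst integrable_completion) auto
  have le: "norm (case p of (x, y) \<Rightarrow> cnj (a x) * M (x, y) * b y) \<le> ?g p" for p
    using mult_right_mono[OF K[of p], of "norm (a (fst p)) * norm (b (snd p))"]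
    by (cases p) (simp add: norm_mult mult_ac)
  have m: "(\<lambda>(x, y). cnj (a x) * M (x, y) * b y) \<in> borel_measurable lebesgue"
    by (rule kernel_integrand_lebesgue[OF _ _ M]) simp_all
  show i: "integrable lebesgue (\<lambda>(x, y). cnj (a x) * M (x, y) * b y)"
    by (rule Bochner_Integration.integrable_bound[OF gl m])
       (intro AE_I2 order_trans[OF le], simp)
  have "norm (L1_form M a b) \<le> (LINT p|lebesgue. ?g p)"
    unfolding L1_form_def by (rule norm_integral_le[OF i gl le])
  also have "\<dots> = (LINT p|lborel. ?g p)" using gm by (intro integral_completion) simp
  also have "\<dots> = K * (LINT x|lborel. norm (a x)) * (LINT x|lborel. norm (b x))"
    using ab(2) by simp
  finally show "norm (L1_form M a b) \<le> K * (LINT x|lborel. norm (a x)) * (LINT x|lborel. norm (b x))" .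
qed

lemma L1_form_diff_left:
  assumes "integrable lborel a" "integrable lborel a'" "integrable lborel b"
  shows "L1_form M (\<lambda>x. a x - a' x) b = L1_form M a b - L1_form M a' b"
  unfolding L1_form_def
  by (subst Bochner_Integration.integral_diff[OF integrable_L1_form[OF assms(1,3)] integrable_L1_form[OF assms(2,3)], symmetric])
     (rule Bochner_Integration.integral_cong, auto simp: left_diff_distrib)

lemma L1_form_diff_right:
  assumes "integrable lborel a" "integrable lborel b" "integrable lborel b'"
  shows "L1_form M a (\<lambda>x. b x - b' x) = L1_form M a b - L1_form M a b'"
  unfolding L1_form_def
  by (subst Bochner_Integration.integral_diff[OF integrable_L1_form[OF assms(1,2)] integrable_L1_form[OF assms(1,3)], symmetric])
     (rule Bochner_Integration.integral_cong, auto simp: right_diff_distrib)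

lemma L1_form_sum:
  fixes c e :: "'n \<Rightarrow> real"
  assumes a: "\<And>i. integrable lborel (a i)" and b: "\<And>i. integrable lborel (b i)"
  shows "L1_form M (\<lambda>x. \<Sum>i\<in>UNIV. of_real (c i) * a i x) (\<lambda>x. \<Sum>j\<in>UNIV. of_real (e j) * b j x)
    = (\<Sum>i\<in>UNIV. \<Sum>j\<in>UNIV. of_real (c i * e j) * L1_form M (a i) (b j))"
proof -
  have "L1_form M (\<lambda>x. \<Sum>i\<in>UNIV. of_real (c i) * a i x) (\<lambda>x. \<Sum>j\<in>UNIV. of_real (e j) * b j x)
    = (LINT p|lebesgue. (\<Sum>i\<in>UNIV. \<Sum>j\<in>UNIV. of_real (c i * e j) * (case p of (x, y) \<Rightarrow> cnj (a i x) * M (x, y) * b j y)))"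
    unfolding L1_form_def
    by (intro Bochner_Integration.integral_cong refl)
       (auto simp: sum_distrib_left sum_distrib_right mult_ac intro!: sum.cong)
  also have "\<dots> = (\<Sum>i\<in>UNIV. \<Sum>j\<in>UNIV. of_real (c i * e j) * L1_form M (a i) (b j))"
    unfolding L1_form_def
    by (simp add: Bochner_Integration.integral_sum Bochner_Integration.integrable_sum integrable_L1_form[OF a b])
  finally show ?thesis .
qed

text \<open>The form is continuous in the \<open>L\<^sub>1\<close>-norm because the kernel is bounded.\<close>
lemma L1_form_tendsto_zero_diff:
  fixes a A :: "real \<Rightarrow> real^'n \<Rightarrow> complex"
  assumes a: "\<And>\<epsilon>. 0 < \<epsilon> \<Longrightarrow> integrable lborel (a \<epsilon>)" "\<And>\<epsilon>. 0 < \<epsilon> \<Longrightarrow> integrable lborel (A \<epsilon>)"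
    and b: "\<And>\<epsilon>. 0 < \<epsilon> \<Longrightarrow> integrable lborel (b \<epsilon>)" "\<And>\<epsilon>. 0 < \<epsilon> \<Longrightarrow> integrable lborel (B \<epsilon>)"
    and da: "\<And>\<epsilon>. 0 < \<epsilon> \<Longrightarrow> (LINT x|lborel. norm (A \<epsilon> x - a \<epsilon> x)) \<le> C * \<epsilon>"
    and db: "\<And>\<epsilon>. 0 < \<epsilon> \<Longrightarrow> (LINT x|lborel. norm (B \<epsilon> x - b \<epsilon> x)) \<le> C * \<epsilon>"
    and na: "\<And>\<epsilon>. 0 < \<epsilon> \<Longrightarrow> (LINT x|lborel. norm (a \<epsilon> x)) \<le> N"
    and nb: "\<And>\<epsilon>. 0 < \<epsilon> \<Longrightarrow> (LINT x|lborel. norm (b \<epsilon> x)) \<le> N"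
    and pos: "0 \<le> C" "0 \<le> N"
  shows "((\<lambda>\<epsilon>. L1_form M (A \<epsilon>) (B \<epsilon>) - L1_form M (a \<epsilon>) (b \<epsilon>)) \<longlongrightarrow> 0) (at_right 0)"
proof -
  let ?bd = "\<lambda>\<epsilon>. K * (C * \<epsilon>) * (C * \<epsilon>) + K * (C * \<epsilon>) * N + K * N * (C * \<epsilon>)"
  have le: "norm (L1_form M (A \<epsilon>) (B \<epsilon>) - L1_form M (a \<epsilon>) (b \<epsilon>)) \<le> ?bd \<epsilon>" if \<epsilon>: "0 < \<epsilon>" for \<epsilon>
  proof -
    let ?dA = "\<lambda>x. A \<epsilon> x - a \<epsilon> x" and ?dB = "\<lambda>x. B \<epsilon> x - b \<epsilon> x"
    note i = a[OF \<epsilon>] b[OF \<epsilon>]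
    have d: "integrable lborel ?dA" "integrable lborel ?dB" using i by auto
    have e: "L1_form M (A \<epsilon>) (B \<epsilon>) - L1_form M (a \<epsilon>) (b \<epsilon>) = L1_form M ?dA ?dB + L1_form M ?dA (b \<epsilon>) + L1_form M (a \<epsilon>) ?dB"
      using i d by (simp add: L1_form_diff_left L1_form_diff_right)
    have 1: "norm (L1_form M ?dA ?dB) \<le> K * (C * \<epsilon>) * (C * \<epsilon>)"
      by (rule order_trans[OF L1_form_bound[OF d]], intro mult_mono da db \<epsilon>) (use pos \<epsilon> K_nonneg in auto)
    have 2: "norm (L1_form M ?dA (b \<epsilon>)) \<le> K * (C * \<epsilon>) * N"
      by (rule order_trans[OF L1_form_bound[OF d(1) i(3)]], intro mult_mono da nb \<epsilon>) (use pos \<epsilon> K_nonneg in auto)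
    have 3: "norm (L1_form M (a \<epsilon>) ?dB) \<le> K * N * (C * \<epsilon>)"
      by (rule order_trans[OF L1_form_bound[OF i(1) d(2)]], intro mult_mono na db \<epsilon>) (use pos \<epsilon> K_nonneg in auto)
    show ?thesis unfolding e by (rule norm_triangle_le, rule add_mono[OF norm_triangle_le 3], rule add_mono[OF 1 2])
  qed
  have "(?bd \<longlongrightarrow> K * (C * 0) * (C * 0) + K * (C * 0) * N + K * N * (C * 0)) (at_right 0)"
    by (intro tendsto_intros)
  then have lim: "(?bd \<longlongrightarrow> 0) (at_right 0)" by simp
  have "\<forall>\<^sub>F \<epsilon> in at_right 0. norm (L1_form M (A \<epsilon>) (B \<epsilon>) - L1_form M (a \<epsilon>) (b \<epsilon>)) \<le> ?bd \<epsilon>"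
    using eventually_at_right_less by (rule eventually_mono) (rule le)
  from Lim_null_comparison[OF this lim] show ?thesis .
qed

lemma L1_form_eq_L2_inner:
  assumes a: "integrable lborel a" and b: "integrable lborel b"
  shows "L1_form M a b = L2_inner a (kernel_op M b)"
proof -
  have [measurable]: "a \<in> borel_measurable borel" "b \<in> borel_measurable borel" using a b by auto
  obtain M' where M' [measurable]: "M' \<in> borel_measurable borel" and MM': "AE p in lebesgue. M p = M' p"
    using borel_version[OF M] by blast
  have M'p [measurable]: "M' \<in> borel_measurable (lborel \<Otimes>\<^sub>M lborel)" unfolding lborel_prod by simp
  let ?F = "\<lambda>(x, y). cnj (a x) * M (x, y) * b y" and ?F' = "\<lambda>(x, y). cnj (a x) * M' (x, y) * b y"
  have F'm: "?F' \<in> borel_measurable borel" by (rule kernel_integrand_borel[OF _ _ M']) simp_all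
  have FF': "AE p in lebesgue. ?F p = ?F' p" using MM' by eventually_elim auto
  note * = lebesgue_integral_cong_borel[OF F'm FF']
  have F'i: "integrable (lborel \<Otimes>\<^sub>M lborel) (\<lambda>(x, y). cnj (a x) * M' (x, y) * b y)"
    using integrable_L1_form[OF a b] *(2) unfolding lborel_prod by simp
  have "L1_form M a b = integral\<^sup>L (lborel \<Otimes>\<^sub>M lborel) ?F'"
    unfolding L1_form_def lborel_prod using *(1) .
  also have "\<dots> = (LINT x|lborel. LINT y|lborel. cnj (a x) * M' (x, y) * b y)"
    using lborel_pair.integral_fst[OF F'i] by simp
  also have "\<dots> = (LINT x|lborel. cnj (a x) * (LINT y|lborel. M' (x, y) * b y))"
    by (simp add: mult.assoc)
  also have "\<dots> = (LINT x|lebesgue. cnj (a x) * kernel_op M b x)"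
  proof (rule lebesgue_integral_cong_borel(1)[symmetric])
    show "(\<lambda>x. cnj (a x) * (LINT y|lborel. M' (x, y) * b y)) \<in> borel_measurable borel"
    proof -
      have "(\<lambda>x. LINT y|lborel. M' (x, y) * b y) \<in> borel_measurable lborel"
        by (rule lborel.borel_measurable_lebesgue_integral) (simp add: case_prod_beta)
      then show ?thesis by simp
    qed
    have "AE p in lborel \<Otimes>\<^sub>M lborel. M p = M' p"
      using MM' unfolding AE_completion_iff lborel_prod .
    from lborel_pair.AE_pair[OF this] have "AE x in lebesgue. AE y in lborel. M (x, y) = M' (x, y)"
      by (rule AE_completion)
    then show "AE x in lebesgue. cnj (a x) * kernel_op M b x = cnj (a x) * (LINT y|lborel. M' (x, y) * b y)"
    proof eventually_elim
      case (elim x)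
      then have "AE y in lebesgue. M (x, y) * b y = M' (x, y) * b y"
        unfolding AE_completion_iff by eventually_elim simp
      from lebesgue_integral_cong_borel(1)[OF _ this] show ?case by (simp add: kernel_op_def)
    qed
  qed
  finally show ?thesis by (simp add: L2_inner_def)
qed

subsection \<open>Forms of densities on subspaces\<close>

text \<open>For densities on subspaces the existential definition of the form becomes a limit of explicit
integrals.\<close>
lemma has_form_push_dist:
  fixes B :: "real^'k::finite \<Rightarrow> real^'n" and B' :: "real^'l::finite \<Rightarrow> real^'n"
  assumes a: "integrable lborel a" and B: "B \<in> borel_measurable borel"
    and b: "integrable lborel b" and B': "B' \<in> borel_measurable borel"
  shows "has_form M (push_dist B a) (push_dist B' b) c \<longleftrightarrow>
    ((\<lambda>\<epsilon>. L1_form M (smear B a (gaussian \<epsilon>)) (smear B' b (gaussian \<epsilon>))) \<longlongrightarrow> c) (at_right 0)"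
proof
  have sa: "integrable lborel (smear B a (gaussian \<epsilon>))" if "0 < \<epsilon>" for \<epsilon>
    by (rule integrable_smear[OF a integrable_gaussian[OF that] B])
  have sb: "integrable lborel (smear B' b (gaussian \<epsilon>))" if "0 < \<epsilon>" for \<epsilon>
    by (rule integrable_smear[OF b integrable_gaussian[OF that] B'])
  have leb: "integrable lebesgue f" if "integrable lborel f" for f :: "real^'n \<Rightarrow> complex"
    using that by (subst integrable_completion) auto
  { assume "has_form M (push_dist B a) (push_dist B' b) c"
    then obtain f g where fg: "\<And>\<epsilon>. 0 < \<epsilon> \<Longrightarrow> integrable lebesgue (f \<epsilon>) \<and> fun_dist (f \<epsilon>) = dist_conv (push_dist B a) (gaussian \<epsilon>) \<and>
        integrable lebesgue (g \<epsilon>) \<and> fun_dist (g \<epsilon>) = dist_conv (push_dist B' b) (gaussian \<epsilon>)"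
      and lim: "((\<lambda>\<epsilon>. L1_form M (f \<epsilon>) (g \<epsilon>)) \<longlongrightarrow> c) (at_right 0)"
      unfolding has_form_def by blast
    have "L1_form M (f \<epsilon>) (g \<epsilon>) = L1_form M (smear B a (gaussian \<epsilon>)) (smear B' b (gaussian \<epsilon>))" if \<epsilon>: "0 < \<epsilon>" for \<epsilon>
    proof (rule L1_form_cong_AE[OF _ _ _ _ M])
      show "AE x in lebesgue. f \<epsilon> x = smear B a (gaussian \<epsilon>) x"
        by (rule fun_dist_unique[OF _ leb[OF sa[OF \<epsilon>]]]) (use fg[OF \<epsilon>] dist_conv_push_dist[OF a B \<epsilon>] in auto)
      show "AE x in lebesgue. g \<epsilon> x = smear B' b (gaussian \<epsilon>) x"
        by (rule fun_dist_unique[OF _ leb[OF sb[OF \<epsilon>]]]) (use fg[OF \<epsilon>] dist_conv_push_dist[OF b B' \<epsilon>] in auto)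
    qed (use sa[OF \<epsilon>] sb[OF \<epsilon>] in auto)
    then have "\<forall>\<^sub>F \<epsilon> in at_right 0. L1_form M (f \<epsilon>) (g \<epsilon>) = L1_form M (smear B a (gaussian \<epsilon>)) (smear B' b (gaussian \<epsilon>))"
      using eventually_at_right_less by (rule eventually_mono[rotated])
    from Lim_transform_eventually[OF lim this]
    show "((\<lambda>\<epsilon>. L1_form M (smear B a (gaussian \<epsilon>)) (smear B' b (gaussian \<epsilon>))) \<longlongrightarrow> c) (at_right 0)" . }
  { assume "((\<lambda>\<epsilon>. L1_form M (smear B a (gaussian \<epsilon>)) (smear B' b (gaussian \<epsilon>))) \<longlongrightarrow> c) (at_right 0)"
    then show "has_form M (push_dist B a) (push_dist B' b) c"
      unfolding has_form_def
      by (intro exI[of _ "\<lambda>\<epsilon>. smear B a (gaussian \<epsilon>)"] exI[of _ "\<lambda>\<epsilon>. smear B' b (gaussian \<epsilon>)"])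
         (auto simp: dist_conv_push_dist a b B B' intro!: leb sa sb) }
qed

lemma dist_form_eqI:
  fixes B :: "real^'k::finite \<Rightarrow> real^'n" and B' :: "real^'l::finite \<Rightarrow> real^'n"
  assumes "integrable lborel a" "B \<in> borel_measurable borel" "integrable lborel b" "B' \<in> borel_measurable borel"
    and c: "has_form M (push_dist B a) (push_dist B' b) c"
  shows "dist_form M (push_dist B a) (push_dist B' b) = c"
  unfolding dist_form_def
proof (rule the_equality)
  show "has_form M (push_dist B a) (push_dist B' b) c" by (rule c)
next
  fix c' assume "has_form M (push_dist B a) (push_dist B' b) c'"
  with c show "c' = c" unfolding has_form_push_dist[OF assms(1-4)]
    by (intro tendsto_unique[OF trivial_limit_at_right_real])
qed

end

subsection \<open>Gaussian approximation in the mean\<close>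

text \<open>An integrable Lipschitz bound. For \<open>norm (x - y) \<le> 1\<close> it is the mean value inequality, with the
decay of the derivatives transported from the segment to \<open>x\<close> at the price of the factor \<open>2 ^ N\<close>; for
distant points the function values themselves are small enough.\<close>
lemma Schwartz_L1_modulus:
  fixes a :: "real^'n::finite \<Rightarrow> complex"
  assumes a: "a \<in> Schwartz"
  obtains W where "integrable lborel W" "\<And>x y. norm (a x - a y) \<le> norm (x - y) * (W x + W y)" "\<And>x. 0 \<le> (W x :: real)"
proof -
  let ?N = "2 * DIM(real^'n)"
  define c where "c = schwartz_seminorm ?N [] a + 2 ^ ?N * (\<Sum>i\<in>UNIV. schwartz_seminorm ?N [] (partial_deriv i a))"
  define W where "W x = c * inverse ((1 + norm x) ^ ?N)" for x :: "real^'n"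
  have sn: "0 \<le> schwartz_seminorm ?N [] (partial_deriv i a)" for i
    by (intro schwartz_seminorm_nonneg Schwartz_partial_deriv a)
  have c1: "schwartz_seminorm ?N [] a \<le> c" 
  proof -
    have "0 \<le> 2 ^ ?N * (\<Sum>i\<in>UNIV. schwartz_seminorm ?N [] (partial_deriv i a))"
      by (intro mult_nonneg_nonneg sum_nonneg sn) simp
    then show ?thesis unfolding c_def by linarith
  qed
  have c2: "2 ^ ?N * (\<Sum>i\<in>UNIV. schwartz_seminorm ?N [] (partial_deriv i a)) \<le> c"
    unfolding c_def using schwartz_seminorm_nonneg[OF a, of ?N "[]"] by simp
  have c0: "0 \<le> c" using c1 schwartz_seminorm_nonneg[OF a, of ?N "[]"] by linarith
  have W0: "0 \<le> W x" for x unfolding W_def using c0 by simp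
  have aW: "norm (a x) \<le> W x" for x
  proof -
    have "norm (a x) \<le> schwartz_seminorm ?N [] a / (1 + norm x) ^ ?N" using Schwartz_norm_le[OF a, of "[]"] by simp
    also have "\<dots> \<le> c / (1 + norm x) ^ ?N" by (rule divide_right_mono[OF c1]) simp
    finally show ?thesis by (simp add: W_def divide_inverse)
  qed
  have "norm (a x - a y) \<le> norm (x - y) * (W x + W y)" for x y
  proof (cases "norm (x - y) \<le> 1")
    case True
    have "norm (a y - a x) \<le> W x * norm (y - x)"
    proof (rule differentiable_bound[of "cball x 1"])
      fix z assume z: "z \<in> cball x 1"
      show "(a has_derivative (\<lambda>h. \<Sum>i\<in>UNIV. (h $ i) *\<^sub>R partial_deriv i a z)) (at z within cball x 1)"
        by (rule has_derivative_at_withinI[OF has_derivative_partials[OF Schwartz_differentiable0[OF a]]])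
      have "norm x \<le> norm z + norm (x - z)" using norm_triangle_ineq[of z "x - z"] by simp
      moreover have "norm (x - z) \<le> 1" using z by (simp add: dist_norm)
      ultimately have "1 + norm x \<le> 2 * (1 + norm z)" using norm_ge_zero[of z] unfolding distrib_left by linarith
      then have xz: "(1 + norm x) ^ ?N \<le> 2 ^ ?N * (1 + norm z) ^ ?N"
        by (simp only: power_mult_distrib[symmetric]) (rule power_mono, auto)
      have "onorm (\<lambda>h :: real^'n. \<Sum>i\<in>UNIV. (h $ i) *\<^sub>R partial_deriv i a z)
          \<le> (\<Sum>i\<in>UNIV. schwartz_seminorm ?N [] (partial_deriv i a) / (1 + norm z) ^ ?N)"
        using Schwartz_norm_le[OF Schwartz_partial_deriv[OF a], of "[]"] by (intro onorm_partials_le) simp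
      also have "\<dots> = (\<Sum>i\<in>UNIV. schwartz_seminorm ?N [] (partial_deriv i a)) / (1 + norm z) ^ ?N"
        by (simp add: sum_divide_distrib)
      also have "\<dots> \<le> (\<Sum>i\<in>UNIV. schwartz_seminorm ?N [] (partial_deriv i a)) / ((1 + norm x) ^ ?N / 2 ^ ?N)"
        using xz by (intro divide_left_mono sum_nonneg sn) (auto simp: field_simps add_pos_nonneg)
      also have "\<dots> = (2 ^ ?N * (\<Sum>i\<in>UNIV. schwartz_seminorm ?N [] (partial_deriv i a))) / (1 + norm x) ^ ?N" by simp
      also have "\<dots> \<le> c / (1 + norm x) ^ ?N" by (rule divide_right_mono[OF c2]) simp
      finally show "onorm (\<lambda>h. \<Sum>i\<in>UNIV. (h $ i) *\<^sub>R partial_deriv i a z) \<le> W x"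
        by (simp add: W_def divide_inverse)
    qed (use True in \<open>auto simp: dist_norm\<close>)
    then have "norm (a x - a y) \<le> norm (x - y) * W x" by (simp add: norm_minus_commute mult.commute)
    also have "\<dots> \<le> norm (x - y) * (W x + W y)" using W0[of y] by (intro mult_left_mono) auto
    finally show ?thesis .
  next
    case False
    have "norm (a x - a y) \<le> 1 * (W x + W y)" using norm_triangle_ineq4[of "a x" "a y"] aW[of x] aW[of y] by simp
    also have "\<dots> \<le> norm (x - y) * (W x + W y)" using False W0[of x] W0[of y] by (intro mult_right_mono) auto
    finally show ?thesis .
  qed
  moreover have "integrable lborel W" unfolding W_def by (intro integrable_mult_right integrable_inverse_power_norm)
  ultimately show ?thesis using that W0 by blast
qed

lemma smear_ident_L1:
  fixes a :: "real^'n::finite \<Rightarrow> complex"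
  assumes a: "a \<in> Schwartz"
  shows "\<exists>C\<ge>0. \<forall>\<epsilon>>0. (LINT x|lborel. norm (a x - smear (\<lambda>y. y) a (gaussian \<epsilon>) x)) \<le> C * \<epsilon>"
proof -
  obtain W where W: "integrable lborel W" "\<And>x y. norm (a x - a y) \<le> norm (x - y) * (W x + W y)" "\<And>x. 0 \<le> (W x :: real)"
    using Schwartz_L1_modulus[OF a] by metis
  obtain K where K: "0 \<le> K" "\<And>\<epsilon>. 0 < \<epsilon> \<Longrightarrow> integrable lborel (\<lambda>x :: real^'n. norm x * gauss \<epsilon> x)"
    "\<And>\<epsilon>. 0 < \<epsilon> \<Longrightarrow> (LINT x|lborel. norm (x :: real^'n) * gauss \<epsilon> x) \<le> K * \<epsilon>"
    using gauss_first_moment by blast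
  let ?w = "LINT x|lborel. W x"
  have w0: "0 \<le> ?w" by (rule Bochner_Integration.integral_nonneg) (rule W(3))
  have ai: "integrable lborel a" by (rule integrable_Schwartz[OF a])
  have "(LINT x|lborel. norm (a x - smear (\<lambda>y. y) a (gaussian \<epsilon>) x)) \<le> (2 * ?w * K) * \<epsilon>" if \<epsilon>: "0 < \<epsilon>" for \<epsilon>
  proof -
    define q where "q u = norm u * gauss \<epsilon> u" for u :: "real^'n"
    have q: "integrable lborel q" "(LINT u|lborel. q u) \<le> K * \<epsilon>" using K(2,3)[OF \<epsilon>] by (auto simp: q_def[abs_def])
    have q0: "0 \<le> q u" for u by (simp add: q_def gauss_nonneg)
    have qt: "integrable lborel (\<lambda>y. q (x - y))" "(LINT y|lborel. q (x - y)) = (LINT u|lborel. q u)" for x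
      unfolding q_def by (rule integrable_moment_reflect[OF \<epsilon>], rule integral_moment_reflect[OF \<epsilon>])
    have ident: "(\<lambda>y :: real^'n. y) \<in> borel_measurable borel" by simp
    let ?b = "\<lambda>x. W x * (LINT u|lborel. q u) + smear (\<lambda>y. y) W q x"
    have le: "AE x in lborel. norm (a x - smear (\<lambda>y. y) a (gaussian \<epsilon>) x) \<le> ?b x"
      using smear_AE[OF ai integrable_gaussian[OF \<epsilon>] ident] smear_AE[OF W(1) q(1) ident]
    proof eventually_elim
      case (elim x)
      have "norm (smear (\<lambda>y. y) a (gaussian \<epsilon>) x - a x) \<le> (LINT y|lborel. W x * q (x - y) + W y * q (x - y))"
      proof (rule norm_smear_ident_diff_le[OF \<epsilon> elim(1)])
        show "integrable lborel (\<lambda>y. W x * q (x - y) + W y * q (x - y))"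
          by (intro Bochner_Integration.integrable_add integrable_mult_right qt elim)
        fix y
        have "norm (a y - a x) * gauss \<epsilon> (x - y) \<le> (norm (x - y) * (W x + W y)) * gauss \<epsilon> (x - y)"
          using W(2)[of x y] by (intro mult_right_mono gauss_nonneg) (simp add: norm_minus_commute)
        then show "norm (a y - a x) * gauss \<epsilon> (x - y) \<le> W x * q (x - y) + W y * q (x - y)"
          by (simp add: q_def algebra_simps)
      qed
      also have "\<dots> = ?b x"
        unfolding smear_def using elim(2) qt by (subst Bochner_Integration.integral_add) auto
      finally show ?case by (simp add: norm_minus_commute)
    qed
    have sm: "integrable lborel (smear (\<lambda>y. y) a (gaussian \<epsilon>))" by (rule integrable_smear[OF ai integrable_gaussian[OF \<epsilon>] ident])
    have sWi: "integrable lborel (smear (\<lambda>y. y) W q)" by (rule integrable_smear[OF W(1) q(1) ident])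
    have "(LINT x|lborel. norm (a x - smear (\<lambda>y. y) a (gaussian \<epsilon>) x)) \<le> (LINT x|lborel. ?b x)"
      using ai sm sWi W(1) le by (intro integral_mono_AE) auto
    also have "\<dots> = ?w * (LINT u|lborel. q u) + (LINT x|lborel. smear (\<lambda>y. y) W q x)"
      using sWi W(1) by simp
    also have "(LINT x|lborel. smear (\<lambda>y. y) W q x) \<le> (LINT x|lborel. norm (smear (\<lambda>y. y) W q x))"
      using sWi by (intro integral_mono) auto
    also have "\<dots> \<le> ?w * (LINT u|lborel. q u)"
      using smear_L1[OF W(1) q(1) ident] W(3) q0 by simp
    finally have "(LINT x|lborel. norm (a x - smear (\<lambda>y. y) a (gaussian \<epsilon>) x)) \<le> 2 * (?w * (LINT u|lborel. q u))" by simp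
    also have "\<dots> \<le> 2 * (?w * (K * \<epsilon>))" using w0 q(2) by (intro mult_left_mono) auto
    finally show ?thesis by (simp add: mult_ac)
  qed
  then show ?thesis using w0 K(1) by (intro exI[of _ "2 * ?w * K"]) auto
qed

lemma push_dist_ident:
  assumes "s \<in> Schwartz" shows "fun_dist s = push_dist (\<lambda>y. y) s"
  using fun_dist_lborel[OF Schwartz_measurable[OF assms]] by (simp add: push_dist_def)

lemma coord_mult_fun_dist:
  assumes "s \<in> Schwartz"
  shows "coord_mult i (fun_dist s) = fun_dist (\<lambda>x. of_real (x $ i) * s x)"
  unfolding coord_mult_def fun_dist_def by (rule restrict_ext) (simp add: Schwartz_mult_coord, simp add: mult_ac)

context bounded_kernel
begin

text \<open>Smearing a Schwartz function converges to the function in \<open>L\<^sub>1\<close> at rate \<open>\<epsilon>\<close>, so the regularized forms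
converge to the form itself.\<close>
lemma dist_form_Schwartz:
  assumes a: "a \<in> Schwartz" and b: "b \<in> Schwartz"
  shows "dist_form M (fun_dist a) (fun_dist b) = L1_form M a b"
proof -
  note ai = integrable_Schwartz[OF a] and bi = integrable_Schwartz[OF b]
  have id: "(\<lambda>y :: real^'n. y) \<in> borel_measurable borel" by simp
  obtain C D where C: "0 \<le> C" "\<And>\<epsilon>. 0 < \<epsilon> \<Longrightarrow> (LINT x|lborel. norm (a x - smear (\<lambda>y. y) a (gaussian \<epsilon>) x)) \<le> C * \<epsilon>"
    and D: "0 \<le> D" "\<And>\<epsilon>. 0 < \<epsilon> \<Longrightarrow> (LINT x|lborel. norm (b x - smear (\<lambda>y. y) b (gaussian \<epsilon>) x)) \<le> D * \<epsilon>"
    using smear_ident_L1[OF a] smear_ident_L1[OF b] by blast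
  let ?a = "\<lambda>\<epsilon>. smear (\<lambda>y. y) a (gaussian \<epsilon>)" and ?b = "\<lambda>\<epsilon>. smear (\<lambda>y. y) b (gaussian \<epsilon>)"
  have "((\<lambda>\<epsilon>. L1_form M (?a \<epsilon>) (?b \<epsilon>) - L1_form M a b) \<longlongrightarrow> 0) (at_right 0)"
  proof (rule L1_form_tendsto_zero_diff)
    fix \<epsilon> :: real assume \<epsilon>: "0 < \<epsilon>"
    show "integrable lborel (?a \<epsilon>)" "integrable lborel (?b \<epsilon>)"
      by (rule integrable_smear[OF ai integrable_gaussian[OF \<epsilon>] id], rule integrable_smear[OF bi integrable_gaussian[OF \<epsilon>] id])
    have "C * \<epsilon> \<le> max C D * \<epsilon>" "D * \<epsilon> \<le> max C D * \<epsilon>" using \<epsilon> by (auto intro: mult_right_mono)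
    then show "(LINT x|lborel. norm (?a \<epsilon> x - a x)) \<le> max C D * \<epsilon>" "(LINT x|lborel. norm (?b \<epsilon> x - b x)) \<le> max C D * \<epsilon>"
      using C(2)[OF \<epsilon>] D(2)[OF \<epsilon>] by (simp_all add: norm_minus_commute)
    show "(LINT x|lborel. norm (a x)) \<le> max (LINT x|lborel. norm (a x)) (LINT x|lborel. norm (b x))"
      "(LINT x|lborel. norm (b x)) \<le> max (LINT x|lborel. norm (a x)) (LINT x|lborel. norm (b x))" by auto
  qed (use ai bi C(1) in \<open>auto simp: le_max_iff_disj\<close>)
  then have "((\<lambda>\<epsilon>. L1_form M (?a \<epsilon>) (?b \<epsilon>)) \<longlongrightarrow> L1_form M a b) (at_right 0)" by (simp add: LIM_zero_iff)
  then have "has_form M (push_dist (\<lambda>y. y) a) (push_dist (\<lambda>y. y) b) (L1_form M a b)"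
    unfolding has_form_push_dist[OF ai id bi id] .
  then show ?thesis unfolding push_dist_ident[OF a] push_dist_ident[OF b]
    by (rule dist_form_eqI[OF ai id bi id])
qed

lemma M_mat_Schwartz:
  assumes "s \<in> Schwartz"
  shows "M_mat M (fun_dist s) $ i $ j = Re (L1_form M (\<lambda>x. of_real (x $ i) * s x) (\<lambda>x. of_real (x $ j) * s x))"
  unfolding M_mat_def by (simp add: coord_mult_fun_dist assms dist_form_Schwartz Schwartz_mult_coord)

text \<open>This links the eigenvalues of the matrix, which enter the anti-norm, to the form of the kernel.\<close>
lemma M_mat_quadratic:
  assumes s: "s \<in> Schwartz"
  shows "w \<bullet> (M_mat M (fun_dist s) *v w) = Re (L1_form M (\<lambda>x. of_real (w \<bullet> x) * s x) (\<lambda>x. of_real (w \<bullet> x) * s x))"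
proof -
  let ?a = "\<lambda>i x. of_real (x $ i) * s x"
  have e: "(\<lambda>x. of_real (w \<bullet> x) * s x) = (\<lambda>x. \<Sum>i\<in>UNIV. of_real (w $ i) * ?a i x)"
    by (rule ext) (simp add: inner_vec_def sum_distrib_right mult.assoc)
  have "L1_form M (\<lambda>x. of_real (w \<bullet> x) * s x) (\<lambda>x. of_real (w \<bullet> x) * s x)
     = (\<Sum>i\<in>UNIV. \<Sum>j\<in>UNIV. of_real (w $ i * w $ j) * L1_form M (?a i) (?a j))"
    unfolding e by (rule L1_form_sum) (intro integrable_Schwartz Schwartz_mult_coord s)+
  also have "Re \<dots> = (\<Sum>i\<in>UNIV. \<Sum>j\<in>UNIV. w $ i * w $ j * M_mat M (fun_dist s) $ i $ j)"
    by (simp add: M_mat_Schwartz[OF s])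
  also have "\<dots> = w \<bullet> (M_mat M (fun_dist s) *v w)"
    by (simp add: inner_vec_def matrix_vector_mult_def sum_distrib_left mult_ac)
  finally show ?thesis by simp
qed

end


section \<open>Proper kernels\<close>

lemma Schwartz_L2:
  assumes "s \<in> Schwartz" shows "s \<in> L2"
proof -
  note m = Schwartz_measurable[OF assms]
  have "integrable lborel (\<lambda>x. norm (s x * s x))"
    by (intro integrable_norm integrable_mult_Schwartz integrable_Schwartz assms)
  then have "integrable lborel (\<lambda>x. (norm (s x))\<^sup>2)" by (simp add: norm_mult power2_eq_square)
  then have "integrable lebesgue (\<lambda>x. (norm (s x))\<^sup>2)" using m by (subst integrable_completion) auto
  then show ?thesis using m by (simp add: L2_def measurable_completion)
qed

lemma L2_measurable: "f \<in> L2 \<Longrightarrow> f \<in> borel_measurable lebesgue"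
  by (simp add: L2_def)

lemma integrable_L2_inner:
  assumes f: "f \<in> L2" and g: "g \<in> L2" shows "integrable lebesgue (\<lambda>x. cnj (f x) * g x)"
proof (rule Bochner_Integration.integrable_bound)
  note [measurable] = L2_measurable[OF f] L2_measurable[OF g]
  show "integrable lebesgue (\<lambda>x. (norm (f x))\<^sup>2 + (norm (g x))\<^sup>2)" using f g by (simp add: L2_def)
  show "(\<lambda>x. cnj (f x) * g x) \<in> borel_measurable lebesgue" by measurable
  have "norm (cnj (f x) * g x) \<le> norm ((norm (f x))\<^sup>2 + (norm (g x))\<^sup>2)" for x
  proof -
    have "0 \<le> (norm (f x) - norm (g x))\<^sup>2" by simp
    then have "2 * (norm (f x) * norm (g x)) \<le> (norm (f x))\<^sup>2 + (norm (g x))\<^sup>2" by (simp add: power2_diff)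
    moreover have "0 \<le> norm (f x) * norm (g x)" by simp
    ultimately have "norm (f x) * norm (g x) \<le> (norm (f x))\<^sup>2 + (norm (g x))\<^sup>2" by linarith
    then show ?thesis by (simp add: norm_mult)
  qed
  then show "AE x in lebesgue. norm (cnj (f x) * g x) \<le> norm ((norm (f x))\<^sup>2 + (norm (g x))\<^sup>2)" by simp
qed

lemma L2_add_cmult:
  assumes f: "f \<in> L2" and g: "g \<in> L2" shows "(\<lambda>x. f x + c * g x) \<in> L2"
proof -
  note [measurable] = L2_measurable[OF f] L2_measurable[OF g]
  have "integrable lebesgue (\<lambda>x. (norm (f x + c * g x))\<^sup>2)"
  proof (rule Bochner_Integration.integrable_bound)
    show "integrable lebesgue (\<lambda>x. 2 * (norm (f x))\<^sup>2 + 2 * (norm c)\<^sup>2 * (norm (g x))\<^sup>2)" using f g by (simp add: L2_def)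
    show "(\<lambda>x. (norm (f x + c * g x))\<^sup>2) \<in> borel_measurable lebesgue" by measurable
    have "(norm (f x + c * g x))\<^sup>2 \<le> 2 * (norm (f x))\<^sup>2 + 2 * (norm c)\<^sup>2 * (norm (g x))\<^sup>2" for x
    proof -
      let ?u = "norm (f x)" and ?v = "norm c * norm (g x)"
      have "norm (f x + c * g x) \<le> ?u + ?v" by (rule order_trans[OF norm_triangle_ineq]) (simp add: norm_mult)
      then have "(norm (f x + c * g x))\<^sup>2 \<le> (?u + ?v)\<^sup>2" by (rule power_mono) simp
      also have "\<dots> \<le> 2 * ?u\<^sup>2 + 2 * ?v\<^sup>2"
      proof -
        have "0 \<le> (?u - ?v)\<^sup>2" by simp
        then show ?thesis by (simp add: power2_diff power2_sum)
      qed
      finally show ?thesis by (simp add: power_mult_distrib)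
    qed
    then show "AE x in lebesgue. norm ((norm (f x + c * g x))\<^sup>2) \<le> norm (2 * (norm (f x))\<^sup>2 + 2 * (norm c)\<^sup>2 * (norm (g x))\<^sup>2)"
      by (intro AE_I2 norm_le_norm_real) auto
  qed
  then show ?thesis by (simp add: L2_def)
qed

locale proper_bounded_kernel = bounded_kernel +
  assumes proper: "proper_kernel M"
begin

lemma kernel_op_L2: "f \<in> L2 \<Longrightarrow> kernel_op M f \<in> L2"
  using proper unfolding proper_kernel_def by blast

lemma kernel_op_add_cmult:
  assumes f: "f \<in> L2" and g: "g \<in> L2"
  shows "AE x in lebesgue. kernel_op M (\<lambda>y. f y + c * g y) x = kernel_op M f x + c * kernel_op M g x"
proof -
  have "AE x in lebesgue. integrable lebesgue (\<lambda>y. M (x, y) * f y)" "AE x in lebesgue. integrable lebesgue (\<lambda>y. M (x, y) * g y)"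
    using proper f g unfolding proper_kernel_def by blast+
  then show ?thesis
    by eventually_elim (simp add: kernel_op_def distrib_left mult.left_commute)
qed

lemma L2_inner_add_cmult:
  assumes "f \<in> L2" "g \<in> L2" "h \<in> L2"
  shows "L2_inner (\<lambda>x. f x + c * g x) h = L2_inner f h + cnj c * L2_inner g h"
  using integrable_L2_inner[OF assms(1,3)] integrable_L2_inner[OF assms(2,3)]
  by (simp add: L2_inner_def distrib_right mult.assoc)

lemma L2_inner_kernel_add_cmult:
  assumes "f \<in> L2" "g \<in> L2" "h \<in> L2"
  shows "L2_inner h (kernel_op M (\<lambda>x. f x + c * g x)) = L2_inner h (kernel_op M f) + c * L2_inner h (kernel_op M g)"
proof -
  note [measurable] = L2_measurable[OF assms(3)] L2_measurable[OF kernel_op_L2[OF assms(1)]] L2_measurable[OF kernel_op_L2[OF assms(2)]]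
    L2_measurable[OF kernel_op_L2[OF L2_add_cmult[OF assms(1,2)], of c]]
  have "L2_inner h (kernel_op M (\<lambda>x. f x + c * g x)) = (LINT x|lebesgue. cnj (h x) * kernel_op M f x + c * (cnj (h x) * kernel_op M g x))"
    unfolding L2_inner_def
  proof (rule integral_cong_AE)
    show "AE x in lebesgue. cnj (h x) * kernel_op M (\<lambda>x. f x + c * g x) x = cnj (h x) * kernel_op M f x + c * (cnj (h x) * kernel_op M g x)"
      using kernel_op_add_cmult[OF assms(1,2), of c] by eventually_elim (simp add: algebra_simps)
  qed measurable
  also have "\<dots> = L2_inner h (kernel_op M f) + c * L2_inner h (kernel_op M g)"
    using integrable_L2_inner[OF assms(3) kernel_op_L2[OF assms(1)]] integrable_L2_inner[OF assms(3) kernel_op_L2[OF assms(2)]]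
    by (simp add: L2_inner_def)
  finally show ?thesis .
qed

lemma L2_form_hermitian:
  assumes "f \<in> L2" "g \<in> L2"
  shows "L2_inner f (kernel_op M g) = cnj (L2_inner g (kernel_op M f))"
proof -
  have "L2_inner f (kernel_op M g) = L2_inner (kernel_op M f) g"
    using proper assms unfolding proper_kernel_def by simp
  also have "\<dots> = cnj (L2_inner g (kernel_op M f))"
    unfolding L2_inner_def by (subst Bochner_Integration.integral_cnj[symmetric]) (simp add: mult.commute)
  finally show ?thesis .
qed

lemma L2_form_nonneg:
  assumes f: "f \<in> L2"
  obtains r where "0 \<le> r" "L2_inner f (kernel_op M f) = of_real r"
proof (cases "AE x in lebesgue. f x = 0")
  case True
  note [measurable] = L2_measurable[OF f] L2_measurable[OF kernel_op_L2[OF f]]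
  have "L2_inner f (kernel_op M f) = (LINT x|(lebesgue :: (real^'a) measure). 0)"
    unfolding L2_inner_def
  proof (rule integral_cong_AE)
    show "AE x in lebesgue. cnj (f x) * kernel_op M f x = 0" using True by eventually_elim simp
  qed measurable
  then show ?thesis using that[of 0] by simp
next
  case False
  then obtain r where "r > 0" "L2_inner f (kernel_op M f) = of_real r"
    using proper f unfolding proper_kernel_def by blast
  then show ?thesis using that[of r] by simp
qed

text \<open>The constant may depend on \<open>q\<close> arbitrarily. Allowing \<open>C + 1\<close> instead of the optimal \<open>C\<close> avoids the
case distinction whether the form vanishes at \<open>q\<close>.\<close>
lemma L2_form_Cauchy_Schwarz:
  assumes q: "q \<in> L2"
  shows "\<exists>C\<ge>0. \<forall>f\<in>L2. (norm (L2_inner f (kernel_op M q)))\<^sup>2 \<le> C * Re (L2_inner f (kernel_op M f))"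
proof -
  obtain C where C: "0 \<le> C" "L2_inner q (kernel_op M q) = of_real C" using L2_form_nonneg[OF q] by blast
  have "(norm (L2_inner f (kernel_op M q)))\<^sup>2 \<le> (C + 1) * Re (L2_inner f (kernel_op M f))" if f: "f \<in> L2" for f
  proof -
    define z where "z = L2_inner f (kernel_op M q)"
    define \<alpha> where "\<alpha> = Re (L2_inner f (kernel_op M f))"
    \<comment> \<open>the minimizing multiple of \<open>q\<close>, with \<open>C + 1\<close> in place of \<open>C\<close>\<close>
    define c where "c = - (of_real (1 / (C + 1))) * cnj z"
    have zq: "L2_inner q (kernel_op M f) = cnj z" unfolding z_def by (rule L2_form_hermitian[OF q f])
    note fq = L2_add_cmult[OF f q, of c]
    obtain r where r: "0 \<le> r" "L2_inner (\<lambda>x. f x + c * q x) (kernel_op M (\<lambda>x. f x + c * q x)) = of_real r"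
      using L2_form_nonneg[OF fq] by blast
    have "L2_inner (\<lambda>x. f x + c * q x) (kernel_op M (\<lambda>x. f x + c * q x))
      = L2_inner f (kernel_op M f) + c * z + cnj c * (cnj z + c * of_real C)"
      by (simp add: L2_inner_add_cmult[OF f q kernel_op_L2[OF fq]] L2_inner_kernel_add_cmult f q zq C(2) z_def)
    also have "Re \<dots> = \<alpha> - 2 * (norm z)\<^sup>2 / (C + 1) + (norm z)\<^sup>2 * C / (C + 1)\<^sup>2"
    proof -
      have zz: "cnj z * z = of_real ((norm z)\<^sup>2)" "z * cnj z = of_real ((norm z)\<^sup>2)"
        by (simp_all only: complex_norm_square mult.commute)
      have "c * z = of_real (- (norm z)\<^sup>2 / (C + 1))" unfolding c_def mult.assoc zz by simp
      moreover have "cnj c * cnj z = of_real (- (norm z)\<^sup>2 / (C + 1))"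
        using arg_cong[OF calculation, of cnj] by simp
      moreover have "cnj c * (c * of_real C) = of_real ((norm z)\<^sup>2 * C / (C + 1)\<^sup>2)"
      proof -
        have "cnj c * (c * of_real C) = of_real ((1 / (C + 1)) * (1 / (C + 1)) * C) * (z * cnj z)"
          by (simp add: c_def)
        then show ?thesis unfolding zz by (simp add: power2_eq_square)
      qed
      ultimately show ?thesis by (simp add: distrib_left \<alpha>_def)
    qed
    finally have "0 \<le> \<alpha> - 2 * (norm z)\<^sup>2 / (C + 1) + (norm z)\<^sup>2 * C / (C + 1)\<^sup>2" using r by simp
    moreover have "(norm z)\<^sup>2 * C / (C + 1)\<^sup>2 \<le> (norm z)\<^sup>2 / (C + 1)"
    proof -
      have "(norm z)\<^sup>2 * C \<le> (norm z)\<^sup>2 * (C + 1)" by (rule mult_left_mono) auto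
      then show ?thesis using C(1) by (simp add: power2_eq_square divide_simps)
    qed
    ultimately have "(norm z)\<^sup>2 / (C + 1) \<le> \<alpha>" by simp
    then show ?thesis using C(1) by (simp add: z_def \<alpha>_def pos_divide_le_eq mult.commute)
  qed
  then show ?thesis using C(1) by (intro exI[of _ "C + 1"]) auto
qed

lemma L1_form_Schwartz:
  "a \<in> Schwartz \<Longrightarrow> b \<in> Schwartz \<Longrightarrow> L1_form M a b = L2_inner a (kernel_op M b)"
  by (intro L1_form_eq_L2_inner integrable_Schwartz)

lemma M_mat_symmetric:
  assumes s: "s \<in> Schwartz" shows "transpose (M_mat M (fun_dist s)) = M_mat M (fun_dist s)"
proof -
  have "M_mat M (fun_dist s) $ j $ i = M_mat M (fun_dist s) $ i $ j" for i j
    using L2_form_hermitian[OF Schwartz_L2[OF Schwartz_mult_coord[OF s, of i]] Schwartz_L2[OF Schwartz_mult_coord[OF s, of j]]]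
    by (simp add: M_mat_Schwartz[OF s] L1_form_Schwartz Schwartz_mult_coord s)
  then show ?thesis by (simp add: transpose_def vec_eq_iff)
qed

lemma Schwartz_mult_inner:
  fixes w :: "real^'n::finite"
  assumes s: "s \<in> Schwartz" shows "(\<lambda>x. of_real (w \<bullet> x) * s x) \<in> Schwartz"
proof -
  have "(\<lambda>x. of_real (w \<bullet> x) * s x) = (\<lambda>x. \<Sum>i\<in>UNIV. of_real (w $ i) * (of_real (x $ i) * s x))"
    by (rule ext) (simp add: inner_vec_def sum_distrib_right mult.assoc)
  then show ?thesis using Schwartz_sum[of UNIV "\<lambda>i x. of_real (w $ i) * (of_real (x $ i) * s x)"]
    by (simp add: Schwartz_cmult Schwartz_mult_coord s)
qed

lemma M_mat_nonneg:
  assumes s: "s \<in> Schwartz" shows "0 \<le> w \<bullet> (M_mat M (fun_dist s) *v w)"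
proof -
  note ws = Schwartz_mult_inner[OF s, of w]
  obtain r where "0 \<le> r" "L2_inner (\<lambda>x. of_real (w \<bullet> x) * s x) (kernel_op M (\<lambda>x. of_real (w \<bullet> x) * s x)) = of_real r"
    using L2_form_nonneg[OF Schwartz_L2[OF ws]] by blast
  then show ?thesis unfolding M_mat_quadratic[OF s] L1_form_Schwartz[OF ws ws] by simp
qed

lemma ky_fan_M_mat_nonneg:
  fixes S :: "'a set"
  assumes s: "s \<in> Schwartz" shows "0 \<le> ky_fan_antinorm (card S) (M_mat M (fun_dist s))"
proof -
  obtain U where "orthogonal_matrix U" "ky_fan_antinorm (card S) (M_mat M (fun_dist s)) = (\<Sum>j\<in>S. row j U \<bullet> (M_mat M (fun_dist s) *v row j U))"
    using ky_fan_attained[OF M_mat_symmetric[OF s]] by blast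
  then show ?thesis by (simp add: sum_nonneg M_mat_nonneg[OF s])
qed

lemma trace_M_mat_nonneg:
  assumes s: "s \<in> Schwartz" shows "0 \<le> trace (M_mat M (fun_dist s))"
proof -
  have "axis i 1 \<bullet> (M_mat M (fun_dist s) *v axis i 1) = M_mat M (fun_dist s) $ i $ i" for i
    by (simp add: inner_axis' matrix_vector_mult_basis column_def)
  then show ?thesis unfolding trace_def using M_mat_nonneg[OF s] by (metis (no_types, lifting) sum_nonneg)
qed

lemma ky_fan_M_mat_zero:
  fixes S :: "'a set"
  shows "ky_fan_antinorm (card S) (M_mat M (fun_dist (\<lambda>x. 0))) = 0"
proof -
  have "L1_form M (\<lambda>x. 0) (\<lambda>x. 0) = 0" using L1_form_bound[of "\<lambda>_. 0" "\<lambda>_. 0"] by simp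
  then have "M_mat M (fun_dist (\<lambda>x. 0)) = 0"
    by (simp add: vec_eq_iff M_mat_Schwartz[OF Schwartz_zero])
  moreover obtain U where "orthogonal_matrix U" "ky_fan_antinorm (card S) (M_mat M (fun_dist (\<lambda>x. 0)))
      = (\<Sum>j\<in>S. row j U \<bullet> (M_mat M (fun_dist (\<lambda>x. 0)) *v row j U))"
    using ky_fan_attained[OF M_mat_symmetric[OF Schwartz_zero]] by blast
  ultimately show ?thesis by simp
qed

end

section \<open>Weak limits along which the anti-norm vanishes\<close>

lemma weak_conv_iff:
  "weak_conv h T \<longleftrightarrow> T \<in> tempered \<and> (\<forall>\<^sub>F i in sequentially. h i \<in> tempered) \<and> (\<forall>\<phi>\<in>Schwartz. (\<lambda>i. h i \<phi>) \<longlonglongrightarrow> T \<phi>)"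
proof -
  have te: "tempered \<subseteq> extensional Schwartz" by (auto simp: tempered_def)
  have e: "\<forall>\<^sub>F i in sequentially. h i \<in> extensional Schwartz" if "\<forall>\<^sub>F i in sequentially. h i \<in> tempered"
    using that by (rule eventually_mono) (use te in auto)
  show ?thesis
    unfolding weak_conv_def weak_topology_def limitin_subtopology limitin_componentwise
    using e te by (auto simp: PiE_UNIV_domain topspace_product_topology PiE_def)
qed

lemma orthogonal_matrices_convergent_subsequence:
  fixes U :: "nat \<Rightarrow> real^'n::finite^'n"
  assumes U: "\<And>i. orthogonal_matrix (U i)"
  obtains r V where "strict_mono r" "orthogonal_matrix V" "\<And>j l. (\<lambda>i. U (r i) $ j $ l) \<longlonglongrightarrow> V $ j $ l"
proof -
  have "norm (U i) \<le> CARD('n)" for i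
  proof -
    have "norm (U i $ j) = 1" for j
      using U[of i] unfolding orthogonal_matrix_orthonormal_rows by (simp add: row_def)
    then show ?thesis using norm_le_l1_cart order_trans L2_set_le_sum[of UNIV "\<lambda>j. norm (U i $ j)"]
      by (simp add: norm_vec_def)
  qed
  then have "bounded (range U)" by (auto simp: bounded_iff)
  then obtain V r where r: "strict_mono r" and lim: "(U \<circ> r) \<longlonglongrightarrow> V"
    using bounded_imp_convergent_subsequence by blast
  have c: "(\<lambda>i. U (r i) $ j $ l) \<longlonglongrightarrow> V $ j $ l" for j l
    using lim by (auto simp: o_def intro: tendsto_vec_nth)
  have "V ** transpose V = mat 1"
  proof -
    have "(\<lambda>i. (U (r i) ** transpose (U (r i))) $ j $ l) \<longlonglongrightarrow> (V ** transpose V) $ j $ l" for j l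
      unfolding matrix_matrix_mult_def transpose_def by (auto intro!: tendsto_intros c)
    moreover have "(U (r i) ** transpose (U (r i))) $ j $ l = mat 1 $ j $ l" for i j l
      using U[of "r i"] by (simp add: orthogonal_matrix_def)
    ultimately have "(V ** transpose V) $ j $ l = mat 1 $ j $ l" for j l
      by (simp add: LIMSEQ_const_iff)
    then show ?thesis by (simp add: vec_eq_iff)
  qed
  then have "orthogonal_matrix (transpose V)" unfolding orthogonal_matrix by simp
  then have "orthogonal_matrix V" by (metis orthogonal_matrix_transpose)
  with r c show ?thesis using that by blast
qed

lemma fun_dist_mult_inner:
  assumes s: "s \<in> Schwartz" and \<phi>: "\<phi> \<in> Schwartz"
  shows "(LINT x|lborel. of_real (w \<bullet> x) * s x * \<phi> x) = (\<Sum>l\<in>UNIV. of_real (w $ l) * fun_dist s (\<lambda>x. of_real (x $ l) * \<phi> x))"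
proof -
  have "(LINT x|lborel. of_real (w \<bullet> x) * s x * \<phi> x) = (LINT x|lborel. (\<Sum>l\<in>UNIV. of_real (w $ l) * (s x * (of_real (x $ l) * \<phi> x))))"
    by (intro Bochner_Integration.integral_cong refl) (simp add: inner_vec_def sum_distrib_right sum_distrib_left mult_ac)
  also have "\<dots> = (\<Sum>l\<in>UNIV. of_real (w $ l) * (LINT x|lborel. s x * (of_real (x $ l) * \<phi> x)))"
    by (simp add: Bochner_Integration.integral_sum integrable_mult_Schwartz[OF integrable_Schwartz[OF s] Schwartz_mult_coord[OF \<phi>]])
  finally show ?thesis by (simp add: fun_dist_lborel[OF Schwartz_measurable[OF s]] Schwartz_mult_coord[OF \<phi>])
qed

context proper_bounded_kernel
begin

text \<open>The form bounds the pairing of \<open>a i\<close> with \<open>\<psi> = kernel_op M q\<close> in \<open>L2\<close>. The \<open>L2\<close> product conjugates one factor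
and the action of a distribution does not, hence the conjugate of \<open>\<psi>\<close>.\<close>
lemma tendsto_zero_on_range:
  assumes q: "q \<in> L2" and \<psi>: "\<psi> \<in> Schwartz" and AE: "AE x in lebesgue. kernel_op M q x = \<psi> x"
    and a: "\<And>i. a i \<in> Schwartz" and lim: "(\<lambda>i. Re (L1_form M (a i) (a i))) \<longlonglongrightarrow> 0"
  shows "(\<lambda>i. LINT x|lborel. a i x * cnj (\<psi> x)) \<longlonglongrightarrow> 0"
proof -
  obtain C where C: "0 \<le> C" "\<And>f. f \<in> L2 \<Longrightarrow> (norm (L2_inner f (kernel_op M q)))\<^sup>2 \<le> C * Re (L2_inner f (kernel_op M f))"
    using L2_form_Cauchy_Schwarz[OF q] by blast
  have e: "L2_inner (a i) (kernel_op M q) = cnj (LINT x|lborel. a i x * cnj (\<psi> x))" for i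
  proof -
    note m = Schwartz_measurable[OF a[of i]] Schwartz_measurable[OF \<psi>]
    have [measurable]: "a i \<in> borel_measurable borel" "\<psi> \<in> borel_measurable borel" by (rule m)+
    have "L2_inner (a i) (kernel_op M q) = (LINT x|lborel. cnj (a i x) * \<psi> x)"
      unfolding L2_inner_def
    proof (rule lebesgue_integral_cong_borel(1))
      show "(\<lambda>x. cnj (a i x) * \<psi> x) \<in> borel_measurable borel" by measurable
      show "AE x in lebesgue. cnj (a i x) * kernel_op M q x = cnj (a i x) * \<psi> x"
        using AE by eventually_elim simp
    qed
    also have "\<dots> = cnj (LINT x|lborel. a i x * cnj (\<psi> x))"
      by (subst Bochner_Integration.integral_cnj[symmetric]) simp
    finally show ?thesis .
  qed
  have le: "(norm (LINT x|lborel. a i x * cnj (\<psi> x)))\<^sup>2 \<le> C * Re (L1_form M (a i) (a i))" for i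
    using C(2)[OF Schwartz_L2[OF a[of i]]] unfolding e L1_form_Schwartz[OF a a] by simp
  have "(\<lambda>i. (norm (LINT x|lborel. a i x * cnj (\<psi> x)))\<^sup>2) \<longlonglongrightarrow> 0"
    by (rule Lim_null_comparison[OF _ tendsto_mult_right_zero[OF lim, of C]], rule always_eventually, rule allI) (simp add: le)
  from tendsto_real_sqrt[OF this] show ?thesis by (simp add: tendsto_norm_zero_iff)
qed

text \<open>Along a subsequence of the Ky Fan matrices \<open>U i\<close> the annihilating directions converge. The limit \<open>T\<close>, multiplied by such a
direction, vanishes on the conjugates of the range of the kernel operator. This set is dense, and \<open>T\<close> itself is
continuous, so it vanishes everywhere.\<close>
theorem weak_limit_in_G_tempered:
  fixes \<iota> :: "'k::finite \<Rightarrow> 'a"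
  assumes \<iota>: "inj \<iota>" and h: "\<And>i. h i \<in> Schwartz" and T: "weak_conv (\<lambda>i. fun_dist (h i)) T"
    and R: "(\<lambda>i. ky_fan_antinorm (CARD('a) - CARD('k)) (M_mat M (fun_dist (h i)))) \<longlonglongrightarrow> 0"
  shows "T \<in> G_tempered \<iota>"
proof -
  define S where "S = - range \<iota>"
  have S: "card S = CARD('a) - CARD('k)"
    using card_image[OF \<iota>] by (simp add: S_def Compl_eq_Diff_UNIV card_Diff_subset)
  let ?A = "\<lambda>i. M_mat M (fun_dist (h i))"
  have "\<exists>U. orthogonal_matrix U \<and> ky_fan_antinorm (card S) (?A i) = (\<Sum>j\<in>S. row j U \<bullet> (?A i *v row j U))" for i
    using ky_fan_attained[OF M_mat_symmetric[OF h], of S i] by blast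
  then obtain U where U: "\<And>i. orthogonal_matrix (U i)"
    "\<And>i. ky_fan_antinorm (card S) (?A i) = (\<Sum>j\<in>S. row j (U i) \<bullet> (?A i *v row j (U i)))" by metis
  have form0: "(\<lambda>i. row j (U i) \<bullet> (?A i *v row j (U i))) \<longlonglongrightarrow> 0" if j: "j \<in> S" for j
  proof (rule tendsto_sandwich[OF _ _ tendsto_const R])
    show "\<forall>\<^sub>F i in sequentially. 0 \<le> row j (U i) \<bullet> (?A i *v row j (U i))"
      by (simp add: M_mat_nonneg[OF h])
    have "row j (U i) \<bullet> (?A i *v row j (U i)) \<le> ky_fan_antinorm (card S) (?A i)" for i
      unfolding U(2) using j by (intro member_le_sum) (auto simp: M_mat_nonneg[OF h])
    then show "\<forall>\<^sub>F i in sequentially. row j (U i) \<bullet> (?A i *v row j (U i)) \<le> ky_fan_antinorm (CARD('a) - CARD('k)) (?A i)"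
      by (simp add: S)
  qed
  obtain r V where r: "strict_mono r" and V: "orthogonal_matrix V" and lim: "\<And>j l. (\<lambda>i. U (r i) $ j $ l) \<longlonglongrightarrow> V $ j $ l"
    by (rule orthogonal_matrices_convergent_subsequence[OF U(1)]) (rule that)
  have T': "T \<in> tempered" and Tlim: "\<And>\<phi>. \<phi> \<in> Schwartz \<Longrightarrow> (\<lambda>i. fun_dist (h i) \<phi>) \<longlonglongrightarrow> T \<phi>"
    using T unfolding weak_conv_iff by auto
  have TV: "T (\<lambda>x. of_real ((V *v x) $ j) * \<phi> x) = (\<Sum>l\<in>UNIV. of_real (V $ j $ l) * T (\<lambda>x. of_real (x $ l) * \<phi> x))"
    if \<phi>: "\<phi> \<in> Schwartz" for \<phi> j
  proof -
    have "(\<lambda>x. of_real ((V *v x) $ j) * \<phi> x) = (\<lambda>x. \<Sum>l\<in>UNIV. of_real (V $ j $ l) * (of_real (x $ l) * \<phi> x))"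
      by (rule ext) (simp add: matrix_vector_mult_def sum_distrib_right mult.assoc)
    then show ?thesis
      by (simp add: tempered_sum[OF T'] tempered_cmult[OF T'] Schwartz_cmult Schwartz_mult_coord \<phi>)
  qed
  show ?thesis
  proof (rule G_temperedI[OF \<iota> T' V])
    fix j and \<phi> :: "real^'a \<Rightarrow> complex" assume j: "j \<notin> range \<iota>" and \<phi>: "\<phi> \<in> Schwartz"
    let ?m = "\<lambda>x. complex_of_real ((V *v x) $ j)"
    define Z where "Z = {\<psi> \<in> topspace schwartz_topology. (T \<circ> ((\<lambda>\<psi> x. ?m x * \<psi> x) \<circ> (\<lambda>\<psi> x. cnj (\<psi> x)))) \<psi> \<in> {0}}"
    have "schwartz_along (\<lambda>x :: real^'a. x) ?m"
      by (rule schwartz_along_poly[where c = 1])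
         (auto intro!: real_polynomial_function.intros(1) bounded_linear_compose[OF bounded_linear_vec_nth bounded_linear_matrix_mult])
    from continuous_map_mult_comp[OF this bounded_linear_ident]
    have "continuous_map schwartz_topology euclidean (T \<circ> ((\<lambda>\<psi> x. ?m x * \<psi> x) \<circ> (\<lambda>\<psi> x. cnj (\<psi> x))))"
      by (intro continuous_map_compose[OF continuous_map_compose[OF continuous_map_schwartz_cnj] tempered_continuous[OF T']])
    then have "closedin schwartz_topology Z"
      unfolding Z_def by (rule closedin_continuous_map_preimage) simp
    moreover have "{\<psi> \<in> Schwartz. \<exists>f\<in>L2. AE x in lebesgue. kernel_op M f x = \<psi> x} \<subseteq> Z"
    proof safe
      fix \<psi> q assume \<psi>: "\<psi> \<in> Schwartz" and q: "q \<in> L2" "AE x in lebesgue. kernel_op M q x = \<psi> x"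
      note c\<psi> = Schwartz_cnj[OF \<psi>]
      let ?a = "\<lambda>i x. of_real (row j (U (r i)) \<bullet> x) * h (r i) x"
      have a: "?a i \<in> Schwartz" for i by (rule Schwartz_mult_inner[OF h])
      have "(\<lambda>i. Re (L1_form M (?a i) (?a i))) \<longlonglongrightarrow> 0"
        using LIMSEQ_subseq_LIMSEQ[OF form0 r, of j] j unfolding M_mat_quadratic[OF h] by (simp add: S_def o_def)
      from tendsto_zero_on_range[OF q(1) \<psi> q(2) a this]
      have "(\<lambda>i. \<Sum>l\<in>UNIV. of_real (U (r i) $ j $ l) * fun_dist (h (r i)) (\<lambda>x. of_real (x $ l) * cnj (\<psi> x))) \<longlonglongrightarrow> 0"
        by (simp add: fun_dist_mult_inner[OF h c\<psi>] row_def)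
      moreover have "(\<lambda>i. \<Sum>l\<in>UNIV. of_real (U (r i) $ j $ l) * fun_dist (h (r i)) (\<lambda>x. of_real (x $ l) * cnj (\<psi> x)))
         \<longlonglongrightarrow> (\<Sum>l\<in>UNIV. of_real (V $ j $ l) * T (\<lambda>x. of_real (x $ l) * cnj (\<psi> x)))"
        by (intro tendsto_sum tendsto_mult tendsto_of_real lim LIMSEQ_subseq_LIMSEQ[OF Tlim r, unfolded o_def] Schwartz_mult_coord c\<psi>)
      ultimately have "T (\<lambda>x. ?m x * cnj (\<psi> x)) = 0" unfolding TV[OF c\<psi>] by (rule LIMSEQ_unique[symmetric])
      then show "\<psi> \<in> Z" using \<psi> by (simp add: Z_def)
    qed
    ultimately have "schwartz_topology closure_of {\<psi> \<in> Schwartz. \<exists>f\<in>L2. AE x in lebesgue. kernel_op M f x = \<psi> x} \<subseteq> Z"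
      by (intro closure_of_minimal)
    moreover have "schwartz_topology closure_of {\<psi> \<in> Schwartz. \<exists>f\<in>L2. AE x in lebesgue. kernel_op M f x = \<psi> x} = Schwartz"
      using proper unfolding proper_kernel_def by blast
    ultimately have "(\<lambda>x. cnj (\<phi> x)) \<in> Z" using Schwartz_cnj[OF \<phi>] by blast
    then show "T (\<lambda>x. ?m x * \<phi> x) = 0" by (simp add: Z_def)
  qed
qed

end


section \<open>Approximating densities on subspaces by Schwartz functions\<close>

lemma rotate_tensor_delta_eq_push_dist:
  assumes \<iota>: "inj \<iota>" and U: "orthogonal_matrix U" and g: "g \<in> Schwartz"
  shows "rotate_dist U (tensor_delta \<iota> (fun_dist g)) = push_dist (\<lambda>y. transpose U *v embed \<iota> y) g"
proof -
  have tU: "orthogonal_matrix (transpose U)" using U by (simp add: orthogonal_matrix_transpose)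
  show ?thesis
    unfolding rotate_dist_def push_dist_def
  proof (rule restrict_ext)
    fix \<phi> :: "real^'b \<Rightarrow> complex" assume \<phi>: "\<phi> \<in> Schwartz"
    note 1 = Schwartz_comp_matrix[OF tU \<phi>]
    show "tensor_delta \<iota> (fun_dist g) (\<lambda>x. \<phi> (transpose U *v x)) = (LINT y|lborel. g y * \<phi> (transpose U *v embed \<iota> y))"
      unfolding tensor_delta_def fun_dist_lborel[OF Schwartz_measurable[OF g]]
      by (simp only: restrict_apply' 1 Schwartz_comp_embed[OF \<iota> 1] if_True)
  qed
qed

lemma coord_mult_push_dist:
  "coord_mult i (push_dist B a) = push_dist B (\<lambda>y. of_real (B y $ i) * a y)"
  unfolding coord_mult_def push_dist_def
  by (rule restrict_ext) (simp add: Schwartz_mult_coord, simp add: mult_ac)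

lemma smear_ident_uniform:
  fixes \<phi> :: "real^'n::finite \<Rightarrow> complex"
  assumes \<phi>: "\<phi> \<in> Schwartz" and L: "\<And>x y. norm (\<phi> x - \<phi> y) \<le> L * norm (x - y)" and \<epsilon>: "0 < \<epsilon>"
  shows "norm (smear (\<lambda>y. y) \<phi> (gaussian \<epsilon>) z - \<phi> z) \<le> L * (LINT u|lborel. norm (u :: real^'n) * gauss \<epsilon> u)"
proof -
  have "norm (smear (\<lambda>y. y) \<phi> (gaussian \<epsilon>) z - \<phi> z) \<le> (LINT y|lborel. L * (norm (z - y) * gauss \<epsilon> (z - y)))"
  proof (rule norm_smear_ident_diff_le[OF \<epsilon>])
    show "integrable lborel (\<lambda>y. \<phi> y * gaussian \<epsilon> (z - y))"
      using integrable_mult_Schwartz[OF integrable_gaussian_reflect[OF \<epsilon>, of z] \<phi>] by (simp add: mult.commute)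
    show "integrable lborel (\<lambda>y. L * (norm (z - y) * gauss \<epsilon> (z - y)))"
      by (intro integrable_mult_right integrable_moment_reflect[OF \<epsilon>])
    show "norm (\<phi> y - \<phi> z) * gauss \<epsilon> (z - y) \<le> L * (norm (z - y) * gauss \<epsilon> (z - y))" for y
      using mult_right_mono[OF L[of y z] gauss_nonneg] by (simp add: norm_minus_commute mult.assoc)
  qed
  then show ?thesis by (simp add: integral_moment_reflect[OF \<epsilon>])
qed

text \<open>The estimate depends on the test function only through its Lipschitz constant. The weak topology is not
metrizable, and this uniformity is what permits a diagonal choice along a sequence of densities.\<close>
lemma fun_dist_smear_close:
  fixes B :: "real^'k::finite \<Rightarrow> real^'n::finite"
  assumes a: "integrable lborel a" and B [measurable]: "B \<in> borel_measurable borel" and \<epsilon>: "0 < \<epsilon>"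
    and \<phi>: "\<phi> \<in> Schwartz" and L: "\<And>x y. norm (\<phi> x - \<phi> y) \<le> L * norm (x - y)"
  shows "norm (fun_dist (smear B a (gaussian \<epsilon>)) \<phi> - push_dist B a \<phi>)
    \<le> (LINT y|lborel. norm (a y)) * (L * (LINT u|lborel. norm (u :: real^'n) * gauss \<epsilon> u))"
proof -
  let ?h = "smear (\<lambda>y. y) \<phi> (gaussian \<epsilon>)"
  have h: "?h \<in> Schwartz" by (rule test_function_conv_gaussian(2)[OF \<phi> \<epsilon>])
  have [measurable]: "?h \<in> borel_measurable borel" "\<phi> \<in> borel_measurable borel" using h \<phi> by (auto intro: Schwartz_measurable)
  have i: "integrable lborel (\<lambda>y. a y * ?h (B y))" "integrable lborel (\<lambda>y. a y * \<phi> (B y))"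
    by (rule integrable_mult_bounded[OF a _ Schwartz_bounded[OF h]], simp)
       (rule integrable_mult_bounded[OF a _ Schwartz_bounded[OF \<phi>]], simp)
  have "fun_dist (smear B a (gaussian \<epsilon>)) \<phi> = push_dist B a ?h"
    unfolding dist_conv_push_dist[OF a B \<epsilon>, symmetric] dist_conv_def
    using \<phi> by (simp add: test_function_conv_gaussian(1)[OF \<phi> \<epsilon>])
  then have "fun_dist (smear B a (gaussian \<epsilon>)) \<phi> - push_dist B a \<phi> = (LINT y|lborel. a y * ?h (B y) - a y * \<phi> (B y))"
    using i h \<phi> by (simp add: push_dist_def)
  also have "norm \<dots> \<le> (LINT y|lborel. norm (a y) * (L * (LINT u|lborel. norm (u :: real^'n) * gauss \<epsilon> u)))"
  proof (rule norm_integral_le)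
    show "integrable lborel (\<lambda>y. a y * ?h (B y) - a y * \<phi> (B y))" using i by simp
    show "integrable lborel (\<lambda>y. norm (a y) * (L * (LINT u|lborel. norm (u :: real^'n) * gauss \<epsilon> u)))"
      using a by (intro integrable_mult_left integrable_norm)
    show "norm (a y * ?h (B y) - a y * \<phi> (B y)) \<le> norm (a y) * (L * (LINT u|lborel. norm (u :: real^'n) * gauss \<epsilon> u))" for y
      unfolding right_diff_distrib[symmetric] norm_mult by (intro mult_left_mono smear_ident_uniform[OF \<phi> L \<epsilon>]) auto
  qed
  finally show ?thesis by simp
qed

text \<open>Writing \<open>c \<bullet> x = c \<bullet> B y + c \<bullet> (x - B y)\<close> under the integral shows that the difference is the smearing with
the kernel \<open>(c \<bullet> u) * gaussian \<epsilon> u\<close>, whose \<open>L\<^sub>1\<close>-norm is at most \<open>norm c\<close> times the first moment.\<close>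
lemma inner_mult_smear:
  fixes B :: "real^'k::finite \<Rightarrow> real^'n::finite" and c :: "real^'n"
  assumes a: "integrable lborel a" and ca: "integrable lborel (\<lambda>y. of_real (c \<bullet> B y) * a y)"
    and B [measurable]: "B \<in> borel_measurable borel" and \<epsilon>: "0 < \<epsilon>"
  shows "(LINT x|lborel. norm (of_real (c \<bullet> x) * smear B a (gaussian \<epsilon>) x - smear B (\<lambda>y. of_real (c \<bullet> B y) * a y) (gaussian \<epsilon>) x))
    \<le> (LINT y|lborel. norm (a y)) * (norm c * (LINT u|lborel. norm (u :: real^'n) * gauss \<epsilon> u))"
proof -
  let ?k = "\<lambda>u. of_real (c \<bullet> u) * gaussian \<epsilon> u"
  have q: "integrable lborel (\<lambda>u :: real^'n. norm u * gauss \<epsilon> u)" using gauss_first_moment \<epsilon> by blast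
  have kle: "norm (?k u) \<le> norm c * (norm u * gauss \<epsilon> u)" for u
  proof -
    have "norm (?k u) = \<bar>c \<bullet> u\<bar> * gauss \<epsilon> u" by (simp add: norm_mult gaussian_eq_gauss gauss_nonneg)
    also have "\<dots> \<le> (norm c * norm u) * gauss \<epsilon> u" by (intro mult_right_mono Cauchy_Schwarz_ineq2 gauss_nonneg)
    finally show ?thesis by (simp add: mult.assoc)
  qed
  have k: "integrable lborel ?k"
  proof (rule Bochner_Integration.integrable_bound[OF integrable_mult_right[OF q, of "norm c"]])
    show "?k \<in> borel_measurable lborel" by measurable
    show "AE u in lborel. norm (?k u) \<le> norm (norm c * (norm (u :: real^'n) * gauss \<epsilon> u))"
      by (intro AE_I2 order_trans[OF kle]) (simp add: gauss_nonneg abs_mult)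
  qed
  have e: "of_real (c \<bullet> x) * smear B a (gaussian \<epsilon>) x - smear B (\<lambda>y. of_real (c \<bullet> B y) * a y) (gaussian \<epsilon>) x = smear B a ?k x" for x
  proof -
    have gm: "(\<lambda>y. gaussian \<epsilon> (x - B y)) \<in> borel_measurable lborel" by measurable
    note i = integrable_mult_bounded[OF a gm Schwartz_bounded[OF gaussian_Schwartz[OF \<epsilon>]]]
      integrable_mult_bounded[OF ca gm Schwartz_bounded[OF gaussian_Schwartz[OF \<epsilon>]]]
    have "smear B a ?k x = (LINT y|lborel. of_real (c \<bullet> x) * (a y * gaussian \<epsilon> (x - B y)) - of_real (c \<bullet> B y) * a y * gaussian \<epsilon> (x - B y))"
      unfolding smear_def by (intro Bochner_Integration.integral_cong refl) (simp add: inner_diff_right algebra_simps)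
    also have "\<dots> = (LINT y|lborel. of_real (c \<bullet> x) * (a y * gaussian \<epsilon> (x - B y))) - (LINT y|lborel. of_real (c \<bullet> B y) * a y * gaussian \<epsilon> (x - B y))"
      by (rule Bochner_Integration.integral_diff) (intro integrable_mult_right i)+
    finally show ?thesis by (simp add: smear_def)
  qed
  have "(LINT u|lborel. norm (?k u)) \<le> (LINT u|lborel. norm c * (norm (u :: real^'n) * gauss \<epsilon> u))"
  proof (rule integral_mono)
    show "integrable lborel (\<lambda>u. norm c * (norm (u :: real^'n) * gauss \<epsilon> u))" by (rule integrable_mult_right[OF q])
  qed (rule integrable_norm[OF k], rule kle)
  moreover have "0 \<le> (LINT y|lborel. norm (a y))" by (rule Bochner_Integration.integral_nonneg) simp
  ultimately have "(LINT y|lborel. norm (a y)) * (LINT u|lborel. norm (?k u))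
      \<le> (LINT y|lborel. norm (a y)) * (LINT u|lborel. norm c * (norm (u :: real^'n) * gauss \<epsilon> u))"
    by (rule mult_left_mono)
  with smear_L1[OF a k B]
  have "(LINT x|lborel. norm (smear B a ?k x)) \<le> (LINT y|lborel. norm (a y)) * (LINT u|lborel. norm c * (norm (u :: real^'n) * gauss \<epsilon> u))"
    by (rule order_trans)
  then show ?thesis unfolding e by simp
qed

context proper_bounded_kernel
begin

text \<open>The approximation is the smeared density. In a direction \<open>row j U\<close> with \<open>j\<close> outside the range of \<open>\<iota>\<close> the
linear function vanishes on the subspace, so by \<open>inner_mult_smear\<close> the corresponding form is \<open>O(\<epsilon>\<^sup>2)\<close>, and
Ky Fan's inequality bounds the anti-norm by these forms.\<close>
theorem G_schwartz_approx:
  fixes \<iota> :: "'k::finite \<Rightarrow> 'a"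
  assumes \<iota>: "inj \<iota>" and p: "p \<in> G_schwartz \<iota>" and def: "M_mat_defined M p" and \<delta>: "0 < \<delta>"
  shows "\<exists>s\<in>Schwartz. ky_fan_antinorm (CARD('a) - CARD('k)) (M_mat M (fun_dist s)) < \<delta> \<and>
    trace (M_mat M (fun_dist s)) < trace (M_mat M p) + \<delta> \<and>
    (\<forall>\<phi>\<in>Schwartz. \<forall>L\<ge>0. (\<forall>x y. norm (\<phi> x - \<phi> y) \<le> L * norm (x - y)) \<longrightarrow> norm (fun_dist s \<phi> - p \<phi>) \<le> L * \<delta>)"
proof -
  obtain g U where g: "g \<in> Schwartz" and U: "orthogonal_matrix U" and p_eq: "p = rotate_dist U (tensor_delta \<iota> (fun_dist g))"
    using p unfolding G_schwartz_def by blast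
  define B where "B = (\<lambda>y. transpose U *v embed \<iota> y)"
  have pB: "p = push_dist B g" unfolding p_eq B_def by (rule rotate_tensor_delta_eq_push_dist[OF \<iota> U g])
  have Bl: "bounded_linear B" unfolding B_def
    by (rule bounded_linear_compose[OF bounded_linear_matrix_mult bounded_linear_embed])
  have Bm: "B \<in> borel_measurable borel"
    by (intro borel_measurable_continuous_onI linear_continuous_on Bl)
  have gi: "integrable lborel g" by (rule integrable_Schwartz[OF g])
  have cg: "integrable lborel (\<lambda>y. of_real (c \<bullet> B y) * g y)" for c
  proof -
    have "schwartz_along (\<lambda>y :: real^'k. y) (\<lambda>y. of_real (c \<bullet> B y))"
      by (rule schwartz_along_poly[where c = 1])
         (auto intro!: real_polynomial_function.intros(1) bounded_linear_compose[OF bounded_linear_inner_right Bl])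
    from Schwartz_mult_comp(1)[OF this bounded_linear_ident g] show ?thesis by (rule integrable_Schwartz)
  qed
  define N where "N = (LINT y|lborel. norm (g y))"
  have N0: "0 \<le> N" unfolding N_def by (rule Bochner_Integration.integral_nonneg) simp
  obtain m where m: "0 \<le> m" "\<And>\<epsilon>. 0 < \<epsilon> \<Longrightarrow> (LINT x|lborel. norm (x :: real^'a) * gauss \<epsilon> x) \<le> m * \<epsilon>"
    using gauss_first_moment by blast
  define s where "s \<epsilon> = smear B g (gaussian \<epsilon>)" for \<epsilon>
  have s: "s \<epsilon> \<in> Schwartz" if "0 < \<epsilon>" for \<epsilon>
    unfolding s_def by (rule smear_Schwartz_Schwartz[OF gaussian_Schwartz[OF that] g Bl])
  have diff: "(LINT x|lborel. norm (of_real (c \<bullet> x) * s \<epsilon> x - smear B (\<lambda>y. of_real (c \<bullet> B y) * g y) (gaussian \<epsilon>) x)) \<le> (N * m) * \<epsilon>"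
    if \<epsilon>: "0 < \<epsilon>" and c: "norm c = 1" for \<epsilon> c
  proof -
    have "(LINT x|lborel. norm (of_real (c \<bullet> x) * s \<epsilon> x - smear B (\<lambda>y. of_real (c \<bullet> B y) * g y) (gaussian \<epsilon>) x))
      \<le> N * (norm c * (LINT x|lborel. norm (x :: real^'a) * gauss \<epsilon> x))"
      unfolding s_def N_def by (rule inner_mult_smear[OF gi cg Bm \<epsilon>])
    also have "\<dots> \<le> N * (m * \<epsilon>)" using m(2)[OF \<epsilon>] N0 c by (intro mult_left_mono) auto
    finally show ?thesis by (simp add: mult.assoc)
  qed
  define S where "S = - range \<iota>"
  have S: "card S = CARD('a) - CARD('k)"
    using card_image[OF \<iota>] by (simp add: S_def Compl_eq_Diff_UNIV card_Diff_subset)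
  have 1: "\<forall>\<^sub>F \<epsilon> in at_right 0. ky_fan_antinorm (CARD('a) - CARD('k)) (M_mat M (fun_dist (s \<epsilon>))) < \<delta>"
  proof -
    let ?b = "\<lambda>\<epsilon>. card S * (K * (N * m * \<epsilon>) * (N * m * \<epsilon>))"
    have le: "ky_fan_antinorm (card S) (M_mat M (fun_dist (s \<epsilon>))) \<le> ?b \<epsilon>" if \<epsilon>: "0 < \<epsilon>" for \<epsilon>
    proof -
      have "row j U \<bullet> (M_mat M (fun_dist (s \<epsilon>)) *v row j U) \<le> K * (N * m * \<epsilon>) * (N * m * \<epsilon>)" if j: "j \<in> S" for j
      proof -
        let ?a = "\<lambda>x. of_real (row j U \<bullet> x) * s \<epsilon> x"
        have "row j U \<bullet> B y = 0" for y
        proof -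
          have "row j U \<bullet> B y = (U *v B y) $ j" by (simp add: matrix_vector_mult_def row_def inner_vec_def)
          then show ?thesis using j embed_nth(2)[OF \<iota>, of j y]
            unfolding B_def orthogonal_matrix_mult_transpose[OF U] by (simp add: S_def)
        qed
        moreover have "norm (row j U) = 1" using U unfolding orthogonal_matrix_orthonormal_rows by blast
        ultimately have n: "(LINT x|lborel. norm (?a x)) \<le> N * m * \<epsilon>"
          using diff[OF \<epsilon>, of "row j U"] by (simp add: smear_def)
        have n0: "0 \<le> (LINT x|lborel. norm (?a x))" by (rule Bochner_Integration.integral_nonneg) simp
        have ai: "integrable lborel ?a" by (intro integrable_Schwartz Schwartz_mult_inner s \<epsilon>)
        have "row j U \<bullet> (M_mat M (fun_dist (s \<epsilon>)) *v row j U) \<le> norm (L1_form M ?a ?a)"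
          unfolding M_mat_quadratic[OF s[OF \<epsilon>]] by (rule complex_Re_le_cmod)
        also have "\<dots> \<le> K * (LINT x|lborel. norm (?a x)) * (LINT x|lborel. norm (?a x))" by (rule L1_form_bound[OF ai ai])
        also have "\<dots> \<le> K * (N * m * \<epsilon>) * (N * m * \<epsilon>)"
          using K_nonneg n n0 N0 m(1) \<epsilon> by (intro mult_mono) auto
        finally show ?thesis .
      qed
      then have "(\<Sum>j\<in>S. row j U \<bullet> (M_mat M (fun_dist (s \<epsilon>)) *v row j U)) \<le> (\<Sum>j\<in>S. K * (N * m * \<epsilon>) * (N * m * \<epsilon>))"
        by (rule sum_mono)
      also have "\<dots> = ?b \<epsilon>" by simp
      finally show ?thesis using ky_fan_le[OF M_mat_symmetric[OF s[OF \<epsilon>]] U, of S] by linarith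
    qed
    have "(?b \<longlongrightarrow> card S * (K * (N * m * 0) * (N * m * 0))) (at_right 0)" by (intro tendsto_intros)
    then have "\<forall>\<^sub>F \<epsilon> in at_right 0. ?b \<epsilon> < \<delta>" using \<delta> by (intro order_tendstoD(2)) auto
    moreover have "\<forall>\<^sub>F \<epsilon> in at_right (0::real). 0 < \<epsilon>" by (rule eventually_at_right_less)
    ultimately show ?thesis
    proof eventually_elim
      case (elim \<epsilon>)
      then show ?case using le[of \<epsilon>] unfolding S[symmetric] by linarith
    qed
  qed
  have 2: "\<forall>\<^sub>F \<epsilon> in at_right 0. trace (M_mat M (fun_dist (s \<epsilon>))) < trace (M_mat M p) + \<delta>"
  proof -
    have "((\<lambda>\<epsilon>. Re (L1_form M (\<lambda>x. of_real (x $ i) * s \<epsilon> x) (\<lambda>x. of_real (x $ i) * s \<epsilon> x))) \<longlongrightarrow> M_mat M p $ i $ i) (at_right 0)" for i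
    proof -
      let ?g = "\<lambda>y. of_real (B y $ i) * g y"
      let ?a = "\<lambda>\<epsilon>. smear B ?g (gaussian \<epsilon>)" and ?A = "\<lambda>\<epsilon> x. of_real (x $ i) * s \<epsilon> x"
      have gi': "integrable lborel ?g" using cg[of "axis i 1"] by (simp add: inner_axis')
      obtain c where c: "has_form M (coord_mult i p) (coord_mult i p) c" using def unfolding M_mat_defined_def by blast
      then have c': "has_form M (push_dist B ?g) (push_dist B ?g) c" unfolding pB coord_mult_push_dist .
      have Mc: "M_mat M p $ i $ i = Re c"
        unfolding M_mat_def pB coord_mult_push_dist by (simp add: dist_form_eqI[OF gi' Bm gi' Bm c'])
      have ai: "integrable lborel (?a \<epsilon>)" if "0 < \<epsilon>" for \<epsilon>
        by (rule integrable_smear[OF gi' integrable_gaussian[OF that] Bm])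
      have Ai: "integrable lborel (?A \<epsilon>)" if "0 < \<epsilon>" for \<epsilon>
        by (intro integrable_Schwartz Schwartz_mult_coord s that)
      have dA: "(LINT x|lborel. norm (?A \<epsilon> x - ?a \<epsilon> x)) \<le> (N * m) * \<epsilon>" if "0 < \<epsilon>" for \<epsilon>
        using diff[OF that, of "axis i 1"] by (simp add: inner_axis')
      have na: "(LINT x|lborel. norm (?a \<epsilon> x)) \<le> (LINT y|lborel. norm (?g y))" if "0 < \<epsilon>" for \<epsilon>
      proof -
        have "(LINT x|lborel. norm (gaussian \<epsilon> (x :: real^'a))) = 1"
          using integral_gauss[OF that] by (simp add: gaussian_eq_gauss gauss_nonneg)
        then show ?thesis using smear_L1[OF gi' integrable_gaussian[OF that] Bm] by simp
      qed
      have "((\<lambda>\<epsilon>. L1_form M (?A \<epsilon>) (?A \<epsilon>) - L1_form M (?a \<epsilon>) (?a \<epsilon>)) \<longlongrightarrow> 0) (at_right 0)"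
        by (rule L1_form_tendsto_zero_diff[where C = "N * m" and N = "LINT y|lborel. norm (?g y)"];
            (rule ai Ai dA na, assumption)?)
           (use N0 m(1) in \<open>auto intro!: Bochner_Integration.integral_nonneg\<close>)
      moreover have "((\<lambda>\<epsilon>. L1_form M (?a \<epsilon>) (?a \<epsilon>)) \<longlongrightarrow> c) (at_right 0)"
        using c' unfolding has_form_push_dist[OF gi' Bm gi' Bm] .
      ultimately have "((\<lambda>\<epsilon>. L1_form M (?A \<epsilon>) (?A \<epsilon>)) \<longlongrightarrow> 0 + c) (at_right 0)"
        using tendsto_add by fastforce
      then show ?thesis unfolding Mc by (intro tendsto_Re) simp
    qed
    then have "((\<lambda>\<epsilon>. \<Sum>i\<in>UNIV. Re (L1_form M (\<lambda>x. of_real (x $ i) * s \<epsilon> x) (\<lambda>x. of_real (x $ i) * s \<epsilon> x))) \<longlongrightarrow> trace (M_mat M p)) (at_right 0)"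
      unfolding trace_def by (intro tendsto_sum)
    then have "\<forall>\<^sub>F \<epsilon> in at_right 0. (\<Sum>i\<in>UNIV. Re (L1_form M (\<lambda>x. of_real (x $ i) * s \<epsilon> x) (\<lambda>x. of_real (x $ i) * s \<epsilon> x))) < trace (M_mat M p) + \<delta>"
      using \<delta> by (intro order_tendstoD(2)) auto
    moreover have "\<forall>\<^sub>F \<epsilon> in at_right (0::real). 0 < \<epsilon>" by (rule eventually_at_right_less)
    ultimately show ?thesis by eventually_elim (simp add: trace_def M_mat_Schwartz s)
  qed
  have 3: "\<forall>\<^sub>F \<epsilon> in at_right 0. N * (m * \<epsilon>) < \<delta>"
  proof -
    have "((\<lambda>\<epsilon>. N * (m * \<epsilon>)) \<longlongrightarrow> N * (m * 0)) (at_right 0)" by (intro tendsto_intros)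
    then show ?thesis using \<delta> by (intro order_tendstoD(2)) auto
  qed
  have "\<forall>\<^sub>F \<epsilon> in at_right 0. 0 < \<epsilon> \<and> N * (m * \<epsilon>) < \<delta> \<and> trace (M_mat M (fun_dist (s \<epsilon>))) < trace (M_mat M p) + \<delta> \<and>
      ky_fan_antinorm (CARD('a) - CARD('k)) (M_mat M (fun_dist (s \<epsilon>))) < \<delta>"
    using 1 2 3 by (intro eventually_conj eventually_at_right_less)
  from eventually_happens'[OF _ this] obtain \<epsilon> where \<epsilon>: "0 < \<epsilon>" "N * (m * \<epsilon>) < \<delta>"
    "trace (M_mat M (fun_dist (s \<epsilon>))) < trace (M_mat M p) + \<delta>"
    "ky_fan_antinorm (CARD('a) - CARD('k)) (M_mat M (fun_dist (s \<epsilon>))) < \<delta>" by auto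
  have "norm (fun_dist (s \<epsilon>) \<phi> - p \<phi>) \<le> L * \<delta>"
    if "\<phi> \<in> Schwartz" "0 \<le> L" "\<forall>x y. norm (\<phi> x - \<phi> y) \<le> L * norm (x - y)" for \<phi> L
  proof -
    have "norm (fun_dist (s \<epsilon>) \<phi> - p \<phi>) \<le> N * (L * (LINT u|lborel. norm (u :: real^'a) * gauss \<epsilon> u))"
      unfolding s_def pB N_def using that by (intro fun_dist_smear_close gi Bm \<epsilon>(1)) auto
    also have "\<dots> \<le> N * (L * (m * \<epsilon>))" using m(2)[OF \<epsilon>(1)] N0 that(2) by (intro mult_left_mono) auto
    also have "\<dots> = L * (N * (m * \<epsilon>))" by simp
    also have "\<dots> \<le> L * \<delta>" using \<epsilon>(2) that(2) by (intro mult_left_mono) auto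
    finally show ?thesis .
  qed
  with \<epsilon> s[OF \<epsilon>(1)] show ?thesis by blast
qed

end

lemma proper_kernel_imp_bounded:
  assumes "proper_kernel M" shows "\<exists>K. proper_bounded_kernel M K"
proof -
  from assms obtain K where "\<And>p. norm (M p) \<le> K" unfolding proper_kernel_def bounded_iff by auto
  with assms show ?thesis
    by (intro exI[of _ K] proper_bounded_kernel.intro bounded_kernel.intro proper_bounded_kernel_axioms.intro)
       (auto simp: proper_kernel_def)
qed

section \<open>Minimizers are regular solutions\<close>

theorem theorem6:
  fixes M :: "(real^'n::finite) \<times> (real^'n) \<Rightarrow> complex"
    and \<iota> :: "'k::finite \<Rightarrow> 'n"
    and I R :: "'n dist \<Rightarrow> real"
  assumes "inj \<iota>"
    and "proper_kernel M"
    and "R = (\<lambda>f. ky_fan_antinorm (CARD('n) - CARD('k)) (M_mat M f))"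
    and "\<forall>f \<in> G_tempered \<iota> \<union> fun_dist ` Schwartz. 0 \<le> I f"
    and "\<forall>s f. range s \<subseteq> Schwartz \<and> f \<in> G_tempered \<iota> \<and> weak_conv (\<lambda>i. fun_dist (s i)) f
           \<longrightarrow> (\<lambda>i. I (fun_dist (s i))) \<longlonglongrightarrow> I f"
    and "rsol M I R \<noteq> {}"
  shows "{f. is_arg_min I (\<lambda>f. f \<in> G_tempered \<iota>) f} \<inter> B_set M \<iota> \<subseteq> rsol M I R"
proof
  note \<iota> = assms(1) and Icont = assms(5)[rule_format]
  obtain K where "proper_bounded_kernel M K" using proper_kernel_imp_bounded[OF assms(2)] by blast
  then interpret proper_bounded_kernel M K .
  have cardS: "card (- range \<iota>) = CARD('n) - CARD('k)"
    using card_image[OF \<iota>] by (simp add: Compl_eq_Diff_UNIV card_Diff_subset)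
  have R0: "0 \<le> R (fun_dist s)" if "s \<in> Schwartz" for s
    using ky_fan_M_mat_nonneg[OF that, of "- range \<iota>"] by (simp add: assms(3) cardS)
  have Rzero: "R (fun_dist (\<lambda>x. 0)) = 0"
    using ky_fan_M_mat_zero[of "- range \<iota>"] by (simp add: assms(3) cardS)
  have I0: "0 \<le> I (fun_dist s)" if "s \<in> Schwartz" for s using assms(4) that by blast
  let ?inf = "\<lambda>\<Lambda>. INF g\<in>Schwartz. ereal (I (fun_dist g) + \<Lambda> * R (fun_dist g))"

  obtain h T r where h: "regularly_solves M I R h" and r: "strict_mono r" and hT: "weak_conv ((\<lambda>i. fun_dist (h i)) \<circ> r) T"
    using assms(6) unfolding rsol_def Lim_set_def by blast
  from h have hS: "h i \<in> Schwartz" for i unfolding regularly_solves_def by blast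
  from h obtain \<epsilon> \<Lambda> where \<epsilon>: "filterlim \<epsilon> (at_right (0::real)) sequentially" and \<Lambda>: "filterlim \<Lambda> at_top sequentially"
    and hle: "\<And>i. ereal (I (fun_dist (h i)) + \<Lambda> i * R (fun_dist (h i))) \<le> ?inf (\<Lambda> i) + ereal (\<epsilon> i)"
    unfolding regularly_solves_def by blast
  have \<epsilon>0: "\<epsilon> \<longlonglongrightarrow> 0" "\<forall>\<^sub>F i in sequentially. 0 < \<epsilon> i"
    using \<epsilon> by (auto simp: filterlim_at elim: eventually_mono)
  have \<Lambda>0: "\<forall>\<^sub>F i in sequentially. 0 < \<Lambda> i" using \<Lambda> by (simp add: filterlim_at_top_dense)

  have Rh: "(\<lambda>i. R (fun_dist (h i))) \<longlonglongrightarrow> 0"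
  proof (rule tendsto_sandwich[OF _ _ tendsto_const])
    show "\<forall>\<^sub>F i in sequentially. 0 \<le> R (fun_dist (h i))" by (simp add: R0 hS)
    show "\<forall>\<^sub>F i in sequentially. R (fun_dist (h i)) \<le> (I (fun_dist (\<lambda>x. 0)) + \<epsilon> i) / \<Lambda> i"
      using \<Lambda>0
    proof eventually_elim
      case (elim i)
      have "?inf (\<Lambda> i) \<le> ereal (I (fun_dist (\<lambda>x. 0)))"
        by (rule INF_lower2[OF Schwartz_zero]) (simp add: Rzero)
      then have "ereal (I (fun_dist (h i)) + \<Lambda> i * R (fun_dist (h i))) \<le> ereal (I (fun_dist (\<lambda>x. 0))) + ereal (\<epsilon> i)"
        by (rule order_trans[OF hle add_right_mono])
      then have "\<Lambda> i * R (fun_dist (h i)) \<le> I (fun_dist (\<lambda>x. 0)) + \<epsilon> i" using I0[OF hS[of i]] by simp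
      then show ?case using elim by (simp add: pos_le_divide_eq mult.commute)
    qed
    show "(\<lambda>i. (I (fun_dist (\<lambda>x. 0)) + \<epsilon> i) / \<Lambda> i) \<longlonglongrightarrow> 0"
      by (rule real_tendsto_divide_at_top[OF tendsto_add[OF tendsto_const \<epsilon>0(1)] \<Lambda>])
  qed
  have hT': "weak_conv (\<lambda>i. fun_dist (h (r i))) T" using hT by (simp add: o_def)
  have TG: "T \<in> G_tempered \<iota>"
    by (rule weak_limit_in_G_tempered[OF \<iota> hS hT'])
       (use LIMSEQ_subseq_LIMSEQ[OF Rh r] in \<open>simp add: o_def assms(3)\<close>)
  have Ih: "(\<lambda>i. I (fun_dist (h (r i)))) \<longlonglongrightarrow> I T"
    using hS TG hT' by (intro Icont) auto

  fix f assume "f \<in> {f. is_arg_min I (\<lambda>f. f \<in> G_tempered \<iota>) f} \<inter> B_set M \<iota>"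
  then have fG: "f \<in> G_tempered \<iota>" and fmin: "\<And>g. g \<in> G_tempered \<iota> \<Longrightarrow> I f \<le> I g" and fB: "f \<in> B_set M \<iota>"
    by (auto simp: is_arg_min_def not_less)
  from fB obtain C p where p: "\<And>i. p i \<in> G_schwartz \<iota>" "\<And>i. M_mat_defined M (p i)" "\<And>i. trace (M_mat M (p i)) \<le> C"
    and pf: "weak_conv p f"
    unfolding B_set_def seq_closure_def by blast
  \<comment> \<open>small enough to make the penalty of the approximants negligible even after multiplication with \<open>\<Lambda> (r i)\<close>\<close>
  define \<delta> where "\<delta> i = inverse (real (Suc i)) / (1 + \<bar>\<Lambda> (r i)\<bar>)" for i
  have \<delta>: "0 < \<delta> i" for i unfolding \<delta>_def by (simp add: add_pos_nonneg)
  have \<delta>le: "\<delta> i \<le> inverse (real (Suc i))" "\<bar>\<Lambda> (r i)\<bar> * \<delta> i \<le> inverse (real (Suc i))" for i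
  proof -
    have pos: "0 < 1 + \<bar>\<Lambda> (r i)\<bar>" by simp
    have "inverse (real (Suc i)) * 1 \<le> inverse (real (Suc i)) * (1 + \<bar>\<Lambda> (r i)\<bar>)" by (rule mult_left_mono) auto
    then show "\<delta> i \<le> inverse (real (Suc i))" unfolding \<delta>_def pos_divide_le_eq[OF pos] by simp
    have "inverse (real (Suc i)) * \<bar>\<Lambda> (r i)\<bar> \<le> inverse (real (Suc i)) * (1 + \<bar>\<Lambda> (r i)\<bar>)" by (rule mult_left_mono) auto
    then show "\<bar>\<Lambda> (r i)\<bar> * \<delta> i \<le> inverse (real (Suc i))"
      unfolding \<delta>_def times_divide_eq_right pos_divide_le_eq[OF pos] by (simp only: mult.commute)
  qed
  have inv0: "(\<lambda>i. inverse (real (Suc i))) \<longlonglongrightarrow> 0" by (rule LIMSEQ_inverse_real_of_nat)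
  have "\<forall>i. \<exists>u. u \<in> Schwartz \<and> R (fun_dist u) < \<delta> i \<and> trace (M_mat M (fun_dist u)) < trace (M_mat M (p i)) + \<delta> i \<and>
    (\<forall>\<phi>\<in>Schwartz. \<forall>L\<ge>0. (\<forall>x y. norm (\<phi> x - \<phi> y) \<le> L * norm (x - y)) \<longrightarrow> norm (fun_dist u \<phi> - p i \<phi>) \<le> L * \<delta> i)"
    using G_schwartz_approx[OF \<iota> p(1,2) \<delta>] unfolding assms(3) Bex_def by (rule allI)
  from choice[OF this] obtain s where
    s': "\<forall>i. s i \<in> Schwartz \<and> R (fun_dist (s i)) < \<delta> i \<and> trace (M_mat M (fun_dist (s i))) < trace (M_mat M (p i)) + \<delta> i \<and>
    (\<forall>\<phi>\<in>Schwartz. \<forall>L\<ge>0. (\<forall>x y. norm (\<phi> x - \<phi> y) \<le> L * norm (x - y)) \<longrightarrow> norm (fun_dist (s i) \<phi> - p i \<phi>) \<le> L * \<delta> i)" ..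
  have s: "\<And>i. s i \<in> Schwartz" "\<And>i. R (fun_dist (s i)) < \<delta> i" "\<And>i. trace (M_mat M (fun_dist (s i))) < trace (M_mat M (p i)) + \<delta> i"
    "\<And>i \<phi> L. \<phi> \<in> Schwartz \<Longrightarrow> 0 \<le> L \<Longrightarrow> (\<forall>x y. norm (\<phi> x - \<phi> y) \<le> L * norm (x - y)) \<Longrightarrow> norm (fun_dist (s i) \<phi> - p i \<phi>) \<le> L * \<delta> i"
    using s' by simp_all
  have sf: "weak_conv (\<lambda>i. fun_dist (s i)) f"
    unfolding weak_conv_iff
  proof (intro conjI ballI)
    show "f \<in> tempered" using pf unfolding weak_conv_iff by blast
    show "\<forall>\<^sub>F i in sequentially. fun_dist (s i) \<in> tempered" by (simp add: fun_dist_tempered s(1))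
    fix \<phi> :: "real^'n \<Rightarrow> complex" assume \<phi>: "\<phi> \<in> Schwartz"
    obtain L where L: "0 \<le> L" "\<forall>x y. norm (\<phi> x - \<phi> y) \<le> L * norm (x - y)" using Schwartz_Lipschitz[OF \<phi>] by blast
    have "norm (fun_dist (s i) \<phi> - p i \<phi>) \<le> L * inverse (real (Suc i))" for i
      using s(4)[OF \<phi> L, of i] mult_left_mono[OF \<delta>le(1)[of i] L(1)] by linarith
    then have "(\<lambda>i. fun_dist (s i) \<phi> - p i \<phi>) \<longlonglongrightarrow> 0"
      by (intro Lim_null_comparison[OF _ tendsto_mult_right_zero[OF inv0, of L]] always_eventually allI)
    moreover have "(\<lambda>i. p i \<phi>) \<longlonglongrightarrow> f \<phi>" using pf \<phi> unfolding weak_conv_iff by blast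
    ultimately have "(\<lambda>i. (fun_dist (s i) \<phi> - p i \<phi>) + p i \<phi>) \<longlonglongrightarrow> 0 + f \<phi>" by (rule tendsto_add)
    then show "(\<lambda>i. fun_dist (s i) \<phi>) \<longlonglongrightarrow> f \<phi>" by simp
  qed
  have Is: "(\<lambda>i. I (fun_dist (s i))) \<longlonglongrightarrow> I f" using s(1) fG sf by (intro Icont) auto

  \<comment> \<open>for large \<open>i\<close> it bounds the excess of the penalized objective at \<open>s i\<close> over that at \<open>h (r i)\<close>\<close>
  define d where "d i = \<bar>I (fun_dist (s i)) - I f\<bar> + \<bar>I (fun_dist (h (r i))) - I T\<bar> + \<bar>\<Lambda> (r i)\<bar> * R (fun_dist (s i))" for i
  have d0: "0 \<le> d i" for i unfolding d_def by (intro add_nonneg_nonneg mult_nonneg_nonneg R0 s(1)) auto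
  have "(\<lambda>i. \<bar>\<Lambda> (r i)\<bar> * R (fun_dist (s i))) \<longlonglongrightarrow> 0"
  proof (rule tendsto_sandwich[OF _ _ tendsto_const inv0])
    show "\<forall>\<^sub>F i in sequentially. 0 \<le> \<bar>\<Lambda> (r i)\<bar> * R (fun_dist (s i))" by (simp add: R0 s(1))
    have "\<bar>\<Lambda> (r i)\<bar> * R (fun_dist (s i)) \<le> \<bar>\<Lambda> (r i)\<bar> * \<delta> i" for i
      using s(2)[of i] by (intro mult_left_mono) auto
    then show "\<forall>\<^sub>F i in sequentially. \<bar>\<Lambda> (r i)\<bar> * R (fun_dist (s i)) \<le> inverse (real (Suc i))"
      using \<delta>le(2) order_trans by (intro always_eventually allI) blast
  qed
  moreover have "(\<lambda>i. \<bar>I (fun_dist (s i)) - I f\<bar>) \<longlonglongrightarrow> 0" using Is by (intro tendsto_rabs_zero) (simp add: LIM_zero)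
  moreover have "(\<lambda>i. \<bar>I (fun_dist (h (r i))) - I T\<bar>) \<longlonglongrightarrow> 0" using Ih by (intro tendsto_rabs_zero) (simp add: LIM_zero)
  ultimately have dlim: "d \<longlonglongrightarrow> 0 + 0 + 0" unfolding d_def[abs_def] by (intro tendsto_add)
  have \<epsilon>r: "(\<lambda>i. \<epsilon> (r i)) \<longlonglongrightarrow> 0" using LIMSEQ_subseq_LIMSEQ[OF \<epsilon>0(1) r] by (simp add: o_def)
  have rs: "filterlim r sequentially sequentially" using r by (rule filterlim_subseq)
  have "\<forall>\<^sub>F i in sequentially. 0 < \<epsilon> (r i) \<and> 0 < \<Lambda> (r i)"
    using eventually_compose_filterlim[OF eventually_conj[OF \<epsilon>0(2) \<Lambda>0] rs] .
  then obtain N where N: "\<And>i. N \<le> i \<Longrightarrow> 0 < \<epsilon> (r i) \<and> 0 < \<Lambda> (r i)" unfolding eventually_sequentially by blast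
  have main: "ereal (I (fun_dist (s i)) + \<Lambda> (r i) * R (fun_dist (s i))) \<le> ?inf (\<Lambda> (r i)) + ereal (\<epsilon> (r i) + d i)" if i: "N \<le> i" for i
  proof -
    have "0 \<le> \<Lambda> (r i) * R (fun_dist (h (r i)))" using N[OF i] R0[OF hS[of "r i"]] by simp
    then have "I (fun_dist (s i)) + \<Lambda> (r i) * R (fun_dist (s i)) \<le> (I (fun_dist (h (r i))) + \<Lambda> (r i) * R (fun_dist (h (r i)))) + d i"
      using fmin[OF TG] N[OF i] unfolding d_def by simp
    then have "ereal (I (fun_dist (s i)) + \<Lambda> (r i) * R (fun_dist (s i))) \<le> ereal (I (fun_dist (h (r i))) + \<Lambda> (r i) * R (fun_dist (h (r i)))) + ereal (d i)"
      by simp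
    also have "\<dots> \<le> (?inf (\<Lambda> (r i)) + ereal (\<epsilon> (r i))) + ereal (d i)" by (rule add_right_mono[OF hle])
    also have "\<dots> = ?inf (\<Lambda> (r i)) + ereal (\<epsilon> (r i) + d i)" by (simp add: add.assoc)
    finally show ?thesis .
  qed
  \<comment> \<open>the inequality is available only from \<open>N\<close> on, where the multipliers and tolerances are positive\<close>
  have "regularly_solves M I R (\<lambda>i. s (i + N))"
    unfolding regularly_solves_def
  proof (intro conjI)
    show "range (\<lambda>i. s (i + N)) \<subseteq> Schwartz" using s(1) by auto
    show "\<exists>\<epsilon> \<Lambda>. filterlim \<epsilon> (at_right (0::real)) sequentially \<and> filterlim \<Lambda> at_top sequentially \<and>
      (\<forall>i. ereal (I (fun_dist (s (i + N))) + \<Lambda> i * R (fun_dist (s (i + N)))) \<le> ?inf (\<Lambda> i) + ereal (\<epsilon> i))"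
    proof (rule exI[of _ "\<lambda>i. \<epsilon> (r (i + N)) + d (i + N)"], rule exI[of _ "\<lambda>i. \<Lambda> (r (i + N))"], intro conjI allI)
      have "(\<lambda>i. \<epsilon> (r i) + d i) \<longlonglongrightarrow> 0 + 0" using \<epsilon>r dlim by (intro tendsto_add) auto
      then have "(\<lambda>i. \<epsilon> (r (i + N)) + d (i + N)) \<longlonglongrightarrow> 0" using LIMSEQ_ignore_initial_segment by fastforce
      moreover have "0 < \<epsilon> (r (i + N)) + d (i + N)" for i using N[of "i + N"] d0[of "i + N"] by simp
      ultimately show "filterlim (\<lambda>i. \<epsilon> (r (i + N)) + d (i + N)) (at_right 0) sequentially"
        unfolding filterlim_at by (auto simp: less_imp_neq[symmetric])
      show "filterlim (\<lambda>i. \<Lambda> (r (i + N))) at_top sequentially"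
        by (rule filterlim_compose[OF \<Lambda> filterlim_compose[OF rs filterlim_add_const_nat_at_top]])
      show "ereal (I (fun_dist (s (i + N))) + \<Lambda> (r (i + N)) * R (fun_dist (s (i + N)))) \<le> ?inf (\<Lambda> (r (i + N))) + ereal (\<epsilon> (r (i + N)) + d (i + N))" for i
        by (rule main) simp
    qed
    have "norm (trace (M_mat M (fun_dist (s i)))) \<le> C + 1" for i
    proof -
      have "\<delta> i \<le> 1" using \<delta>le(1)[of i] by (rule order_trans) (simp add: field_simps)
      then show ?thesis using trace_M_mat_nonneg[OF s(1)[of i]] s(3)[of i] p(3)[of i] by simp
    qed
    then show "bounded (range (\<lambda>i. trace (M_mat M (fun_dist (s (i + N))))))" unfolding bounded_iff by blast
  qed
  moreover have "f \<in> Lim_set (\<lambda>i. fun_dist (s (i + N)))"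
  proof -
    have "strict_mono (\<lambda>i. i + N)" by (simp add: strict_mono_def)
    have "weak_conv (\<lambda>i. fun_dist (s (i + N))) f"
      using sf unfolding weak_conv_iff by (auto simp: fun_dist_tempered s(1) intro: LIMSEQ_ignore_initial_segment)
    then show ?thesis unfolding Lim_set_def by (auto intro!: exI[of _ "\<lambda>i. i"] simp: strict_mono_def o_def)
  qed
  ultimately show "f \<in> rsol M I R" unfolding rsol_def by blast
qed

end
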